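(* Let $f: M \to M$ be a $C^1$ partially hyperbolic diffeomorphism. If $f$ has the $g$-almost product property, then $$h_{\mathrm B}(f, CI)\geq h^u_{\mathrm B}(f,M),$$ where $CI$ is the completely irregular set of $f$.
   Context: Setting. $M$ is a smooth, connected, compact Riemannian manifold without boundary. A $C^1$-diffeomorphism $f:M\to M$ is a $C^1$ partially hyperbolic diffeomorphism if there is a nontrivial $Df$-invariant splitting $TM=E^s\oplus E^c\oplus E^u$ such that, for some suitable Riemannian metric, all unit vectors $v^\sigma\in E^\sigma(x)$ ($\sigma=s,c,u$, $x\in M$) satisfy $\|D_xfv^s\|<\|D_xfv^c\|<\|D_xfv^u\|$, and $\|D_xf|_{E^s(x)}\|<1$, $\|D_xf^{-1}|_{E^u(x)}\|<1$. $W^u$ is the unstable foliation (tangent to $E^u$), $d$ the Riemannian distance on $M$, $d^u$ the distance induced by the Riemannian structure on the leaves of $W^u$, and $W^u(x,\delta)$ the open $d^u$-ball in $W^u(x)$ of center $x$ and radius $\delta$. Completely irregular set. For continuous $\varphi:M\to\mathbb R$, let $I_\varphi=\{x\in M:\frac1n\sum_{i=0}^{n-1}\varphi(f^ix)\text{ does not converge as }n\to\infty\}$. Let $C^*(M,\mathbb R)$ be the set of continuous $\varphi:M\to\mathbb R$ with $I_\varphi\ne\emptyset$, and $CI=\bigcap_{\varphi\in C^*(M,\mathbb R)}I_\varphi$ (an empty intersection being $M$). $g$-almost product property (Pfister–Sullivan). Let $g:\mathbb N\to\mathbb N$ be a nondecreasing unbounded function with $g(n)<n$ and $\lim_{n\to\infty}g(n)/n=0$.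 For $x\in M$, $\epsilon>0$, let $B_n(g;x,\epsilon)$ be the set of $y\in M$ for which there is $\Lambda\subset\{0,\dots,n-1\}$ with $\#(\{0,\dots,n-1\}\setminus\Lambda)\le g(n)$ and $d(f^jx,f^jy)\le\epsilon$ for all $j\in\Lambda$. $f$ has the $g$-almost product property (with this $g$) if there is a nonincreasing function $m:(0,\infty)\to\mathbb N$ such that for any $k\ge1$, any $x_1,\dots,x_k\in M$, any $\epsilon_1,\dots,\epsilon_k>0$ and any integers $n_i\ge m(\epsilon_i)$, $\bigcap_{j=1}^kf^{-M_{j-1}}B_{n_j}(g;x_j,\epsilon_j)\ne\emptyset$, where $M_0=0$, $M_j=n_1+\dots+n_j$. Bowen entropies. For a finite open cover $\mathcal U$ of $M$ and $n\ge1$, $\mathcal W_n(\mathcal U)$ is the set of strings $\mathbf U=U_{i_0}\cdots U_{i_{n-1}}$ with entries in $\mathcal U$; write $m(\mathbf U)=n$ and $X(\mathbf U)=\{x\in M: f^j(x)\in U_{i_j},\ 0\le j\le m(\mathbf U)-1\}$. For $Y\subset M$, $s\in\mathbb R$, let $\mathcal M_N^s(\mathcal U,Y)=\inf_{\mathcal G}\sum_{\mathbf U\in\mathcal G}e^{-s\,m(\mathbf U)}$, the infimum over all $\mathcal G\subset\bigcup_{j\ge N}\mathcal W_j(\mathcal U)$ with $\bigcup_{\mathbf U\in\mathcal G}X(\mathbf U)\supset Y$; $\mathcal M^s(\mathcal U,Y)=\lim_{N\to\infty}\mathcal M_N^s(\mathcal U,Y)$; $h_{\mathrm B}(f,\mathcal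 U,Y)=\inf\{s:\mathcal M^s(\mathcal U,Y)=0\}$; $h_{\mathrm B}(f,Y)=\sup_{\mathcal U}h_{\mathrm B}(f,\mathcal U,Y)$ over finite open covers $\mathcal U$ of $M$. The Bowen unstable topological entropy of $Z\subset M$ is $$h^u_{\mathrm B}(f,Z)=\lim_{\delta\to0}\sup_{x\in M}h_{\mathrm B}(f,\overline{W^u(x,\delta)}\cap Z).$$ *)

theory Defs
  imports "HOL-Analysis.Analysis"
begin

section \<open>Smooth manifolds and their tangent bundles\<close>

text \<open>\<open>C_k_on k f S\<close>: \<open>f\<close> is of class \<open>C\<^sup>k\<close> on \<open>S\<close>, meant for open \<open>S\<close> in a finite-dimensional domain.\<close>

primrec C_k_on ::
  "nat \<Rightarrow> ('a::real_normed_vector \<Rightarrow> 'b::real_normed_vector) \<Rightarrow> 'a set \<Rightarrow> bool" where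
  "C_k_on 0 f S \<longleftrightarrow> continuous_on S f"
| "C_k_on (Suc k) f S \<longleftrightarrow>
     f differentiable_on S \<and> (\<forall>v. C_k_on k (\<lambda>x. frechet_derivative f (at x) v) S)"

text \<open>The manifold is the whole type \<open>'m\<close>; charts take values in a Euclidean space \<open>'e\<close> with
  \<open>DIM('e) = dim M\<close>. Charts have open images in \<open>'e\<close>, so there is no boundary. Second
  countability is not required: it follows from compactness of \<open>'m\<close>, which is assumed where needed.\<close>

type_synonym ('m, 'e) chart = "'m set \<times> ('m \<Rightarrow> 'e)"

abbreviation cdom :: "('m, 'e) chart \<Rightarrow> 'm set" where "cdom \<equiv> fst"

abbreviation coord :: "('m, 'e) chart \<Rightarrow> 'm \<Rightarrow> 'e" where "coord \<equiv> snd"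

definition param :: "('m, 'e) chart \<Rightarrow> 'e \<Rightarrow> 'm" where
  "param c = inv_into (cdom c) (coord c)"

definition smooth_atlas :: "('m::t2_space, 'e::euclidean_space) chart set \<Rightarrow> bool" where
  "smooth_atlas A \<longleftrightarrow>
     (\<forall>c\<in>A. open (cdom c) \<and> open (coord c ` cdom c) \<and>
        homeomorphism (cdom c) (coord c ` cdom c) (coord c) (param c)) \<and>
     (\<Union>c\<in>A. cdom c) = UNIV \<and>
     (\<forall>c\<in>A. \<forall>d\<in>A. \<forall>k. C_k_on k (coord d \<circ> param c) (coord c ` (cdom c \<inter> cdom d)))"

text \<open>The tangent space at \<open>x\<close> is modelled on \<open>'e\<close>, a tangent vector at \<open>x\<close> being given by its
  coordinates in a preferred chart \<open>chart_at A x\<close> around \<open>x\<close>. The preferred chart varies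
  discontinuously with \<open>x\<close>, so regularity of fields of vectors, subspaces or forms is always
  expressed in a fixed chart \<open>c\<close>, using the linear isomorphism \<open>vec_of_coords A c x\<close> which turns the
  coordinates of a tangent vector at \<open>x\<close> in \<open>c\<close> into those in the preferred chart.\<close>

definition chart_at :: "('m, 'e) chart set \<Rightarrow> 'm \<Rightarrow> ('m, 'e) chart" where
  "chart_at A x = (SOME c. c \<in> A \<and> x \<in> cdom c)"

definition vec_of_coords ::
  "('m, 'e::euclidean_space) chart set \<Rightarrow> ('m, 'e) chart \<Rightarrow> 'm \<Rightarrow> 'e \<Rightarrow> 'e" where
  "vec_of_coords A c x = frechet_derivative (coord (chart_at A x) \<circ> param c) (at (coord c x))"

definition C1_map ::
  "('m::t2_space, 'e::euclidean_space) chart set \<Rightarrow> ('m \<Rightarrow> 'm) \<Rightarrow> bool" where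
  "C1_map A f \<longleftrightarrow> continuous_on UNIV f \<and>
     (\<forall>c\<in>A. \<forall>d\<in>A. C_k_on 1 (coord d \<circ> f \<circ> param c) (coord c ` (cdom c \<inter> f -` cdom d)))"

definition C1_diffeomorphism ::
  "('m::t2_space, 'e::euclidean_space) chart set \<Rightarrow> ('m \<Rightarrow> 'm) \<Rightarrow> bool" where
  "C1_diffeomorphism A f \<longleftrightarrow> bij f \<and> C1_map A f \<and> C1_map A (inv f)"

text \<open>The derivative \<open>D\<^sub>xf\<close> from the tangent space at \<open>x\<close> to the one at \<open>f x\<close>.\<close>

definition tangent_map ::
  "('m, 'e::euclidean_space) chart set \<Rightarrow> ('m \<Rightarrow> 'm) \<Rightarrow> 'm \<Rightarrow> 'e \<Rightarrow> 'e" where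
  "tangent_map A f x =
     frechet_derivative (coord (chart_at A (f x)) \<circ> f \<circ> param (chart_at A x))
       (at (coord (chart_at A x) x))"

text \<open>A continuous vector subbundle of the tangent bundle, described by local continuous frames.\<close>

definition continuous_subbundle ::
  "('m::t2_space, 'e::euclidean_space) chart set \<Rightarrow> ('m \<Rightarrow> 'e set) \<Rightarrow> bool" where
  "continuous_subbundle A E \<longleftrightarrow>
     (\<forall>c\<in>A. \<forall>x\<in>cdom c. \<exists>V k (b :: nat \<Rightarrow> 'm \<Rightarrow> 'e).
        open V \<and> x \<in> V \<and> V \<subseteq> cdom c \<and> (\<forall>i<k. continuous_on V (b i)) \<and>
        (\<forall>y\<in>V. inj_on (\<lambda>i. b i y) {..<k} \<and> independent ((\<lambda>i. b i y) ` {..<k}) \<and>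
           E y = vec_of_coords A c y ` span ((\<lambda>i. b i y) ` {..<k})))"


section \<open>Riemannian metrics and distances\<close>

definition riemannian_metric ::
  "('m::t2_space, 'e::euclidean_space) chart set \<Rightarrow> ('m \<Rightarrow> 'e \<Rightarrow> 'e \<Rightarrow> real) \<Rightarrow> bool" where
  "riemannian_metric A G \<longleftrightarrow>
     (\<forall>x. bilinear (G x) \<and> (\<forall>v w. G x v w = G x w v) \<and> (\<forall>v. v \<noteq> 0 \<longrightarrow> G x v v > 0)) \<and>
     (\<forall>c\<in>A. \<forall>v w. \<forall>k.
        C_k_on k (\<lambda>y. G (param c y) (vec_of_coords A c (param c y) v) (vec_of_coords A c (param c y) w))
          (coord c ` cdom c))"

definition tnorm :: "('m \<Rightarrow> 'e \<Rightarrow> 'e \<Rightarrow> real) \<Rightarrow> 'm \<Rightarrow> 'e \<Rightarrow> real" where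
  "tnorm G x v = sqrt (G x v v)"

text \<open>Operator norm, for the metric \<open>G\<close>, of the restriction to \<open>E\<close> of a linear map \<open>L\<close> from the
  tangent space at \<open>x\<close> to the tangent space at \<open>y\<close>. Using the closed unit ball rather than the unit
  sphere makes it \<open>0\<close> for \<open>E = {0}\<close>.\<close>

definition restricted_opnorm ::
  "('m \<Rightarrow> 'e \<Rightarrow> 'e \<Rightarrow> real) \<Rightarrow> 'm \<Rightarrow> 'm \<Rightarrow> ('e \<Rightarrow> 'e) \<Rightarrow> 'e set \<Rightarrow> real" where
  "restricted_opnorm G x y L E = Sup {tnorm G y (L v) |v. v \<in> E \<and> tnorm G x v \<le> 1}"

definition C1_curve_on ::
  "('m::t2_space, 'e::euclidean_space) chart set \<Rightarrow> real \<Rightarrow> real \<Rightarrow> (real \<Rightarrow> 'm) \<Rightarrow> bool" where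
  "C1_curve_on A a b \<gamma> \<longleftrightarrow> continuous_on {a..b} \<gamma> \<and>
     (\<forall>c\<in>A. \<exists>D. continuous_on ({a..b} \<inter> \<gamma> -` cdom c) D \<and>
        (\<forall>t \<in> {a..b} \<inter> \<gamma> -` cdom c.
           ((coord c \<circ> \<gamma>) has_vector_derivative D t) (at t within {a..b})))"

definition piecewise_C1_path ::
  "('m::t2_space, 'e::euclidean_space) chart set \<Rightarrow> (real \<Rightarrow> 'm) \<Rightarrow> bool" where
  "piecewise_C1_path A \<gamma> \<longleftrightarrow> continuous_on {0..1} \<gamma> \<and>
     (\<exists>S. finite S \<and>
        (\<forall>a b. 0 \<le> a \<and> a < b \<and> b \<le> 1 \<and> {a<..<b} \<inter> S = {} \<longrightarrow> C1_curve_on A a b \<gamma>))"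

definition velocity ::
  "('m::t2_space, 'e::euclidean_space) chart set \<Rightarrow> (real \<Rightarrow> 'm) \<Rightarrow> real \<Rightarrow> 'e" where
  "velocity A \<gamma> t = vector_derivative (coord (chart_at A (\<gamma> t)) \<circ> \<gamma>) (at t)"

text \<open>For a piecewise \<open>C\<^sup>1\<close> path the velocity is meaningful except at finitely many times, which do
  not affect the integral.\<close>

definition path_length ::
  "('m::t2_space, 'e::euclidean_space) chart set \<Rightarrow> ('m \<Rightarrow> 'e \<Rightarrow> 'e \<Rightarrow> real) \<Rightarrow> (real \<Rightarrow> 'm) \<Rightarrow> real" where
  "path_length A G \<gamma> = integral {0..1} (\<lambda>t. tnorm G (\<gamma> t) (velocity A \<gamma> t))"

text \<open>The length distance obtained from piecewise \<open>C\<^sup>1\<close> paths lying in \<open>L\<close>: the Riemannian distance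
  for \<open>L = UNIV\<close>, and the intrinsic leaf distance if \<open>L\<close> is a leaf of a foliation. (A \<open>C\<^sup>1\<close> curve of
  the manifold contained in a leaf is a \<open>C\<^sup>1\<close> curve of that leaf, since leaves are weakly
  embedded.)\<close>

definition length_dist ::
  "('m::t2_space, 'e::euclidean_space) chart set \<Rightarrow> ('m \<Rightarrow> 'e \<Rightarrow> 'e \<Rightarrow> real) \<Rightarrow>
     'm set \<Rightarrow> 'm \<Rightarrow> 'm \<Rightarrow> real" where
  "length_dist A G L x y =
     Inf {path_length A G \<gamma> |\<gamma>. piecewise_C1_path A \<gamma> \<and> \<gamma> ` {0..1} \<subseteq> L \<and> \<gamma> 0 = x \<and> \<gamma> 1 = y}"

abbreviation riemannian_dist ::
  "('m::t2_space, 'e::euclidean_space) chart set \<Rightarrow> ('m \<Rightarrow> 'e \<Rightarrow> 'e \<Rightarrow> real) \<Rightarrow> 'm \<Rightarrow> 'm \<Rightarrow> real" where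
  "riemannian_dist A G \<equiv> length_dist A G UNIV"


section \<open>Partial hyperbolicity and the unstable foliation\<close>

text \<open>The metric \<open>G\<close> bound here is the adapted one; it need not be the metric of the manifold.
  Nontriviality of the splitting means that none of the three bundles is the whole tangent bundle,
  i.e. that at least two of them are nonzero. The two domination inequalities are stated separately
  so that they retain their meaning if one of the bundles is zero.\<close>

definition partially_hyperbolic ::
  "('m::t2_space, 'e::euclidean_space) chart set \<Rightarrow> ('m \<Rightarrow> 'm) \<Rightarrow>
     ('m \<Rightarrow> 'e set) \<Rightarrow> ('m \<Rightarrow> 'e set) \<Rightarrow> ('m \<Rightarrow> 'e set) \<Rightarrow> bool" where
  "partially_hyperbolic A f Es Ec Eu \<longleftrightarrow>
     C1_diffeomorphism A f \<and>
     continuous_subbundle A Es \<and> continuous_subbundle A Ec \<and> continuous_subbundle A Eu \<and>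
     (\<forall>x v. \<exists>!(a, b, c). a \<in> Es x \<and> b \<in> Ec x \<and> c \<in> Eu x \<and> v = a + b + c) \<and>
     (\<forall>x. Es x \<noteq> UNIV \<and> Ec x \<noteq> UNIV \<and> Eu x \<noteq> UNIV) \<and>
     (\<forall>x. tangent_map A f x ` Es x = Es (f x) \<and>
          tangent_map A f x ` Ec x = Ec (f x) \<and>
          tangent_map A f x ` Eu x = Eu (f x)) \<and>
     (\<exists>G. riemannian_metric A G \<and>
        (\<forall>x. \<forall>vs\<in>Es x. \<forall>vc\<in>Ec x. tnorm G x vs = 1 \<and> tnorm G x vc = 1 \<longrightarrow>
           tnorm G (f x) (tangent_map A f x vs) < tnorm G (f x) (tangent_map A f x vc)) \<and>
        (\<forall>x. \<forall>vc\<in>Ec x. \<forall>vu\<in>Eu x. tnorm G x vc = 1 \<and> tnorm G x vu = 1 \<longrightarrow>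
           tnorm G (f x) (tangent_map A f x vc) < tnorm G (f x) (tangent_map A f x vu)) \<and>
        (\<forall>x. restricted_opnorm G x (f x) (tangent_map A f x) (Es x) < 1) \<and>
        (\<forall>x. restricted_opnorm G x (inv f x) (tangent_map A (inv f) x) (Eu x) < 1))"

text \<open>A foliation is given by the map \<open>W\<close> sending a point to the leaf through it. A foliation box is
  parametrised by the product of the open unit balls of a subspace \<open>P\<close> (leaf direction) and of its
  orthogonal complement (transverse direction). The parametrisation \<open>h\<close> is a homeomorphism, and
  \<open>C\<^sup>1\<close> along the plaques, with injective derivative of image \<open>E\<close>; \<open>D z\<close> is the derivative of the
  plaque through \<open>h z\<close>, read in the chart \<open>c\<close>. The last clause says that a leaf meets the box in at
  most countably many plaques.\<close>

definition box_domain :: "'e::euclidean_space set \<Rightarrow> 'e set" where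
  "box_domain P = {p + q |p q. p \<in> P \<and> norm p < 1 \<and> q \<in> P\<^sup>\<bottom> \<and> norm q < 1}"

definition plaque :: "('e::euclidean_space \<Rightarrow> 'm) \<Rightarrow> 'e set \<Rightarrow> 'e \<Rightarrow> 'm set" where
  "plaque h P q = {h (p + q) |p. p \<in> P \<and> norm p < 1}"

definition foliation_box ::
  "('m::t2_space, 'e::euclidean_space) chart set \<Rightarrow> ('m \<Rightarrow> 'e set) \<Rightarrow> ('m \<Rightarrow> 'm set) \<Rightarrow>
     'e set \<Rightarrow> ('e \<Rightarrow> 'm) \<Rightarrow> bool" where
  "foliation_box A E W P h \<longleftrightarrow>
     subspace P \<and> open (h ` box_domain P) \<and>
     (\<exists>h'. homeomorphism (box_domain P) (h ` box_domain P) h h') \<and>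
     (\<forall>c\<in>A. \<exists>D.
        (\<forall>v\<in>P. continuous_on (box_domain P \<inter> h -` cdom c) (\<lambda>z. D z v)) \<and>
        (\<forall>z \<in> box_domain P \<inter> h -` cdom c.
           ((coord c \<circ> h) has_derivative D z) (at z within {z + p |p. p \<in> P}) \<and>
           inj_on (D z) P \<and> E (h z) = vec_of_coords A c (h z) ` (D z ` P))) \<and>
     (\<forall>q \<in> P\<^sup>\<bottom>. norm q < 1 \<longrightarrow> (\<forall>y \<in> plaque h P q. plaque h P q \<subseteq> W y)) \<and>
     (\<forall>x. countable {q \<in> P\<^sup>\<bottom>. norm q < 1 \<and> plaque h P q \<subseteq> W x})"

text \<open>A continuous foliation with \<open>C\<^sup>1\<close> leaves tangent to \<open>E\<close>: a partition into leaves that are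
  connected (by paths in the leaf), covered by foliation boxes.\<close>

definition foliation_tangent_to ::
  "('m::t2_space, 'e::euclidean_space) chart set \<Rightarrow> ('m \<Rightarrow> 'e set) \<Rightarrow> ('m \<Rightarrow> 'm set) \<Rightarrow> bool" where
  "foliation_tangent_to A E W \<longleftrightarrow>
     (\<forall>x. x \<in> W x) \<and> (\<forall>x. \<forall>y \<in> W x. W y = W x) \<and>
     (\<forall>x. \<forall>y \<in> W x. \<exists>\<gamma>. piecewise_C1_path A \<gamma> \<and> \<gamma> ` {0..1} \<subseteq> W x \<and> \<gamma> 0 = x \<and> \<gamma> 1 = y) \<and>
     (\<forall>x. \<exists>P h. foliation_box A E W P h \<and> x \<in> h ` box_domain P)"

definition leaf_ball ::
  "('m::t2_space, 'e::euclidean_space) chart set \<Rightarrow> ('m \<Rightarrow> 'e \<Rightarrow> 'e \<Rightarrow> real) \<Rightarrow>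
     ('m \<Rightarrow> 'm set) \<Rightarrow> 'm \<Rightarrow> real \<Rightarrow> 'm set" where
  "leaf_ball A G W x \<delta> = {y \<in> W x. length_dist A G (W x) x y < \<delta>}"


section \<open>The completely irregular set\<close>

definition irregular_set :: "('m \<Rightarrow> 'm) \<Rightarrow> ('m \<Rightarrow> real) \<Rightarrow> 'm set" where
  "irregular_set f \<phi> = {x. \<not> convergent (\<lambda>n. (1 / real n) * (\<Sum>i<n. \<phi> ((f ^^ i) x)))}"

definition completely_irregular_set :: "('m::topological_space \<Rightarrow> 'm) \<Rightarrow> 'm set" where
  "completely_irregular_set f =
     (\<Inter>\<phi> \<in> {\<phi>. continuous_on UNIV \<phi> \<and> irregular_set f \<phi> \<noteq> {}}. irregular_set f \<phi>)"


section \<open>The almost product property\<close>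

text \<open>The bound \<open>g n < n\<close> can only be required for positive \<open>n\<close>.\<close>

definition mistake_function :: "(nat \<Rightarrow> nat) \<Rightarrow> bool" where
  "mistake_function g \<longleftrightarrow> mono g \<and> (\<forall>K. \<exists>n. K < g n) \<and> (\<forall>n\<ge>1. g n < n) \<and>
     (\<lambda>n. real (g n) / real n) \<longlonglongrightarrow> 0"

definition g_dynamical_ball ::
  "('m \<Rightarrow> 'm \<Rightarrow> real) \<Rightarrow> ('m \<Rightarrow> 'm) \<Rightarrow> (nat \<Rightarrow> nat) \<Rightarrow> nat \<Rightarrow> 'm \<Rightarrow> real \<Rightarrow> 'm set" where
  "g_dynamical_ball d f g n x \<epsilon> =
     {y. \<exists>\<Lambda> \<subseteq> {..<n}. card ({..<n} - \<Lambda>) \<le> g n \<and> (\<forall>j\<in>\<Lambda>. d ((f ^^ j) x) ((f ^^ j) y) \<le> \<epsilon>)}"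

definition almost_product_property ::
  "('m \<Rightarrow> 'm \<Rightarrow> real) \<Rightarrow> ('m \<Rightarrow> 'm) \<Rightarrow> (nat \<Rightarrow> nat) \<Rightarrow> bool" where
  "almost_product_property d f g \<longleftrightarrow>
     (\<exists>m :: real \<Rightarrow> nat. antimono_on {0<..} m \<and>
        (\<forall>k::nat. k \<ge> 1 \<longrightarrow> (\<forall>x \<epsilon> n. (\<forall>j\<in>{1..k}. \<epsilon> j > 0 \<and> n j \<ge> m (\<epsilon> j)) \<longrightarrow>
           (\<Inter>j\<in>{1..k}. (f ^^ (\<Sum>i\<in>{1..<j}. n i)) -` g_dynamical_ball d f g (n j) (x j) (\<epsilon> j)) \<noteq> {})))"


section \<open>Bowen entropies\<close>

text \<open>A string over the cover \<open>U\<close> is a nonempty list with entries in \<open>U\<close>. Entropies are extended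
  reals; in particular the empty set has entropy \<open>-\<infinity>\<close>.\<close>

definition string_set :: "('m \<Rightarrow> 'm) \<Rightarrow> 'm set list \<Rightarrow> 'm set" where
  "string_set f w = {x. \<forall>j < length w. (f ^^ j) x \<in> w ! j}"

definition bowen_M_N ::
  "('m \<Rightarrow> 'm) \<Rightarrow> 'm set set \<Rightarrow> 'm set \<Rightarrow> real \<Rightarrow> nat \<Rightarrow> ennreal" where
  "bowen_M_N f U Y s N =
     (INF \<G> \<in> {\<G>. \<G> \<subseteq> {w \<in> lists U. w \<noteq> [] \<and> N \<le> length w} \<and> Y \<subseteq> (\<Union>w\<in>\<G>. string_set f w)}.
        \<Sum>\<^sub>\<infinity>w\<in>\<G>. ennreal (exp (- s * real (length w))))"

definition bowen_M :: "('m \<Rightarrow> 'm) \<Rightarrow> 'm set set \<Rightarrow> 'm set \<Rightarrow> real \<Rightarrow> ennreal" where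
  "bowen_M f U Y s = lim (\<lambda>N. bowen_M_N f U Y s N)"

definition bowen_entropy_cover :: "('m \<Rightarrow> 'm) \<Rightarrow> 'm set set \<Rightarrow> 'm set \<Rightarrow> ereal" where
  "bowen_entropy_cover f U Y = Inf (ereal ` {s. bowen_M f U Y s = 0})"

definition bowen_entropy :: "('m::topological_space \<Rightarrow> 'm) \<Rightarrow> 'm set \<Rightarrow> ereal" where
  "bowen_entropy f Y =
     (SUP U \<in> {U. finite U \<and> (\<forall>V\<in>U. open V) \<and> \<Union>U = UNIV}. bowen_entropy_cover f U Y)"

definition unstable_bowen_entropy ::
  "('m::t2_space, 'e::euclidean_space) chart set \<Rightarrow> ('m \<Rightarrow> 'e \<Rightarrow> 'e \<Rightarrow> real) \<Rightarrow>
     ('m \<Rightarrow> 'm set) \<Rightarrow> ('m \<Rightarrow> 'm) \<Rightarrow> 'm set \<Rightarrow> ereal" where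
  "unstable_bowen_entropy A G W f Z =
     Lim (at_right 0) (\<lambda>\<delta>. SUP x. bowen_entropy f (closure (leaf_ball A G W x \<delta>) \<inter> Z))"

end

theory Submission
  imports Defs
begin

text \<open>The unstable entropy is at most the entropy \<open>h\<close> of the whole space, so only \<open>h \<le> h(CI)\<close> matters,
  and this needs nothing but the compactness of \<open>M\<close>, the continuity of \<open>f\<close> and the almost product
  property. No invariant measures are used. Counting the strings at small Hamming distance shows that
  for large \<open>p\<close> there are about \<open>exp (h p)\<close> orbit segments of length \<open>p\<close> any two of which are apart at a
  fixed proportion of times; they stay apart under shadowing with few mistakes. Follow such segments
  freely, and interrupt them when the elapsed time reaches \<open>n k / \<theta>\<close> by one prescribed segment
  \<open>(y k, n k)\<close>. If \<open>n k\<close> grows geometrically this costs a proportion \<open>O(\<theta>)\<close> of the entropy. If the averages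
  of \<open>\<phi>\<close> converged along the resulting orbit, then also over the prescribed segments, whatever happens
  on the free ones; so it suffices that the averages of \<open>\<phi>\<close> over the \<open>(y k, n k)\<close> diverge for all \<open>\<phi>\<close> with
  an irregular point, which is arranged using the separability of the space of continuous functions.\<close>

section \<open>Bowen entropies\<close>

text \<open>Mistakes are the obstacle to the usual count: two orbits that are apart at a single time
  may have a common shadow, whereas a positive proportion of separating times survives. The
  prescribed segments must be rare and yet influential. Geometric growth keeps all earlier ones
  together no longer than the current one, so they fill at most the proportion 2 \<theta> of the
  time, while each is at least a fixed fraction of the time elapsed before it. As a lower bound at a
  given exponent \<open>s < h\<close> is wanted, \<theta> can be fixed in advance and need not tend
  to 0 along the orbit. The manifold is given as a Hausdorff type with a distance defined by path
  lengths. Its topology is metrised by an auxiliary \<open>D\<close>, and a one-sided comparison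
  suffices: points close in the Riemannian distance are close for \<open>D\<close>, so shadowing
  carries over.\<close>

lemma bowen_M_N_mono_set:
  assumes "Y \<subseteq> Z"
  shows "bowen_M_N f U Y s N \<le> bowen_M_N f U Z s N"
  unfolding bowen_M_N_def by (rule INF_superset_mono) (use assms in auto)

lemma incseq_bowen_M_N: "incseq (bowen_M_N f U Y s)"
  unfolding incseq_def bowen_M_N_def
  by (intro allI impI INF_superset_mono) auto

lemma bowen_M_eq_SUP: "bowen_M f U Y s = (SUP N. bowen_M_N f U Y s N)"
  unfolding bowen_M_def
  by (rule limI, rule LIMSEQ_SUP, rule incseq_bowen_M_N)

lemma bowen_M_mono_set:
  assumes "Y \<subseteq> Z"
  shows "bowen_M f U Y s \<le> bowen_M f U Z s"
  unfolding bowen_M_eq_SUP by (intro SUP_mono') (rule bowen_M_N_mono_set[OF assms])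

lemma bowen_entropy_cover_mono:
  assumes "Y \<subseteq> Z"
  shows "bowen_entropy_cover f U Y \<le> bowen_entropy_cover f U Z"
proof -
  have "bowen_M f U Y s = 0" if "bowen_M f U Z s = 0" for s
    using bowen_M_mono_set[OF assms, of f U s] that by simp
  then show ?thesis
    unfolding bowen_entropy_cover_def by (intro Inf_superset_mono image_mono) auto
qed

lemma bowen_entropy_mono:
  assumes "Y \<subseteq> Z"
  shows "bowen_entropy f Y \<le> bowen_entropy f Z"
  unfolding bowen_entropy_def
  by (intro SUP_mono') (rule bowen_entropy_cover_mono[OF assms])

lemma tendsto_at_right_mono_INF:
  fixes h :: "real \<Rightarrow> ereal"
  assumes mono: "\<And>x y. \<lbrakk>a < x; x \<le> y\<rbrakk> \<Longrightarrow> h x \<le> h y"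
  shows "(h \<longlongrightarrow> (INF x\<in>{a<..}. h x)) (at_right a)"
proof (rule order_tendstoI)
  fix c assume c: "c < (INF x\<in>{a<..}. h x)"
  show "\<forall>\<^sub>F x in at_right a. c < h x"
    by (rule eventually_at_rightI[where b = "a + 1"])
      (use c in \<open>auto intro: less_le_trans INF_lower\<close>)
next
  fix c assume "(INF x\<in>{a<..}. h x) < c"
  then obtain b where "a < b" "h b < c" by (auto simp: INF_less_iff)
  then show "\<forall>\<^sub>F x in at_right a. h x < c"
    by (intro eventually_at_rightI[where b = b])
      (auto intro: le_less_trans[OF mono[of _ b]])
qed

text \<open>\<open>Lim\<close> is meaningful only if a limit exists. Leaf balls grow with \<delta>,
  so the entropies are monotone and the limit is their infimum; the value at
  \<open>\<delta> = 1\<close> already bounds it.\<close>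

lemma unstable_bowen_entropy_le:
  "unstable_bowen_entropy A G W f UNIV \<le> bowen_entropy f UNIV"
proof -
  define h where "h = (\<lambda>\<delta>. SUP x. bowen_entropy f (closure (leaf_ball A G W x \<delta>) \<inter> UNIV))"
  have "h x \<le> h y" if "x \<le> y" for x y
  proof -
    have "leaf_ball A G W z x \<subseteq> leaf_ball A G W z y" for z
      using that by (auto simp: leaf_ball_def)
    then show ?thesis
      unfolding h_def
      by (intro SUP_mono' bowen_entropy_mono Int_mono closure_mono) auto
  qed
  then have "(h \<longlongrightarrow> (INF \<delta>\<in>{0<..}. h \<delta>)) (at_right 0)"
    by (intro tendsto_at_right_mono_INF)
  then have "Lim (at_right 0) h = (INF \<delta>\<in>{0<..}. h \<delta>)"
    by (intro tendsto_Lim) auto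
  also have "\<dots> \<le> h 1"
    by (intro INF_lower) auto
  also have "\<dots> \<le> bowen_entropy f UNIV"
    unfolding h_def by (intro SUP_least bowen_entropy_mono) auto
  finally show ?thesis
    unfolding unstable_bowen_entropy_def h_def .
qed

lemma bowen_M_N_le:
  assumes "finite \<G>" "\<G> \<subseteq> {w \<in> lists U. w \<noteq> [] \<and> length w = n}" "N \<le> n"
    and "Y \<subseteq> (\<Union>w\<in>\<G>. string_set f w)"
  shows "bowen_M_N f U Y s N \<le> ennreal (card \<G> * exp (- s * n))"
proof -
  have "bowen_M_N f U Y s N \<le> (\<Sum>\<^sub>\<infinity>w\<in>\<G>. ennreal (exp (- s * real (length w))))"
    unfolding bowen_M_N_def by (rule INF_lower) (use assms in auto)
  also have "\<dots> = (\<Sum>w\<in>\<G>. ennreal (exp (- s * real (length w))))"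
    using assms by simp
  also have "\<dots> = (\<Sum>w\<in>\<G>. ennreal (exp (- s * real n)))"
    by (rule sum.cong) (use assms in auto)
  also have "\<dots> = ennreal (card \<G> * exp (- s * n))"
    by (simp add: ennreal_mult ennreal_of_nat_eq_real_of_nat)
  finally show ?thesis .
qed

text \<open>One cover, fixed before \<open>s\<close>, suffices since the entropy is a supremum over
  covers.\<close>

lemma bowen_entropy_geI:
  assumes "finite U" "\<And>V. V \<in> U \<Longrightarrow> open V" "\<Union>U = UNIV"
    and nz: "\<And>s. s < h \<Longrightarrow> \<exists>N. bowen_M_N f U Y s N \<noteq> 0"
  shows "ereal h \<le> bowen_entropy f Y"
proof -
  have "h \<le> s" if "bowen_M f U Y s = 0" for s
  proof (rule ccontr)
    assume "\<not> h \<le> s"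
    then obtain N where "bowen_M_N f U Y s N \<noteq> 0" using nz[of s] by auto
    moreover have "bowen_M_N f U Y s N \<le> bowen_M f U Y s"
      unfolding bowen_M_eq_SUP by (rule SUP_upper) auto
    ultimately show False using that by simp
  qed
  then have "ereal h \<le> bowen_entropy_cover f U Y"
    unfolding bowen_entropy_cover_def by (auto intro!: Inf_greatest)
  also have "\<dots> \<le> bowen_entropy f Y"
    unfolding bowen_entropy_def by (rule SUP_upper) (use assms in auto)
  finally show ?thesis .
qed

text \<open>The bound \<open>c\<close> is uniform in \<open>n\<close> because
  \<open>bowen_M_N\<close> increases with \<open>N\<close>. The gap between \<open>h\<close> and
  \<open>h'\<close> will pay for passing from strings to separated points.\<close>

lemma bowen_entropy_gtD:
  assumes "ereal h < bowen_entropy f Y"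
  obtains U c N h' where "finite U" "\<And>V. V \<in> U \<Longrightarrow> open V" "\<Union>U = UNIV" "h < h'" "0 < c"
    "\<And>n. N \<le> n \<Longrightarrow> ennreal c \<le> bowen_M_N f U Y h' n"
proof -
  obtain U where U: "finite U" "\<forall>V\<in>U. open V" "\<Union>U = UNIV" "ereal h < bowen_entropy_cover f U Y"
    using assms unfolding bowen_entropy_def less_SUP_iff by auto
  obtain h' where h': "ereal h < ereal h'" "ereal h' < bowen_entropy_cover f U Y"
    using ereal_dense2[OF U(4)] by auto
  have "bowen_M f U Y h' \<noteq> 0"
  proof
    assume "bowen_M f U Y h' = 0"
    then have "bowen_entropy_cover f U Y \<le> ereal h'"
      unfolding bowen_entropy_cover_def by (intro Inf_lower) auto
    then show False using h' by simp
  qed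
  then obtain N where N: "0 < bowen_M_N f U Y h' N"
    unfolding bowen_M_eq_SUP by (metis (no_types, lifting) SUP_eq_const UNIV_not_empty not_gr_zero)
  then obtain c :: ennreal where c: "0 < c" "c < bowen_M_N f U Y h' N"
    using dense by blast
  then obtain r where r: "c = ennreal r" "0 \<le> r" by (cases c) auto
  show thesis
  proof (rule that[of U h' r N])
    show "ennreal r \<le> bowen_M_N f U Y h' n" if "N \<le> n" for n
      using c r incseq_bowen_M_N[of f U Y h'] that
      by (auto simp: incseq_def intro: order_trans[OF less_imp_le])
  qed (use U h' c r in auto)
qed

section \<open>Separated sets and entropy\<close>

subsection \<open>Hamming balls\<close>

text \<open>The weight \<open>t \<le> 1\<close> given to every value other than \<open>None\<close> makes this a Chernoff bound.\<close>

lemma card_few_Some_le: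
  fixes t \<delta> :: real
  assumes "finite U" "0 < t" "t \<le> 1"
  shows "card {\<beta> \<in> {..<n} \<rightarrow>\<^sub>E insert None (Some ` U). card {j \<in> {..<n}. \<beta> j \<noteq> None} \<le> \<delta> * n}
           \<le> (t powr (- \<delta>) * (1 + t * card U)) ^ n"
proof -
  let ?P = "{..<n} \<rightarrow>\<^sub>E insert None (Some ` U)"
  let ?B = "{\<beta> \<in> ?P. card {j \<in> {..<n}. \<beta> j \<noteq> None} \<le> \<delta> * n}"
  define wt where "wt = (\<lambda>x::'a option. if x = None then 1 else t)"
  have fin: "finite ?P" using assms by (intro finite_PiE) auto
  have prod_wt: "(\<Prod>j<n. wt (\<beta> j)) = t ^ card {j \<in> {..<n}. \<beta> j \<noteq> None}" for \<beta>
    unfolding wt_def by (simp add: prod.If_cases Collect_conj_eq[symmetric] Int_def)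
  have "(t powr \<delta>) ^ n = t powr (\<delta> * n)"
    using assms by (subst powr_power) (auto simp: mult.commute)
  then have "card ?B * (t powr \<delta>) ^ n = (\<Sum>\<beta>\<in>?B. t powr (\<delta> * n))"
    by (simp only: sum_constant)
  also have "\<dots> \<le> (\<Sum>\<beta>\<in>?B. \<Prod>j<n. wt (\<beta> j))"
    unfolding prod_wt
  proof (rule sum_mono)
    fix \<beta> assume "\<beta> \<in> ?B"
    then have "t powr (\<delta> * n) \<le> t powr real (card {j \<in> {..<n}. \<beta> j \<noteq> None})"
      using assms by (intro powr_mono') auto
    also have "\<dots> = t ^ card {j \<in> {..<n}. \<beta> j \<noteq> None}"
      by (rule powr_realpow[OF assms(2)])
    finally show "t powr (\<delta> * n) \<le> t ^ card {j \<in> {..<n}. \<beta> j \<noteq> None}" .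
  qed
  also have "\<dots> \<le> (\<Sum>\<beta>\<in>?P. \<Prod>j<n. wt (\<beta> j))"
  proof (rule sum_mono2[OF fin])
    show "0 \<le> (\<Prod>j<n. wt (\<beta> j))" for \<beta>
      unfolding prod_wt using assms(2) by simp
  qed blast
  also have "\<dots> = (\<Prod>j<n. \<Sum>x\<in>insert None (Some ` U). wt x)"
    by (subst prod_sum_PiE) (use assms in auto)
  also have "(\<Sum>x\<in>insert None (Some ` U). wt x) = 1 + t * card U"
    using assms by (subst sum.insert) (auto simp: wt_def sum.reindex)
  finally have *: "card ?B * (t powr \<delta>) ^ n \<le> (1 + t * card U) ^ n" by simp
  have "(t powr \<delta>) ^ n > 0" using assms by simp
  with * have "card ?B \<le> (1 + t * card U) ^ n / (t powr \<delta>) ^ n"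
    by (simp add: pos_le_divide_eq)
  also have "\<dots> = (t powr (- \<delta>) * (1 + t * card U)) ^ n"
    by (simp add: powr_minus power_mult_distrib power_inverse divide_inverse mult.commute)
  finally show ?thesis .
qed

text \<open>Here \<open>u\<close> stands for the size of a cover. First \<open>t\<close> brings
  \<open>1 + t * u\<close> below \<open>exp (\<gamma> / 2)\<close>; then \<delta>, chosen after
  \<open>t\<close>, does the same for \<open>t powr (- \<delta>)\<close>.\<close>

lemma Hamming_parameters:
  fixes \<gamma> u :: real
  assumes "0 < \<gamma>" "0 \<le> u"
  obtains t \<delta> :: real where "0 < t" "t \<le> 1" "0 < \<delta>" "t powr (- \<delta>) * (1 + t * u) \<le> exp \<gamma>"
proof -
  define t where "t = min 1 (\<gamma> / (2 * (u + 1)))"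
  have t: "0 < t" "t \<le> 1" using assms by (auto simp: t_def)
  have "t * u \<le> \<gamma> / (2 * (u + 1)) * u"
    using assms by (intro mult_right_mono) (auto simp: t_def)
  also have "\<dots> = \<gamma> / 2 * (u / (u + 1))" by simp
  also have "\<dots> \<le> \<gamma> / 2 * 1" using assms by (intro mult_left_mono) auto
  finally have tu: "t * u \<le> \<gamma> / 2" by simp
  \<comment> \<open>The denominator \<open>1 - ln t\<close> instead of \<open>- ln t\<close> admits
    \<open>t = 1\<close> as well.\<close>
  define \<delta> where "\<delta> = (\<gamma> / 2) / (1 - ln t)"
  have ln: "ln t \<le> 0" using t by simp
  have \<delta>: "0 < \<delta>" using assms ln by (auto simp: \<delta>_def)
  have "- \<delta> * ln t = \<gamma> / 2 * (- ln t / (1 - ln t))" by (simp add: \<delta>_def)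
  also have "\<dots> \<le> \<gamma> / 2 * 1" using assms ln by (intro mult_left_mono) (auto simp: field_simps)
  finally have "- \<delta> * ln t \<le> \<gamma> / 2" by simp
  then have "t powr (- \<delta>) \<le> exp (\<gamma> / 2)" using t by (simp add: powr_def)
  moreover have "1 + t * u \<le> exp (\<gamma> / 2)"
    using exp_ge_add_one_self[of "\<gamma> / 2"] tu by linarith
  ultimately have "t powr (- \<delta>) * (1 + t * u) \<le> exp (\<gamma> / 2) * exp (\<gamma> / 2)"
    using t assms by (intro mult_mono) auto
  also have "\<dots> = exp \<gamma>" by (simp flip: exp_add)
  finally show thesis using that t \<delta> by blast
qed

subsection \<open>Compact systems\<close>

text \<open>The topology of the phase space is metrised by pulling back the distance along \<open>\<Phi>\<close>.\<close>

locale compact_system =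
  fixes f :: "'m::t2_space \<Rightarrow> 'm" and \<Phi> :: "'m \<Rightarrow> 'b::metric_space"
  assumes compact_UNIV: "compact (UNIV :: 'm set)"
    and continuous_f: "continuous_on UNIV f"
    and continuous_\<Phi>: "continuous_on UNIV \<Phi>"
    and inj_\<Phi>: "inj \<Phi>"
begin

definition D :: "'m \<Rightarrow> 'm \<Rightarrow> real" where "D x y = dist (\<Phi> x) (\<Phi> y)"

lemma D_commute: "D x y = D y x" and D_triangle: "D x z \<le> D x y + D y z"
  and D_self [simp]: "D x x = 0" and D_nonneg [simp]: "0 \<le> D x y"
  by (auto simp: D_def dist_commute dist_triangle)

lemma continuous_funpow: "continuous_on UNIV (f ^^ n)"
proof (induction n)
  case (Suc n)
  have "continuous_on UNIV (f \<circ> (f ^^ n))"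
    using Suc continuous_f by (intro continuous_on_compose) (auto intro: continuous_on_subset)
  then show ?case by simp
qed (simp add: id_def)

lemma open_D_ball: "open {y. D x y < e}"
  unfolding D_def by (intro open_Collect_less continuous_intros continuous_\<Phi>)

lemma closed_D_ball: "closed {y. D x y \<le> e}"
  unfolding D_def by (intro closed_Collect_le continuous_intros continuous_\<Phi>)

text \<open>A finite union, over the admissible sets of good times, of intersections of closed
  conditions. Closedness lets compactness pass from finitely many shadowed blocks to infinitely
  many.\<close>

lemma closed_g_dynamical_ball: "closed (g_dynamical_ball D f g n x e)"
proof -
  have "g_dynamical_ball D f g n x e =
      (\<Union>\<Lambda>\<in>{\<Lambda>. \<Lambda> \<subseteq> {..<n} \<and> card ({..<n} - \<Lambda>) \<le> g n}. \<Inter>j\<in>\<Lambda>. (f ^^ j) -` {y. D ((f ^^ j) x) y \<le> e})"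
    by (auto simp: g_dynamical_ball_def)
  moreover have "closed \<dots>"
    by (intro closed_UN closed_INT ballI closed_vimage closed_D_ball continuous_funpow)
      (auto intro: finite_subset[OF _ finite_Pow_iff[THEN iffD2]])
  ultimately show ?thesis by simp
qed

text \<open>On the compact complement of \<open>V\<close> the function \<open>D x\<close> attains
  its minimum, which is positive because \<Phi> is injective. With \<open>open_D_ball\<close> this
  shows that \<open>D\<close> induces the given topology.\<close>

lemma D_neighbourhood:
  assumes "open V" "x \<in> V"
  obtains e where "0 < e" "{y. D x y < e} \<subseteq> V"
proof (cases "V = UNIV")
  case False
  have "compact (- V)"
    using assms compact_UNIV by (metis Int_UNIV_left closed_Compl compact_Int_closed)
  moreover have "continuous_on (- V) (D x)"
    unfolding D_def by (intro continuous_intros continuous_on_subset[OF continuous_\<Phi>]) auto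
  ultimately obtain z where z: "z \<in> - V" "\<And>y. y \<in> - V \<Longrightarrow> D x z \<le> D x y"
    using continuous_attains_inf[of "- V" "D x"] False by blast
  have "z \<noteq> x" using z(1) assms(2) by blast
  then have "0 < D x z" using inj_\<Phi> by (simp add: D_def inj_eq)
  moreover have "{y. D x y < D x z} \<subseteq> V"
  proof (rule subsetI, rule ccontr)
    fix y assume y: "y \<in> {y. D x y < D x z}" "y \<notin> V"
    have "D x z \<le> D x y" by (rule z(2)) (use y(2) in simp)
    with y(1) show False by simp
  qed
  ultimately show thesis by (rule that)
next
  case True
  show thesis by (rule that[of 1]) (simp_all add: True)
qed

lemma Lebesgue_number:
  assumes "\<And>V. V \<in> \<V> \<Longrightarrow> open V" "\<Union>\<V> = UNIV"
  shows "\<exists>e>0. \<forall>x. \<exists>V\<in>\<V>. {y. D x y \<le> e} \<subseteq> V"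
proof -
  \<comment> \<open>The radius is doubled so that the balls of radius \<open>e\<close> still cover
    while leaving room for the triangle inequality.\<close>
  have "\<exists>V e. V \<in> \<V> \<and> 0 < e \<and> {y. D x y < 2 * e} \<subseteq> V" for x
  proof -
    have "x \<in> \<Union>\<V>" by (simp add: assms(2))
    then obtain V where V: "V \<in> \<V>" "x \<in> V" by (rule UnionE)
    obtain e where "0 < e" "{y. D x y < e} \<subseteq> V"
      using D_neighbourhood[OF assms(1)[OF V(1)] V(2)] .
    with V(1) show ?thesis by (intro exI[of _ V] exI[of _ "e / 2"]) simp
  qed
  then obtain V e where Ve: "\<And>x. V x \<in> \<V>" "\<And>x. 0 < e x" "\<And>x. {y. D x y < 2 * e x} \<subseteq> V x"
    by metis
  have "(UNIV :: 'm set) \<subseteq> (\<Union>x\<in>UNIV. {y. D x y < e x})"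
  proof
    fix x show "x \<in> (\<Union>x\<in>UNIV. {y. D x y < e x})"
      by (rule UN_I[of x]) (use Ve(2) in auto)
  qed
  then obtain F where F: "finite F" "(UNIV :: 'm set) \<subseteq> (\<Union>x\<in>F. {y. D x y < e x})"
    by (rule compactE_image[OF compact_UNIV open_D_ball])
  define d where "d = Min (insert 1 (e ` F))"
  have d: "0 < d" using F Ve by (auto simp: d_def)
  have d_le: "d \<le> e x" if "x \<in> F" for x using that F by (auto simp: d_def)
  show ?thesis
  proof (intro exI[of _ d] conjI allI d)
    fix z
    obtain x where x: "x \<in> F" "D x z < e x" using F(2) by blast
    have "D x y < 2 * e x" if "D z y \<le> d" for y
      using that d_le[OF x(1)] x(2) D_triangle[of x y z] by linarith
    then show "\<exists>V\<in>\<V>. {y. D z y \<le> d} \<subseteq> V" using Ve(1,3)[of x] by blast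
  qed
qed

lemma uniformly_continuous:
  fixes \<phi> :: "'m \<Rightarrow> 'c::metric_space"
  assumes "continuous_on UNIV \<phi>" "0 < \<eta>"
  obtains e where "0 < e" "\<And>x y. D x y \<le> e \<Longrightarrow> dist (\<phi> x) (\<phi> y) < \<eta>"
proof -
  let ?\<V> = "range (\<lambda>c. {y. dist (\<phi> c) (\<phi> y) < \<eta> / 2})"
  have "\<And>V. V \<in> ?\<V> \<Longrightarrow> open V"
    by (auto intro!: open_Collect_less continuous_intros assms)
  moreover have "\<Union>?\<V> = UNIV"
  proof -
    have "x \<in> \<Union>?\<V>" for x using assms(2) by (intro UnionI[of "{y. dist (\<phi> x) (\<phi> y) < \<eta> / 2}"]) auto
    then show ?thesis by auto
  qed
  ultimately obtain e where e: "0 < e" "\<And>x. \<exists>V\<in>?\<V>. {y. D x y \<le> e} \<subseteq> V"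
    using Lebesgue_number[of ?\<V>] by metis
  show thesis
  proof (rule that[OF e(1)])
    fix x y assume "D x y \<le> e"
    obtain V where V: "V \<in> ?\<V>" "{y. D x y \<le> e} \<subseteq> V" using e(2)[of x] by (rule bexE)
    then obtain c where c: "V = {y. dist (\<phi> c) (\<phi> y) < \<eta> / 2}" by auto
    have "x \<in> V" "y \<in> V"
      by (rule subsetD[OF V(2)]; use e(1) \<open>D x y \<le> e\<close> in simp)+
    then have "dist (\<phi> c) (\<phi> x) < \<eta> / 2" "dist (\<phi> c) (\<phi> y) < \<eta> / 2"
      by (simp_all add: c)
    then show "dist (\<phi> x) (\<phi> y) < \<eta>"
      using dist_triangle3[of "\<phi> x" "\<phi> y" "\<phi> c"] by linarith
  qed
qed

lemma finite_small_cover: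
  assumes "0 < e"
  obtains U where "finite U" "\<And>V. V \<in> U \<Longrightarrow> open V" "\<Union>U = UNIV"
    "\<And>V x y. \<lbrakk>V \<in> U; x \<in> V; y \<in> V\<rbrakk> \<Longrightarrow> D x y < e"
proof -
  have "(UNIV :: 'm set) \<subseteq> (\<Union>x\<in>UNIV. {y. D x y < e / 2})"
  proof
    fix x show "x \<in> (\<Union>x\<in>UNIV. {y. D x y < e / 2})"
      by (rule UN_I[of x]) (use assms in auto)
  qed
  then obtain F where F: "finite F" "(UNIV :: 'm set) \<subseteq> (\<Union>x\<in>F. {y. D x y < e / 2})"
    by (rule compactE_image[OF compact_UNIV open_D_ball])
  show thesis
  proof (rule that[of "(\<lambda>x. {y. D x y < e / 2}) ` F"])
    show "D x y < e" if V: "V \<in> (\<lambda>x. {y. D x y < e / 2}) ` F" "x \<in> V" "y \<in> V" for V x y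
    proof -
      obtain c where "V = {y. D c y < e / 2}"
        using V(1) by blast
      then have "D c x < e / 2" "D c y < e / 2" using V(2,3) by simp_all
      then show ?thesis using D_triangle[of x y c] D_commute[of x c] by linarith
    qed
    show "\<Union>((\<lambda>x. {y. D x y < e / 2}) ` F) = UNIV" using F(2) by blast
    show "open V" if "V \<in> (\<lambda>x. {y. D x y < e / 2}) ` F" for V
      using that open_D_ball by blast
  qed (use F(1) in simp)
qed

end

section \<open>Orbits that are apart at a positive proportion of times\<close>

context compact_system begin

text \<open>Bowen separation would ask for a single separating time. Here, once
  \<open>2 * g n \<le> \<delta> * n\<close>, one is left after removing the mistakes of two
  shadows.\<close>

definition separated :: "nat \<Rightarrow> real \<Rightarrow> real \<Rightarrow> 'm set \<Rightarrow> bool" where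
  "separated n \<delta> e E \<longleftrightarrow>
     (\<forall>x\<in>E. \<forall>y\<in>E. x \<noteq> y \<longrightarrow> \<delta> * n < card {j \<in> {..<n}. e < D ((f ^^ j) x) ((f ^^ j) y)})"

text \<open>Otherwise \<open>insert x E\<close> would be a larger separated set. If \<open>x\<close>
  lies in \<open>E\<close>, it is itself the point \<open>z\<close>.\<close>

lemma maximal_separated_spans:
  fixes \<delta> :: real
  assumes "finite E" "separated n \<delta> e E" "0 \<le> \<delta>" "0 < e"
    and max: "\<And>E'. \<lbrakk>finite E'; separated n \<delta> e E'\<rbrakk> \<Longrightarrow> card E' \<le> card E"
  obtains z where "z \<in> E" "card {j \<in> {..<n}. e < D ((f ^^ j) z) ((f ^^ j) x)} \<le> \<delta> * n"
proof (cases "x \<in> E")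
  case True
  then show thesis using assms by (intro that[of x]) auto
next
  case False
  have comm: "{j \<in> {..<n}. e < D ((f ^^ j) x) ((f ^^ j) z)} = {j \<in> {..<n}. e < D ((f ^^ j) z) ((f ^^ j) x)}" for z
    by (simp add: D_commute)
  have "\<exists>z\<in>E. card {j \<in> {..<n}. e < D ((f ^^ j) z) ((f ^^ j) x)} \<le> \<delta> * n"
  proof (rule ccontr)
    assume "\<not> ?thesis"
    then have far: "\<delta> * n < card {j \<in> {..<n}. e < D ((f ^^ j) z) ((f ^^ j) x)}" if "z \<in> E" for z
      using that by (meson not_le)
    have "separated n \<delta> e (insert x E)"
      unfolding separated_def
    proof (intro ballI impI)
      fix a b assume ab: "a \<in> insert x E" "b \<in> insert x E" "a \<noteq> b"
      then consider "a = x" "b \<in> E" | "a \<in> E" "b = x" | "a \<in> E" "b \<in> E" by blast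
      then show "\<delta> * n < card {j \<in> {..<n}. e < D ((f ^^ j) a) ((f ^^ j) b)}"
      proof cases
        case 1
        then show ?thesis using far[of b] by (simp only: comm)
      next
        case 2
        then show ?thesis using far[of a] by (simp only:)
      next
        case 3
        then show ?thesis using assms(2) ab(3) unfolding separated_def by blast
      qed
    qed
    then show False using max[of "insert x E"] assms(1) False by simp
  qed
  then show thesis using that by blast
qed

text \<open>A point \<open>x\<close> is coded by some \<open>z\<close> of \<open>E\<close> and
  corrections \<beta>: \<open>None\<close> where the orbit of \<open>x\<close> follows that of
  \<open>z\<close>, so that \<open>V ((f ^^ j) z)\<close> contains it, and \<open>Some W\<close>
  with a set \<open>W\<close> around it at the few other times. \<open>card_few_Some_le\<close>
  counts the corrections.\<close>

lemma string_cover_of_spanning: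
  fixes \<delta> t :: real
  assumes U: "finite U" "\<And>x. V x \<in> U" "\<And>x. {y. D x y \<le> e} \<subseteq> V x" and "0 \<le> e"
    and E: "finite E" "\<And>x. \<exists>z\<in>E. card {j \<in> {..<n}. e < D ((f ^^ j) z) ((f ^^ j) x)} \<le> \<delta> * n"
    and t: "0 < t" "t \<le> 1"
  obtains \<G> where "finite \<G>" "\<G> \<subseteq> {w \<in> lists U. length w = n}" "UNIV \<subseteq> (\<Union>w\<in>\<G>. string_set f w)"
    "card \<G> \<le> card E * (t powr (- \<delta>) * (1 + t * card U)) ^ n"
proof -
  let ?B = "{\<beta> \<in> {..<n} \<rightarrow>\<^sub>E insert None (Some ` U). card {j \<in> {..<n}. \<beta> j \<noteq> None} \<le> \<delta> * n}"
  define str where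
    "str = (\<lambda>(z, \<beta>). map (\<lambda>j. case \<beta> j of None \<Rightarrow> V ((f ^^ j) z) | Some W \<Rightarrow> W) [0..<n])"
  have fin: "finite ?B"
    by (rule finite_subset[OF _ finite_PiE[of "{..<n}" "\<lambda>_. insert None (Some ` U)"]]) (use U(1) in auto)
  show thesis
  proof (rule that[of "str ` (E \<times> ?B)"])
    show "finite (str ` (E \<times> ?B))" using E(1) fin by blast
    show "str ` (E \<times> ?B) \<subseteq> {w \<in> lists U. length w = n}"
    proof
      fix w assume "w \<in> str ` (E \<times> ?B)"
      then obtain z \<beta> where w: "w = str (z, \<beta>)" "\<beta> \<in> ?B" by blast
      have "(case \<beta> j of None \<Rightarrow> V ((f ^^ j) z) | Some W \<Rightarrow> W) \<in> U" if "j < n" for j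
      proof -
        have "\<beta> j \<in> insert None (Some ` U)" using w(2) that by auto
        then show ?thesis using U(2) by auto
      qed
      then show "w \<in> {w \<in> lists U. length w = n}" by (auto simp: w(1) str_def)
    qed
    show "UNIV \<subseteq> (\<Union>w\<in>str ` (E \<times> ?B). string_set f w)"
    proof
      fix x
      obtain z where z: "z \<in> E" "card {j \<in> {..<n}. e < D ((f ^^ j) z) ((f ^^ j) x)} \<le> \<delta> * n"
        using E(2) by blast
      define \<beta> where "\<beta> = (\<lambda>j\<in>{..<n}. if e < D ((f ^^ j) z) ((f ^^ j) x) then Some (V ((f ^^ j) x)) else None)"
      have "{j \<in> {..<n}. \<beta> j \<noteq> None} = {j \<in> {..<n}. e < D ((f ^^ j) z) ((f ^^ j) x)}"
        by (auto simp: \<beta>_def)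
      then have "\<beta> \<in> ?B" using z(2) U(2) by (auto simp: \<beta>_def)
      moreover have "x \<in> string_set f (str (z, \<beta>))"
      proof -
        have "x' \<in> V x'" for x' using U(3)[of x'] assms(4) by auto
        moreover have "y \<in> V x'" if "\<not> e < D x' y" for x' y using U(3)[of x'] that by auto
        ultimately show ?thesis by (auto simp: string_set_def str_def \<beta>_def)
      qed
      ultimately show "x \<in> (\<Union>w\<in>str ` (E \<times> ?B). string_set f w)" using z(1) by blast
    qed
    have "card (str ` (E \<times> ?B)) \<le> card E * card ?B"
      using card_image_le[OF finite_cartesian_product[OF E(1) fin], of str]
      unfolding card_cartesian_product .
    then have "real (card (str ` (E \<times> ?B))) \<le> card E * real (card ?B)"
      unfolding of_nat_mult[symmetric] of_nat_le_iff .
    also have "\<dots> \<le> card E * (t powr (- \<delta>) * (1 + t * card U)) ^ n"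
      by (intro mult_left_mono card_few_Some_le U(1) t) simp
    finally show "card (str ` (E \<times> ?B)) \<le> card E * (t powr (- \<delta>) * (1 + t * card U)) ^ n" .
  qed
qed

text \<open>If for some large \<open>n\<close> every separated set had fewer than
  \<open>exp (h * n)\<close> points, the strings coded by a largest one would have a sum below
  \<open>exp (- \<gamma> * n)\<close> at exponent \<open>h'\<close>, contradicting the bound
  \<open>c\<close>. Both \<open>e\<close> and \<delta> come from the cover and the gap alone, hence
  serve all \<open>n\<close>.\<close>

lemma separated_sets:
  assumes U: "finite U" "\<And>V. V \<in> U \<Longrightarrow> open V" "\<Union>U = UNIV"
    and h: "h < h'" "0 < c" "\<And>n. N \<le> n \<Longrightarrow> ennreal c \<le> bowen_M_N f U UNIV h' n"
  shows "\<exists>e \<delta> N'. 0 < e \<and> 0 < \<delta> \<and>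
    (\<forall>n\<ge>N'. \<exists>E. finite E \<and> separated n \<delta> e E \<and> exp (h * n) \<le> card E)"
proof -
  obtain e where e: "0 < e" "\<And>x. \<exists>V\<in>U. {y. D x y \<le> e} \<subseteq> V"
    using Lebesgue_number[OF U(2,3)] by metis
  then obtain V where V: "\<And>x. V x \<in> U" "\<And>x. {y. D x y \<le> e} \<subseteq> V x" by metis
  \<comment> \<open>Half of the gap pays for the Hamming balls; the other half makes the sum
    decay.\<close>
  define \<gamma> where "\<gamma> = (h' - h) / 2"
  have "0 < \<gamma>" using h by (simp add: \<gamma>_def)
  then obtain t \<delta> :: real where t: "0 < t" "t \<le> 1" "0 < \<delta>" "t powr (- \<delta>) * (1 + t * card U) \<le> exp \<gamma>"
    by (rule Hamming_parameters[OF _ of_nat_0_le_iff[of "card U"]])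
  obtain N1 :: nat where N1: "- ln c / \<gamma> \<le> N1" using real_arch_simple by blast
  show ?thesis
  proof (rule exI[of _ e], rule exI[of _ \<delta>], rule exI[of _ "max N (max N1 1)"],
      intro conjI allI impI e(1) t(3), rule ccontr)
    fix n assume n: "max N (max N1 1) \<le> n"
      and neg: "\<nexists>E. finite E \<and> separated n \<delta> e E \<and> exp (h * n) \<le> card E"
    have lt: "card E < exp (h * n)" if "finite E" "separated n \<delta> e E" for E
      using neg that by (meson not_le)
    obtain b :: nat where b: "exp (h * n) \<le> b" using real_arch_simple by blast
    have "\<exists>E. (finite E \<and> separated n \<delta> e E) \<and> (\<forall>E'. finite E' \<and> separated n \<delta> e E' \<longrightarrow> card E' \<le> card E)"
    proof (rule ex_has_greatest_nat[where k = "{}" and b = b])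
      show "finite {} \<and> separated n \<delta> e {}" by (simp add: separated_def)
      show "\<forall>E'. finite E' \<and> separated n \<delta> e E' \<longrightarrow> card E' < b"
        using lt b by (metis less_le_trans of_nat_less_iff)
    qed
    then obtain E where E: "finite E" "separated n \<delta> e E"
      and max: "\<And>E'. \<lbrakk>finite E'; separated n \<delta> e E'\<rbrakk> \<Longrightarrow> card E' \<le> card E" by metis
    have "\<exists>z\<in>E. card {j \<in> {..<n}. e < D ((f ^^ j) z) ((f ^^ j) x)} \<le> \<delta> * n" for x
      by (rule maximal_separated_spans[OF E _ e(1) max]) (use t(3) in auto)
    then obtain \<G> where \<G>: "finite \<G>" "\<G> \<subseteq> {w \<in> lists U. length w = n}" "UNIV \<subseteq> (\<Union>w\<in>\<G>. string_set f w)"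
      "card \<G> \<le> card E * (t powr (- \<delta>) * (1 + t * card U)) ^ n"
      by (rule string_cover_of_spanning[OF U(1) V less_imp_le[OF e(1)] E(1) _ t(1,2)])
    have "ennreal c \<le> bowen_M_N f U UNIV h' n" using h(3) n by simp
    also have "\<dots> \<le> ennreal (card \<G> * exp (- h' * n))"
      by (rule bowen_M_N_le) (use \<G> n in auto)
    finally have "c \<le> card \<G> * exp (- h' * n)" by (subst (asm) ennreal_le_iff) auto
    also have "\<dots> \<le> (card E * (t powr (- \<delta>) * (1 + t * card U)) ^ n) * exp (- h' * n)"
      by (rule mult_right_mono[OF \<G>(4)]) simp
    also have "\<dots> \<le> (card E * (exp \<gamma>) ^ n) * exp (- h' * n)"
      using t by (intro mult_right_mono mult_left_mono power_mono) auto
    also have "\<dots> < (exp (h * n) * (exp \<gamma>) ^ n) * exp (- h' * n)"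
      by (intro mult_strict_right_mono lt E) auto
    also have "\<dots> = exp (- \<gamma> * n)"
      by (simp add: \<gamma>_def field_simps flip: exp_add exp_of_nat_mult)
    also have "\<dots> \<le> c"
    proof -
      have "- ln c / \<gamma> \<le> n" using N1 n by linarith
      then have "- ln c \<le> \<gamma> * n"
        using \<open>0 < \<gamma>\<close> by (simp add: field_simps)
      then have "exp (- \<gamma> * n) \<le> exp (ln c)" by (subst exp_le_cancel_iff) simp
      then show ?thesis using h(2) by simp
    qed
    finally show False by simp
  qed
qed

end

section \<open>The Moran construction\<close>

subsection \<open>Covers by cylinders\<close>

text \<open>The sums \<open>S j \<omega>\<close> over those members of the cover that meet the cylinder of length \<open>j\<close> around
  \<open>\<omega>\<close> play the role of the mass of that cylinder: if the total sum were less than \<open>1\<close>, one could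
  descend through cylinders of too small mass to a point that is not covered.\<close>

lemma cylinder_cover_sum_ge_1:
  fixes u :: "'w \<Rightarrow> ennreal" and E :: "nat \<Rightarrow> 'a set"
  assumes E: "\<And>i. finite (E i)" "\<And>i. E i \<noteq> {}"
    and cyl: "\<And>w \<omega> \<omega>' i. \<lbrakk>w \<in> G; \<omega> \<in> C w; \<omega>' \<in> C w; i < J w\<rbrakk> \<Longrightarrow> \<omega> i = \<omega>' i"
    and u: "\<And>w. w \<in> G \<Longrightarrow> ennreal (\<Prod>i<J w. 1 / card (E i)) \<le> u w"
    and cover: "\<And>\<omega>. (\<And>i. \<omega> i \<in> E i) \<Longrightarrow> \<exists>w\<in>G. \<omega> \<in> C w"
  shows "1 \<le> (\<Sum>\<^sub>\<infinity>w\<in>G. u w)"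
proof (rule ccontr)
  assume less: "\<not> 1 \<le> (\<Sum>\<^sub>\<infinity>w\<in>G. u w)"
  \<comment> \<open>The mass of a cylinder of length \<open>j\<close> for the uniform product
    measure.\<close>
  define Q where "Q j = ennreal (\<Prod>i<j. 1 / card (E i))" for j
  define H where "H j \<omega> = {w \<in> G. \<exists>\<omega>'\<in>C w. \<forall>i<j. \<omega>' i = \<omega> i}" for j and \<omega> :: "nat \<Rightarrow> 'a"
  define S where "S j \<omega> = (\<Sum>\<^sub>\<infinity>w\<in>H j \<omega>. u w)" for j and \<omega> :: "nat \<Rightarrow> 'a"
  have card_pos: "0 < card (E i)" for i using E by (simp add: card_gt_0_iff)
  have summable: "u summable_on X" for X by (intro nonneg_summable_on_complete) auto
  have S_mono: "infsum u X \<le> infsum u Y" if "X \<subseteq> Y" for X Y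
    using that by (intro infsum_mono_neutral summable) auto
  have Q_antimono: "Q j \<le> Q i" if "i \<le> j" for i j
  proof -
    have "decseq (\<lambda>j. \<Prod>i<j. 1 / real (card (E i)))"
    proof (rule decseq_SucI)
      fix n
      have "(\<Prod>i<n. 1 / real (card (E i))) * (1 / real (card (E n))) \<le> (\<Prod>i<n. 1 / real (card (E i))) * 1"
        using card_pos[of n] by (intro mult_left_mono prod_nonneg) auto
      then show "(\<Prod>i<Suc n. 1 / real (card (E i))) \<le> (\<Prod>i<n. 1 / real (card (E i)))" by simp
    qed
    then show ?thesis unfolding Q_def using that by (intro ennreal_leI) (simp add: decseq_def)
  qed
  \<comment> \<open>In a cylinder with too small a sum no counted \<open>w\<close> is resolved yet:
    its weight alone would be at least \<open>Q (J w)\<close>, hence at least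
    \<open>Q j\<close>.\<close>
  have J_gt: "j < J w" if "S j \<omega> < Q j" "w \<in> H j \<omega>" for j \<omega> w
  proof (rule ccontr)
    assume "\<not> j < J w"
    then have "Q j \<le> Q (J w)" by (intro Q_antimono) simp
    also have "\<dots> \<le> u w" unfolding Q_def using that(2) by (intro u) (simp add: H_def)
    also have "\<dots> = infsum u {w}" by simp
    also have "\<dots> \<le> S j \<omega>" unfolding S_def by (rule S_mono) (use that(2) in simp)
    finally show False using that(1) by simp
  qed
  \<comment> \<open>\<open>Q j\<close> is \<open>card (E j)\<close> times \<open>Q (Suc j)\<close>,
    and the families counted in the subcylinders are disjoint, so one of these is too light
    again.\<close>
  have step: "\<exists>a\<in>E j. S (Suc j) (fun_upd \<omega> j a) < Q (Suc j)" if S: "S j \<omega> < Q j" for j \<omega>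
  proof (rule ccontr)
    assume "\<not> ?thesis"
    then have ge: "Q (Suc j) \<le> S (Suc j) (fun_upd \<omega> j a)" if "a \<in> E j" for a
      using that by (meson not_le)
    have sub: "H (Suc j) (fun_upd \<omega> j a) \<subseteq> H j \<omega>" for a
    proof
      fix w assume "w \<in> H (Suc j) (fun_upd \<omega> j a)"
      then obtain \<omega>' where w: "w \<in> G" and \<omega>': "\<omega>' \<in> C w" "\<forall>i<Suc j. \<omega>' i = (fun_upd \<omega> j a) i"
        unfolding H_def by blast
      have "\<forall>i<j. \<omega>' i = \<omega> i"
      proof (intro allI impI)
        fix i assume "i < j"
        then show "\<omega>' i = \<omega> i" using \<omega>'(2)[rule_format, of i] by simp
      qed
      then show "w \<in> H j \<omega>" unfolding H_def using w \<omega>'(1) by blast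
    qed
    \<comment> \<open>A common member would have to fix coordinate \<open>j\<close>, since
      \<open>j < J w\<close>, and could not meet both subcylinders.\<close>
    have disj: "H (Suc j) (fun_upd \<omega> j a) \<inter> H (Suc j) (fun_upd \<omega> j b) = {}" if "a \<noteq> b" for a b
    proof (rule ccontr)
      assume "\<not> ?thesis"
      then obtain w where w: "w \<in> H (Suc j) (fun_upd \<omega> j a)" "w \<in> H (Suc j) (fun_upd \<omega> j b)" by blast
      obtain \<omega>1 where \<omega>1: "w \<in> G" "\<omega>1 \<in> C w" "\<forall>i<Suc j. \<omega>1 i = (fun_upd \<omega> j a) i"
        using w(1) unfolding H_def by blast
      obtain \<omega>2 where \<omega>2: "\<omega>2 \<in> C w" "\<forall>i<Suc j. \<omega>2 i = (fun_upd \<omega> j b) i"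
        using w(2) unfolding H_def by blast
      have "j < J w" using J_gt[OF S] w(1) sub by blast
      then have "\<omega>1 j = \<omega>2 j" by (rule cyl[OF \<omega>1(1,2) \<omega>2(1)])
      then show False using \<omega>1(3)[rule_format, of j] \<omega>2(2)[rule_format, of j] that by simp
    qed
    have "Q j = ennreal (card (E j) * (\<Prod>i<Suc j. 1 / card (E i)))"
      unfolding Q_def using card_pos[of j] by simp
    also have "\<dots> = of_nat (card (E j)) * Q (Suc j)"
      unfolding Q_def ennreal_of_nat_eq_real_of_nat
      by (rule ennreal_mult) (simp, intro prod_nonneg, simp)
    also have "\<dots> = (\<Sum>a\<in>E j. Q (Suc j))" by simp
    also have "\<dots> \<le> (\<Sum>a\<in>E j. S (Suc j) (fun_upd \<omega> j a))" by (rule sum_mono) (rule ge)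
    also have "\<dots> = infsum u (\<Union>a\<in>E j. H (Suc j) (fun_upd \<omega> j a))"
      unfolding S_def by (rule sum_infsum) (use E(1) summable disj in auto)
    also have "\<dots> \<le> S j \<omega>"
      unfolding S_def by (rule S_mono) (use sub in blast)
    finally show False using S by simp
  qed
  \<comment> \<open>Any sequence will do, as the cylinder of length 0 is the whole space.\<close>
  define \<omega>0 :: "nat \<Rightarrow> 'a" where "\<omega>0 = (\<lambda>_. undefined)"
  have start: "S 0 \<omega>0 < Q 0"
  proof -
    have "S 0 \<omega>0 \<le> infsum u G" unfolding S_def by (rule S_mono) (auto simp: H_def)
    also have "\<dots> < 1" using less by simp
    finally show ?thesis by (simp add: Q_def)
  qed
  have "\<exists>W. \<forall>j. S j (W j) < Q j \<and> (\<exists>a\<in>E j. W (Suc j) = fun_upd (W j) j a)"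
    using dependent_nat_choice[of "\<lambda>j \<omega>. S j \<omega> < Q j" "\<lambda>j \<omega> \<omega>'. \<exists>a\<in>E j. \<omega>' = fun_upd \<omega> j a"]
      start step by metis
  then obtain W where W: "\<And>j. S j (W j) < Q j" "\<And>j. \<exists>a\<in>E j. W (Suc j) = fun_upd (W j) j a"
    by metis
  define \<omega> where "\<omega> j = W (Suc j) j" for j
  have W_eq: "W (Suc i + k) i = \<omega> i" for i k
  proof (induction k)
    case (Suc k)
    obtain a where "W (Suc (Suc i + k)) = fun_upd (W (Suc i + k)) (Suc i + k) a" using W(2) by blast
    then show ?case using Suc by simp
  qed (simp add: \<omega>_def)
  have \<omega>: "\<omega> i \<in> E i" for i
  proof -
    obtain a where "a \<in> E i" "W (Suc i) = fun_upd (W i) i a" using W(2) by blast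
    then show ?thesis by (simp add: \<omega>_def)
  qed
  then obtain w where w: "w \<in> G" "\<omega> \<in> C w" using cover by blast
  \<comment> \<open>A member containing the limit sequence is still counted at level
    \<open>J w\<close>, where \<open>J_gt\<close> becomes absurd.\<close>
  have "\<omega> i = W (J w) i" if "i < J w" for i
    using W_eq[of i "J w - Suc i"] that by simp
  then have "w \<in> H (J w) (W (J w))" unfolding H_def using w by blast
  then have "J w < J w" by (rule J_gt[OF W(1)])
  then show False by simp
qed

subsection \<open>Birkhoff averages\<close>

definition birkhoff_avg :: "('m \<Rightarrow> 'm) \<Rightarrow> ('m \<Rightarrow> real) \<Rightarrow> nat \<Rightarrow> 'm \<Rightarrow> real" where
  "birkhoff_avg f \<phi> n x = (1 / real n) * (\<Sum>i<n. \<phi> ((f ^^ i) x))"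

lemma birkhoff_avg_uminus: "birkhoff_avg f (\<lambda>x. - \<phi> x) n x = - birkhoff_avg f \<phi> n x"
  by (simp add: birkhoff_avg_def sum_negf)

lemma abs_birkhoff_avg_le:
  assumes "\<And>x. \<bar>\<phi> x\<bar> \<le> c"
  shows "\<bar>birkhoff_avg f \<phi> n x\<bar> \<le> c"
proof (cases "n = 0")
  case True
  then show ?thesis using assms[of x] by (simp add: birkhoff_avg_def)
next
  case False
  have "\<bar>\<Sum>i<n. \<phi> ((f ^^ i) x)\<bar> \<le> (\<Sum>i<n. c)"
    by (intro order_trans[OF sum_abs] sum_mono assms)
  then show ?thesis using False by (simp add: birkhoff_avg_def abs_mult field_simps)
qed

lemma birkhoff_avg_close:
  assumes "\<And>x. \<bar>\<phi> x - \<psi> x\<bar> \<le> c"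
  shows "\<bar>birkhoff_avg f \<phi> n x - birkhoff_avg f \<psi> n x\<bar> \<le> c"
  using abs_birkhoff_avg_le[of "\<lambda>x. \<phi> x - \<psi> x" c f n x] assms
  by (simp add: birkhoff_avg_def sum_subtractf algebra_simps)

text \<open>Boundedness gives a subsequential limit \<open>l\<close>. As \<open>s\<close> does not
  tend to \<open>l\<close>, it is infinitely often at distance at least \<eta>, and then infinitely
  often on the same side; both levels are put between \<open>l\<close> and that side.\<close>

lemma bounded_not_convergent_oscillates:
  fixes s :: "nat \<Rightarrow> real"
  assumes "bounded (range s)" "\<not> convergent s"
  obtains a b where "a < b" "\<exists>\<^sub>\<infinity>n. s n < a" "\<exists>\<^sub>\<infinity>n. b < s n"
proof -
  obtain l r where r: "strict_mono r" "(s \<circ> r) \<longlonglongrightarrow> l"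
    using bounded_imp_convergent_subsequence[OF assms(1)] by blast
  have "\<not> s \<longlonglongrightarrow> l" using assms(2) by (auto simp: convergent_def)
  then obtain \<eta> where \<eta>: "0 < \<eta>" "\<exists>\<^sub>\<infinity>n. \<eta> \<le> \<bar>s n - l\<bar>"
    unfolding tendsto_iff frequently_cofinite[symmetric] cofinite_eq_sequentially
    by (auto simp: dist_real_def not_eventually not_less)
  have near: "\<exists>\<^sub>\<infinity>n. \<bar>s n - l\<bar> < e" if "0 < e" for e
  proof -
    have "\<forall>\<^sub>F n in sequentially. \<bar>(s \<circ> r) n - l\<bar> < e"
      using r(2) that by (auto simp: tendsto_iff dist_real_def)
    then obtain N where N: "\<And>n. N \<le> n \<Longrightarrow> \<bar>s (r n) - l\<bar> < e"
      by (auto simp: eventually_sequentially)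
    show ?thesis
      unfolding INFM_nat_le
    proof
      fix m
      show "\<exists>n\<ge>m. \<bar>s n - l\<bar> < e"
        using N[of "max N m"] seq_suble[OF r(1), of "max N m"] by (intro exI[of _ "r (max N m)"]) simp
    qed
  qed
  have "(\<exists>\<^sub>\<infinity>n. l + \<eta> \<le> s n) \<or> (\<exists>\<^sub>\<infinity>n. s n \<le> l - \<eta>)"
    unfolding frequently_disj_iff[symmetric]
    by (rule frequently_mono[OF _ \<eta>(2)]) (auto simp: abs_if split: if_splits)
  then show thesis
  proof
    assume "\<exists>\<^sub>\<infinity>n. l + \<eta> \<le> s n"
    then have "\<exists>\<^sub>\<infinity>n. l + \<eta> / 2 < s n"
      by (rule frequently_elim1) (use \<eta>(1) in auto)
    moreover have "\<exists>\<^sub>\<infinity>n. s n < l + \<eta> / 3"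
      by (rule frequently_elim1[OF near[of "\<eta> / 3"]]) (use \<eta>(1) in linarith)+
    ultimately show thesis using \<eta>(1) by (intro that[of "l + \<eta> / 3" "l + \<eta> / 2"]) auto
  next
    assume "\<exists>\<^sub>\<infinity>n. s n \<le> l - \<eta>"
    then have "\<exists>\<^sub>\<infinity>n. s n < l - \<eta> / 2"
      by (rule frequently_elim1) (use \<eta>(1) in auto)
    moreover have "\<exists>\<^sub>\<infinity>n. l - \<eta> / 3 < s n"
      by (rule frequently_elim1[OF near[of "\<eta> / 3"]]) (use \<eta>(1) in linarith)+
    ultimately show thesis using \<eta>(1) by (intro that[of "l - \<eta> / 2" "l - \<eta> / 3"]) auto
  qed
qed

text \<open>The approximants are step functions with rational values on finitely many base sets,
  overlaps being resolved by the first match in a list. They need not be continuous, since Birkhoff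
  averages respect uniform closeness of any functions.\<close>

lemma countable_uniformly_dense_functions:
  fixes \<B> :: "'m::topological_space set set"
  assumes compact: "compact (UNIV :: 'm set)"
    and \<B>: "countable \<B>" "\<And>B. B \<in> \<B> \<Longrightarrow> open B" "\<And>V x. \<lbrakk>open V; x \<in> V\<rbrakk> \<Longrightarrow> \<exists>B\<in>\<B>. x \<in> B \<and> B \<subseteq> V"
  shows "\<exists>\<Psi> :: ('m \<Rightarrow> real) set. countable \<Psi> \<and>
    (\<forall>\<phi> \<eta>. continuous_on UNIV \<phi> \<longrightarrow> 0 < \<eta> \<longrightarrow> (\<exists>\<psi>\<in>\<Psi>. \<forall>x. \<bar>\<phi> x - \<psi> x\<bar> < \<eta>))"
proof -
  define step where
    "step l x = (case find (\<lambda>p. x \<in> fst p) l of None \<Rightarrow> 0 | Some p \<Rightarrow> snd p)" for l :: "('m set \<times> real) list" and x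
  show ?thesis
  proof (intro exI[of _ "step ` lists (\<B> \<times> \<rat>)"] conjI allI impI)
    show "countable (step ` lists (\<B> \<times> \<rat>))"
      by (intro countable_image countable_lists countable_SIGMA \<B>(1) countable_rat)
    fix \<phi> :: "'m \<Rightarrow> real" and \<eta> :: real assume \<phi>: "continuous_on UNIV \<phi>" and \<eta>: "0 < \<eta>"
    \<comment> \<open>Any list of such pairs whose sets cover the space yields a good
      approximant.\<close>
    define \<P> where "\<P> = {p \<in> \<B> \<times> \<rat>. \<forall>y\<in>fst p. \<bar>\<phi> y - snd p\<bar> < \<eta>}"
    have "(UNIV :: 'm set) \<subseteq> (\<Union>p\<in>\<P>. fst p)"
    proof
      fix x
      obtain q where q: "q \<in> \<rat>" "\<phi> x - \<eta> / 2 < q" "q < \<phi> x"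
        using Rats_dense_in_real[of "\<phi> x - \<eta> / 2" "\<phi> x"] \<eta> by auto
      have "open {y. \<bar>\<phi> y - \<phi> x\<bar> < \<eta> / 2}"
        by (intro open_Collect_less continuous_intros \<phi>)
      then obtain B where B: "B \<in> \<B>" "x \<in> B" "B \<subseteq> {y. \<bar>\<phi> y - \<phi> x\<bar> < \<eta> / 2}"
        using \<B>(3)[of "{y. \<bar>\<phi> y - \<phi> x\<bar> < \<eta> / 2}" x] \<eta> by auto
      have "\<bar>\<phi> y - q\<bar> < \<eta>" if "y \<in> B" for y
      proof -
        have "\<bar>\<phi> y - \<phi> x\<bar> < \<eta> / 2" using B(3) that by blast
        then show ?thesis using q by linarith
      qed
      then have "(B, q) \<in> \<P>" using B(1) q(1) by (simp add: \<P>_def)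
      then show "x \<in> (\<Union>p\<in>\<P>. fst p)" using B(2) by force
    qed
    moreover have "open (fst p)" if "p \<in> \<P>" for p using that \<B>(2) by (auto simp: \<P>_def)
    ultimately obtain F where F: "F \<subseteq> \<P>" "finite F" "(UNIV :: 'm set) \<subseteq> (\<Union>p\<in>F. fst p)"
      using compactE_image[OF compact, of \<P> fst] by metis
    obtain l where l: "set l = F" using finite_list[OF F(2)] by blast
    have "\<bar>\<phi> x - step l x\<bar> < \<eta>" for x
    proof (cases "find (\<lambda>p. x \<in> fst p) l")
      case None
      have "x \<in> (\<Union>p\<in>F. fst p)" by (rule subsetD[OF F(3) UNIV_I])
      then obtain p where "p \<in> F" "x \<in> fst p" by blast
      moreover have "\<not> (\<exists>p. p \<in> set l \<and> x \<in> fst p)" using None by (rule iffD1[OF find_None_iff])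
      ultimately show ?thesis using l by blast
    next
      case (Some p)
      then have "p \<in> F" "x \<in> fst p" using l by (auto simp: find_Some_iff)
      then show ?thesis using F(1) Some by (auto simp: step_def \<P>_def)
    qed
    moreover have "l \<in> lists (\<B> \<times> \<rat>)" using l F(1) by (auto simp: \<P>_def)
    ultimately show "\<exists>\<psi>\<in>step ` lists (\<B> \<times> \<rat>). \<forall>x. \<bar>\<phi> x - \<psi> x\<bar> < \<eta>" by blast
  qed
qed

text \<open>Whenever the averages of \<open>\<phi>\<close> along some orbit are infinitely often small, so are they along the
  segments \<open>(y k, n k)\<close>: up to a small error this is a statement about one of countably many pairs
  consisting of a function of \<open>\<Psi>\<close> and a rational bound, and each of them is visited infinitely often.\<close>

lemma universal_orbit_segments:
  fixes f :: "'m \<Rightarrow> 'm::topological_space" and \<Psi> :: "('m \<Rightarrow> real) set"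
  assumes compact: "compact (UNIV :: 'm set)"
    and \<Psi>: "countable \<Psi>"
      "\<And>\<phi> \<eta>. \<lbrakk>continuous_on UNIV \<phi>; 0 < \<eta>\<rbrakk> \<Longrightarrow> \<exists>\<psi>\<in>\<Psi>. \<forall>x. \<bar>\<phi> x - \<psi> x\<bar> < \<eta>"
  obtains y :: "nat \<Rightarrow> 'm" and n :: "nat \<Rightarrow> nat" where
    "\<And>k. L k \<le> n k" "\<And>k. 2 * n k \<le> n (Suc k)"
    "\<And>\<phi>. \<lbrakk>continuous_on UNIV \<phi>; irregular_set f \<phi> \<noteq> {}\<rbrakk> \<Longrightarrow> \<not> convergent (\<lambda>k. birkhoff_avg f \<phi> (n k) (y k))"
proof -
  define cls where "cls = (\<lambda>(\<psi>, q). {(z, n). birkhoff_avg f \<psi> n z < q})"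
  \<comment> \<open>A class can be visited again and again while the lengths double only if it
    contains arbitrarily long segments.\<close>
  define long where "long S \<longleftrightarrow> (\<forall>N. \<exists>(z, n)\<in>S. N \<le> n)" for S :: "('m \<times> nat) set"
  \<comment> \<open>\<open>UNIV\<close> keeps the enumeration nonempty even if no other class is
    long.\<close>
  define \<S> where "\<S> = insert UNIV {S \<in> cls ` (\<Psi> \<times> \<rat>). long S}"
  have \<S>: "countable \<S>" "\<S> \<noteq> {}"
    using \<Psi>(1) by (auto simp: \<S>_def countable_rat intro!: countable_Collect countable_image countable_SIGMA)
  \<comment> \<open>Discarding the second component of \<open>prod_decode\<close> makes each class
    recur for infinitely many \<open>k\<close>.\<close>
  define e where "e k = from_nat_into \<S> (fst (prod_decode k))" for k
  have long: "long (e k)" for k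
  proof -
    have "e k \<in> \<S>" unfolding e_def by (rule from_nat_into[OF \<S>(2)])
    moreover have "long UNIV" by (auto simp: long_def)
    ultimately show ?thesis by (auto simp: \<S>_def)
  qed
  have "\<exists>s. \<forall>k. (s k \<in> e k \<and> L k \<le> snd (s k)) \<and> 2 * snd (s k) \<le> snd (s (Suc k))"
  proof (rule dependent_nat_choice)
    show "\<exists>p. p \<in> e 0 \<and> L 0 \<le> snd p" using long[of 0] unfolding long_def by fastforce
    fix p :: "'m \<times> nat" and k
    obtain z n where "(z, n) \<in> e (Suc k)" "max (L (Suc k)) (2 * snd p) \<le> n"
      using long[of "Suc k"] unfolding long_def by blast
    then show "\<exists>p'. (p' \<in> e (Suc k) \<and> L (Suc k) \<le> snd p') \<and> 2 * snd p \<le> snd p'"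
      by (intro exI[of _ "(z, n)"]) simp
  qed
  then obtain s where s: "\<And>k. s k \<in> e k" "\<And>k. L k \<le> snd (s k)" "\<And>k. 2 * snd (s k) \<le> snd (s (Suc k))"
    by blast
  have visit: "\<exists>\<^sub>\<infinity>k. birkhoff_avg f \<phi> (snd (s k)) (fst (s k)) < c"
    if \<phi>: "continuous_on UNIV \<phi>" and ac: "a < c" and z: "\<exists>\<^sub>\<infinity>n. birkhoff_avg f \<phi> n z < a" for \<phi> a c z
  proof -
    \<comment> \<open>One third is lost from \<phi> to \<psi>, one leaves room for the rational
      \<open>q\<close>, one is lost on the way back.\<close>
    define \<eta> where "\<eta> = (c - a) / 3"
    have \<eta>: "0 < \<eta>" "c = a + 3 * \<eta>" using ac by (simp_all add: \<eta>_def field_simps)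
    obtain \<psi> where \<psi>: "\<psi> \<in> \<Psi>" "\<And>x. \<bar>\<phi> x - \<psi> x\<bar> < \<eta>" using \<Psi>(2)[OF \<phi> \<eta>(1)] by blast
    have close: "\<bar>birkhoff_avg f \<phi> n x - birkhoff_avg f \<psi> n x\<bar> \<le> \<eta>" for n x
      by (rule birkhoff_avg_close) (rule less_imp_le[OF \<psi>(2)])
    obtain q where q: "q \<in> \<rat>" "a + \<eta> < q" "q < a + 2 * \<eta>"
      using Rats_dense_in_real[of "a + \<eta>" "a + 2 * \<eta>"] \<eta>(1) by auto
    have "long (cls (\<psi>, q))"
      unfolding long_def
    proof
      fix N
      obtain n where n: "N \<le> n" "birkhoff_avg f \<phi> n z < a" using z unfolding INFM_nat_le by blast
      then have "(z, n) \<in> cls (\<psi>, q)" using close[of n z] q by (simp add: cls_def)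
      with n(1) show "\<exists>(z, n)\<in>cls (\<psi>, q). N \<le> n" by blast
    qed
    then have "cls (\<psi>, q) \<in> \<S>" using \<psi>(1) q(1) by (simp add: \<S>_def)
    then obtain i where i: "from_nat_into \<S> i = cls (\<psi>, q)"
      using from_nat_into_surj[OF \<S>(1)] by blast
    show ?thesis
      unfolding INFM_nat_le
    proof
      fix m
      define k where "k = prod_encode (i, m)"
      have "m \<le> k" unfolding k_def by (rule le_prod_encode_2)
      moreover have "s k \<in> cls (\<psi>, q)" using s(1)[of k] i by (simp add: e_def k_def)
      then have "birkhoff_avg f \<psi> (snd (s k)) (fst (s k)) < q" by (auto simp: cls_def)
      then have "birkhoff_avg f \<phi> (snd (s k)) (fst (s k)) < c"
        using close[of "snd (s k)" "fst (s k)"] q(3) \<eta>(2) by linarith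
      ultimately show "\<exists>k\<ge>m. birkhoff_avg f \<phi> (snd (s k)) (fst (s k)) < c" by blast
    qed
  qed
  show thesis
  proof (rule that[of "\<lambda>k. snd (s k)" "\<lambda>k. fst (s k)"])
    fix \<phi> assume \<phi>: "continuous_on UNIV \<phi>" "irregular_set f \<phi> \<noteq> {}"
    then obtain z where z: "\<not> convergent (\<lambda>n. birkhoff_avg f \<phi> n z)"
      by (auto simp: irregular_set_def birkhoff_avg_def)
    obtain c where "\<And>x. \<bar>\<phi> x\<bar> \<le> c"
      using compact_imp_bounded[OF compact_continuous_image[OF \<phi>(1) compact]]
      by (auto simp: bounded_iff)
    then have "bounded (range (\<lambda>n. birkhoff_avg f \<phi> n z))"
      by (intro boundedI[of _ c]) (auto intro: abs_birkhoff_avg_le)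
    then obtain a b where ab: "a < b" "\<exists>\<^sub>\<infinity>n. birkhoff_avg f \<phi> n z < a" "\<exists>\<^sub>\<infinity>n. b < birkhoff_avg f \<phi> n z"
      using z by (rule bounded_not_convergent_oscillates)
    \<comment> \<open>Each visit loses a little, so the levels are moved inside the interval from
      \<open>a\<close> to \<open>b\<close>. Large averages of \<phi> are treated as small averages
      of \<open>- \<phi>\<close>, so one kind of class suffices.\<close>
    define c1 c2 where "c1 = a + (b - a) / 3" and "c2 = b - (b - a) / 3"
    have c: "a < c1" "c1 < c2" "c2 < b" using ab(1) by (auto simp: c1_def c2_def field_simps)
    have low: "\<exists>\<^sub>\<infinity>k. birkhoff_avg f \<phi> (snd (s k)) (fst (s k)) < c1"
      by (rule visit[OF \<phi>(1) c(1) ab(2)])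
    have "\<exists>\<^sub>\<infinity>k. birkhoff_avg f (\<lambda>x. - \<phi> x) (snd (s k)) (fst (s k)) < - c2"
      by (rule visit[of _ "- b" _ z]) (use \<phi>(1) c(3) ab(3) in \<open>auto simp: birkhoff_avg_uminus intro!: continuous_intros\<close>)
    then have high: "\<exists>\<^sub>\<infinity>k. c2 < birkhoff_avg f \<phi> (snd (s k)) (fst (s k))"
      by (simp add: birkhoff_avg_uminus)
    show "\<not> convergent (\<lambda>k. birkhoff_avg f \<phi> (snd (s k)) (fst (s k)))"
    proof
      assume "convergent (\<lambda>k. birkhoff_avg f \<phi> (snd (s k)) (fst (s k)))"
      then obtain l where l: "(\<lambda>k. birkhoff_avg f \<phi> (snd (s k)) (fst (s k))) \<longlonglongrightarrow> l"
        by (auto simp: convergent_def)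
      show False
      proof (cases "l < c2")
        case True
        then have "\<forall>\<^sub>F k in sequentially. birkhoff_avg f \<phi> (snd (s k)) (fst (s k)) < c2"
          using l by (rule order_tendstoD(2)[rotated])
        then obtain N where "\<And>k. N \<le> k \<Longrightarrow> birkhoff_avg f \<phi> (snd (s k)) (fst (s k)) < c2"
          by (auto simp: eventually_sequentially)
        then show False using high unfolding INFM_nat_le by (meson less_asym)
      next
        case False
        then have "\<forall>\<^sub>F k in sequentially. c1 < birkhoff_avg f \<phi> (snd (s k)) (fst (s k))"
          using l c(2) by (intro order_tendstoD(1)[OF l]) simp
        then obtain N where "\<And>k. N \<le> k \<Longrightarrow> c1 < birkhoff_avg f \<phi> (snd (s k)) (fst (s k))"
          by (auto simp: eventually_sequentially)
        then show False using low unfolding INFM_nat_le by (meson less_asym)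
      qed
    qed
  qed (use s in auto)
qed

subsection \<open>The layout of the blocks\<close>

text \<open>Free blocks of length \<open>p\<close> are inserted until the elapsed time is about \<open>n k / \<theta>\<close>, where the
  prescribed block of length \<open>n k\<close> is placed. The state after \<open>j\<close> blocks is the number of
  prescribed blocks among them together with the elapsed time.\<close>

locale block_layout =
  fixes p :: nat and \<theta> :: real and n :: "nat \<Rightarrow> nat"
  assumes p: "1 \<le> p" and \<theta>: "0 < \<theta>" "\<theta> \<le> 1"
    and n_ge_1: "\<And>k. 1 \<le> n k" and n_double: "\<And>k. 2 * n k \<le> n (Suc k)"
begin

primrec state :: "nat \<Rightarrow> nat \<times> nat" where
  "state 0 = (0, 0)"
| "state (Suc j) = (case state j of (k, m) \<Rightarrow> if n k \<le> \<theta> * m then (Suc k, m + n k) else (k, m + p))"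

definition stage :: "nat \<Rightarrow> nat" where "stage j = fst (state j)"
definition start :: "nat \<Rightarrow> nat" where "start j = snd (state j)"
definition prescribed :: "nat \<Rightarrow> bool" where "prescribed j \<longleftrightarrow> n (stage j) \<le> \<theta> * start j"
definition len :: "nat \<Rightarrow> nat" where "len j = (if prescribed j then n (stage j) else p)"
definition free :: "nat \<Rightarrow> nat" where "free j = card {i \<in> {..<j}. \<not> prescribed i}"

lemma start_0 [simp]: "start 0 = 0" and stage_0 [simp]: "stage 0 = 0"
  and start_Suc: "start (Suc j) = start j + len j"
  and stage_Suc: "stage (Suc j) = (if prescribed j then Suc (stage j) else stage j)"
  by (auto simp: start_def stage_def prescribed_def len_def split: prod.split)

lemma free_Suc: "free (Suc j) = (if prescribed j then free j else Suc (free j))"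
proof -
  have "{i \<in> {..<Suc j}. \<not> prescribed i} =
      (if prescribed j then {i \<in> {..<j}. \<not> prescribed i} else insert j {i \<in> {..<j}. \<not> prescribed i})"
    by (auto simp: less_Suc_eq)
  then show ?thesis by (simp add: free_def)
qed

lemma start_eq_sum: "start j = (\<Sum>i<j. len i)"
  by (induction j) (auto simp: start_Suc)

lemma len_ge_1: "1 \<le> len j"
  using p n_ge_1 by (simp add: len_def)

lemma strict_mono_start: "strict_mono start"
  by (rule strict_monoI_Suc) (use len_ge_1 in \<open>simp add: start_Suc Suc_le_eq\<close>)

lemma sum_n_le: "(\<Sum>i<k. n i) \<le> n k"
proof (induction k)
  case (Suc k)
  then show ?case using n_double[of k] by simp
qed simp

lemma start_eq: "start j = p * free j + (\<Sum>i<stage j. n i)"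
  by (induction j) (auto simp: start_Suc stage_Suc free_Suc len_def, simp add: free_def)

text \<open>A prescribed block has length at most \<open>\<theta> * start j\<close>, and by
  \<open>sum_n_le\<close> all earlier ones together add at most its length: hence the factor 2. Free
  blocks only increase the right side.\<close>

lemma sum_prescribed_le: "real (\<Sum>i<stage j. n i) \<le> 2 * \<theta> * start j"
proof (induction j)
  case (Suc j)
  show ?case
  proof (cases "prescribed j")
    case True
    then have "(\<Sum>i<stage (Suc j). n i) \<le> 2 * n (stage j)"
      using sum_n_le[of "stage j"] by (simp add: stage_Suc)
    then have "real (\<Sum>i<stage (Suc j). n i) \<le> real (2 * n (stage j))"
      by (rule of_nat_mono)
    also have "\<dots> \<le> 2 * (\<theta> * start j)" using True by (simp add: prescribed_def)
    also have "\<dots> \<le> 2 * \<theta> * start (Suc j)" using \<theta> by (simp add: start_Suc)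
    finally show ?thesis .
  next
    case False
    have "2 * \<theta> * start j \<le> 2 * \<theta> * start (Suc j)" using \<theta> by (simp add: start_Suc)
    then show ?thesis using Suc False by (simp add: stage_Suc)
  qed
qed simp

text \<open>A prescribed block never comes too late: a free block is placed only below the threshold
  and overshoots by at most \<open>\<theta> * p\<close>, while a prescribed one adds at most
  \<open>n (stage j)\<close> on the left, which the doubled next length absorbs.\<close>

lemma start_le: "\<theta> * start j \<le> n (stage j) + \<theta> * p"
proof (induction j)
  case (Suc j)
  show ?case
  proof (cases "prescribed j")
    case True
    have "\<theta> * n (stage j) \<le> n (stage j)" using \<theta> by (simp add: mult_left_le_one_le)
    then have "\<theta> * start (Suc j) \<le> 2 * n (stage j) + \<theta> * p"
      using Suc True by (simp add: start_Suc len_def distrib_left)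
    moreover have "2 * real (n (stage j)) \<le> n (stage (Suc j))"
      using n_double[of "stage j"] True by (simp add: stage_Suc)
    ultimately show ?thesis by linarith
  next
    case False
    then show ?thesis
      by (simp add: prescribed_def start_Suc stage_Suc len_def distrib_left)
  qed
qed (use \<theta> in simp)

lemma start_Suc_le: "start (Suc j) \<le> (1 + \<theta>) * start j + p"
  using \<theta> by (auto simp: start_Suc len_def prescribed_def algebra_simps)

lemma free_ge: "(1 - 2 * \<theta>) * start j \<le> p * free j"
proof -
  have "real (start j) = p * free j + real (\<Sum>i<stage j. n i)"
    unfolding of_nat_mult[symmetric] of_nat_add[symmetric] using start_eq by simp
  then show ?thesis using sum_prescribed_le[of j] by (simp add: algebra_simps)
qed

text \<open>While the stage stays constant the elapsed time grows without bound, so it passes the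
  threshold.\<close>

lemma prescribed_block_exists: "\<exists>j. prescribed j \<and> stage j = k"
proof -
  have from_stage: "\<exists>j. prescribed j \<and> stage j = k" if "stage j0 = k" for j0 k
  proof (rule ccontr)
    assume "\<not> ?thesis"
    then have no: "\<not> prescribed j" if "stage j = k" for j using that by blast
    have stage: "stage (j0 + i) = k" for i
      by (induction i) (use that no in \<open>auto simp: stage_Suc\<close>)
    obtain i :: nat where i: "n k / \<theta> \<le> i" using real_arch_simple by blast
    have "i \<le> start (j0 + i)" using strict_mono_imp_increasing[OF strict_mono_start, of "j0 + i"] by simp
    then have "n k / \<theta> \<le> start (j0 + i)" using i by linarith
    then have "n k \<le> \<theta> * start (j0 + i)" using \<theta> by (simp add: field_simps)
    then show False using no[OF stage[of i]] by (simp add: prescribed_def stage)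
  qed
  show ?thesis
  proof (induction k)
    case (Suc k)
    then obtain j where "prescribed j" "stage j = k" by blast
    then have "stage (Suc j) = Suc k" by (simp add: stage_Suc)
    then show ?case by (rule from_stage)
  qed (rule from_stage[of 0], simp)
qed

text \<open>The factor \<open>1 / \<theta> + p\<close> is the same for all blocks; it becomes the
  constant \<open>C\<close> of \<open>shadowing_irregular\<close>.\<close>

lemma prescribed_start:
  assumes "prescribed j"
  shows "n (stage j) \<le> start j" "start j \<le> (1 / \<theta> + p) * n (stage j)"
proof -
  have "real (n (stage j)) \<le> \<theta> * start j" using assms by (simp add: prescribed_def)
  also have "\<dots> \<le> start j" using \<theta> by (simp add: mult_left_le_one_le)
  finally show "n (stage j) \<le> start j" by simp
  have "real (start j) \<le> n (stage j) / \<theta> + p"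
    using start_le[of j] \<theta> by (simp add: field_simps)
  also have "real p \<le> real p * n (stage j)"
    using mult_left_mono[of 1 "real (n (stage j))" "real p"] n_ge_1[of "stage j"] by simp
  finally show "start j \<le> (1 / \<theta> + p) * n (stage j)"
    by (simp add: algebra_simps)
qed

text \<open>A string ending inside block \<open>j\<close> is shorter than
  \<open>start (Suc j)\<close> but reveals only the free blocks before \<open>j\<close>; hence the
  different indices. The unfinished block accounts for the factor \<open>1 + \<theta>\<close>, the
  prescribed ones for \<open>1 - 2 * \<theta>\<close>.\<close>

lemma free_growth:
  assumes "0 \<le> s" "s * (1 + \<theta>) < h * (1 - 2 * \<theta>)" "0 \<le> h"
  obtains X where "\<And>j. X \<le> real (start j) \<Longrightarrow> s * start (Suc j) \<le> h * (p * free j)"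
proof
  let ?d = "h * (1 - 2 * \<theta>) - s * (1 + \<theta>)"
  \<comment> \<open>From this time on the slack \<open>?d\<close> absorbs the additive term
    \<open>s * p\<close>.\<close>
  fix j assume "s * p / ?d \<le> real (start j)"
  then have "s * p \<le> ?d * start j" using assms(2) by (simp add: field_simps)
  moreover have "s * start (Suc j) \<le> s * ((1 + \<theta>) * start j + p)"
    by (rule mult_left_mono[OF start_Suc_le assms(1)])
  moreover have "h * ((1 - 2 * \<theta>) * start j) \<le> h * (p * free j)"
    by (rule mult_left_mono[OF free_ge assms(3)])
  ultimately show "s * start (Suc j) \<le> h * (p * free j)"
    by (simp add: algebra_simps)
qed

end

subsection \<open>Shadowing prescribed segments\<close>

context compact_system begin

text \<open>At good times the values differ by at most \<eta>, and each of at most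
  \<open>g n\<close> mistakes costs at most \<open>2 * c\<close>.\<close>

lemma birkhoff_avg_shadow:
  assumes "w \<in> g_dynamical_ball D f g n x e" "1 \<le> n"
    and "\<And>x y. D x y \<le> e \<Longrightarrow> \<bar>\<phi> x - \<phi> y\<bar> \<le> \<eta>" "0 \<le> \<eta>" "\<And>x. \<bar>\<phi> x\<bar> \<le> c"
  shows "\<bar>birkhoff_avg f \<phi> n x - birkhoff_avg f \<phi> n w\<bar> \<le> \<eta> + 2 * c * (g n / n)"
proof -
  obtain \<Lambda> where \<Lambda>: "\<Lambda> \<subseteq> {..<n}" "card ({..<n} - \<Lambda>) \<le> g n"
    "\<And>j. j \<in> \<Lambda> \<Longrightarrow> D ((f ^^ j) x) ((f ^^ j) w) \<le> e"
    using assms(1) unfolding g_dynamical_ball_def by blast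
  have c: "0 \<le> c" using assms(5)[of x] by linarith
  let ?d = "\<lambda>i. \<bar>\<phi> ((f ^^ i) x) - \<phi> ((f ^^ i) w)\<bar>"
  have "\<bar>(\<Sum>i<n. \<phi> ((f ^^ i) x)) - (\<Sum>i<n. \<phi> ((f ^^ i) w))\<bar> \<le> (\<Sum>i<n. ?d i)"
    unfolding sum_subtractf[symmetric] by (rule sum_abs)
  also have "\<dots> = (\<Sum>i\<in>\<Lambda>. ?d i) + (\<Sum>i\<in>{..<n} - \<Lambda>. ?d i)"
    using sum.subset_diff[OF \<Lambda>(1) finite_lessThan, of ?d] by linarith
  also have "\<dots> \<le> (\<Sum>i\<in>\<Lambda>. \<eta>) + (\<Sum>i\<in>{..<n} - \<Lambda>. 2 * c)"
  proof (intro add_mono sum_mono)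
    show "?d i \<le> \<eta>" if "i \<in> \<Lambda>" for i by (rule assms(3)[OF \<Lambda>(3)[OF that]])
    show "?d i \<le> 2 * c" for i
      using assms(5)[of "(f ^^ i) x"] assms(5)[of "(f ^^ i) w"] by linarith
  qed
  also have "\<dots> \<le> n * \<eta> + g n * (2 * c)"
    unfolding sum_constant using card_mono[OF _ \<Lambda>(1)] \<Lambda>(2) assms(4) c
    by (intro add_mono mult_right_mono) auto
  finally have "\<bar>(\<Sum>i<n. \<phi> ((f ^^ i) x)) - (\<Sum>i<n. \<phi> ((f ^^ i) w))\<bar> / n \<le> (n * \<eta> + g n * (2 * c)) / n"
    by (rule divide_right_mono) simp
  also have "\<dots> = \<eta> + 2 * c * (g n / n)" using assms(2) by (simp add: field_simps)
  finally show ?thesis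
    by (simp add: birkhoff_avg_def flip: diff_divide_distrib)
qed

text \<open>The sum over the segment is a difference of two initial sums. In this form convergence
  of the averages passes to segments as soon as \<open>m / n\<close> stays bounded.\<close>

lemma birkhoff_avg_split:
  assumes "1 \<le> n"
  shows "birkhoff_avg f \<phi> n ((f ^^ m) z) = birkhoff_avg f \<phi> (m + n) z
     + (m / n) * (birkhoff_avg f \<phi> (m + n) z - birkhoff_avg f \<phi> m z)"
proof -
  have sum: "(\<Sum>i<m + n. \<phi> ((f ^^ i) z)) = (\<Sum>i<m. \<phi> ((f ^^ i) z)) + (\<Sum>i<n. \<phi> ((f ^^ i) ((f ^^ m) z)))"
  proof -
    have "(f ^^ i) ((f ^^ m) z) = (f ^^ (m + i)) z" for i
      by (subst add.commute) (simp add: funpow_add)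
    then show ?thesis by (induction n) simp_all
  qed
  have avg: "(\<Sum>i<k. \<phi> ((f ^^ i) x)) = k * birkhoff_avg f \<phi> k x" for k x
    by (cases "k = 0") (simp_all add: birkhoff_avg_def)
  have "n * birkhoff_avg f \<phi> n ((f ^^ m) z) = (m + n) * birkhoff_avg f \<phi> (m + n) z - m * birkhoff_avg f \<phi> m z"
    using sum unfolding avg by simp
  then show ?thesis using assms by (simp add: field_simps)
qed

text \<open>If the averages of \<open>\<phi>\<close> along the orbit of \<open>z\<close> converged, then so would those along its segments
  from \<open>m k\<close> to \<open>m k + n k\<close>, which make up a fixed proportion of the elapsed time.\<close>

lemma shadowing_irregular:
  fixes C :: real
  assumes g: "mistake_function g"
    and n: "\<And>k. 1 \<le> n k" "filterlim n at_top sequentially"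
    and m: "\<And>k. n k \<le> m k" "\<And>k. m k \<le> C * n k"
    and z: "\<And>k. (f ^^ m k) z \<in> g_dynamical_ball D f g (n k) (y k) (1 / Suc k)"
    and \<phi>: "continuous_on UNIV \<phi>" "\<not> convergent (\<lambda>k. birkhoff_avg f \<phi> (n k) (y k))"
  shows "z \<in> irregular_set f \<phi>"
proof (rule ccontr)
  assume "z \<notin> irregular_set f \<phi>"
  then obtain l where l: "(\<lambda>n. birkhoff_avg f \<phi> n z) \<longlonglongrightarrow> l"
    by (auto simp: irregular_set_def birkhoff_avg_def convergent_def)
  have m_top: "filterlim m at_top sequentially"
    by (rule filterlim_at_top_mono[OF n(2)]) (use m(1) in simp)
  have mn_top: "filterlim (\<lambda>k. m k + n k) at_top sequentially"
    by (rule filterlim_at_top_mono[OF n(2)]) simp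
  have lim: "(\<lambda>k. birkhoff_avg f \<phi> (m k) z) \<longlonglongrightarrow> l" "(\<lambda>k. birkhoff_avg f \<phi> (m k + n k) z) \<longlonglongrightarrow> l"
    by (rule filterlim_compose[OF l m_top], rule filterlim_compose[OF l mn_top])
  have "(\<lambda>k. (m k / n k) * (birkhoff_avg f \<phi> (m k + n k) z - birkhoff_avg f \<phi> (m k) z)) \<longlonglongrightarrow> 0"
  proof (rule Lim_null_comparison)
    show "\<forall>\<^sub>F k in sequentially. norm ((m k / n k) * (birkhoff_avg f \<phi> (m k + n k) z - birkhoff_avg f \<phi> (m k) z))
        \<le> C * \<bar>birkhoff_avg f \<phi> (m k + n k) z - birkhoff_avg f \<phi> (m k) z\<bar>"
    proof (intro always_eventually allI)
      fix k
      have "m k / n k \<le> C" using m(2)[of k] n(1)[of k] by (simp add: field_simps)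
      then show "norm ((m k / n k) * (birkhoff_avg f \<phi> (m k + n k) z - birkhoff_avg f \<phi> (m k) z))
          \<le> C * \<bar>birkhoff_avg f \<phi> (m k + n k) z - birkhoff_avg f \<phi> (m k) z\<bar>"
        unfolding real_norm_def abs_mult by (intro mult_right_mono) auto
    qed
    show "(\<lambda>k. C * \<bar>birkhoff_avg f \<phi> (m k + n k) z - birkhoff_avg f \<phi> (m k) z\<bar>) \<longlonglongrightarrow> 0"
      using tendsto_mult_right_zero[OF tendsto_rabs_zero[OF tendsto_diff[OF lim(2,1), simplified]]] by simp
  qed
  then have "(\<lambda>k. birkhoff_avg f \<phi> (n k) ((f ^^ m k) z)) \<longlonglongrightarrow> l + 0"
    unfolding birkhoff_avg_split[OF n(1)] by (intro tendsto_add lim)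
  \<comment> \<open>The shadowing error vanishes in the limit because both the tolerance
    \<open>1 / Suc k\<close> and the proportion of mistakes do.\<close>
  moreover have "(\<lambda>k. birkhoff_avg f \<phi> (n k) (y k) - birkhoff_avg f \<phi> (n k) ((f ^^ m k) z)) \<longlonglongrightarrow> 0"
  proof -
    obtain c where c: "\<And>x. \<bar>\<phi> x\<bar> \<le> c"
      using compact_imp_bounded[OF compact_continuous_image[OF \<phi>(1) compact_UNIV]]
      by (auto simp: bounded_iff)
    have "(\<lambda>k. real (g (n k)) / real (n k)) \<longlonglongrightarrow> 0"
      using g unfolding mistake_function_def by (intro filterlim_compose[OF _ n(2)]) auto
    then have g_lim: "(\<lambda>k. 2 * c * (g (n k) / n k)) \<longlonglongrightarrow> 0" by (rule tendsto_mult_right_zero)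
    show ?thesis
    proof (rule LIMSEQ_I)
      fix r :: real assume "0 < r"
      then have r: "0 < r / 2" by simp
      obtain e where e: "0 < e" "\<And>x y. D x y \<le> e \<Longrightarrow> dist (\<phi> x) (\<phi> y) < r / 2"
        using uniformly_continuous[OF \<phi>(1) r] by blast
      have "(\<lambda>k. 1 / real (Suc k)) \<longlonglongrightarrow> 0" by (rule LIMSEQ_Suc[OF lim_1_over_n])
      then have "\<forall>\<^sub>F k in sequentially. 1 / Suc k < e" using e(1) by (rule order_tendstoD(2))
      moreover have "\<forall>\<^sub>F k in sequentially. 2 * c * (g (n k) / n k) < r / 2"
        using g_lim r by (rule order_tendstoD(2))
      ultimately have "\<forall>\<^sub>F k in sequentially. norm (birkhoff_avg f \<phi> (n k) (y k) - birkhoff_avg f \<phi> (n k) ((f ^^ m k) z) - 0) < r"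
      proof eventually_elim
        case (elim k)
        have "\<bar>\<phi> x - \<phi> y\<bar> \<le> r / 2" if "D x y \<le> 1 / Suc k" for x y
          using e(2)[of x y] that elim(1) by (simp add: dist_real_def)
        then have "\<bar>birkhoff_avg f \<phi> (n k) (y k) - birkhoff_avg f \<phi> (n k) ((f ^^ m k) z)\<bar>
            \<le> r / 2 + 2 * c * (g (n k) / n k)"
          by (rule birkhoff_avg_shadow[OF z n(1) _ less_imp_le[OF r] c])
        then show ?case using elim(2) unfolding real_norm_def diff_zero by linarith
      qed
      then show "\<exists>N. \<forall>k\<ge>N. norm (birkhoff_avg f \<phi> (n k) (y k) - birkhoff_avg f \<phi> (n k) ((f ^^ m k) z) - 0) < r"
        by (simp only: eventually_sequentially)
    qed
  qed
  ultimately have "(\<lambda>k. birkhoff_avg f \<phi> (n k) (y k)) \<longlonglongrightarrow> l"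
    using tendsto_add by fastforce
  then show False using \<phi>(2) by (auto simp: convergent_def)
qed

end

subsection \<open>Entropy of the completely irregular set\<close>

locale almost_product_system = compact_system f \<Phi>
  for f :: "'m::t2_space \<Rightarrow> 'm" and \<Phi> :: "'m \<Rightarrow> 'b::metric_space" +
  fixes g :: "nat \<Rightarrow> nat" and thr :: "real \<Rightarrow> nat"
  assumes mistake_function: "mistake_function g"
    and finite_shadowing: "\<And>x e n (k :: nat). \<lbrakk>\<And>j. 0 < e j; \<And>j. thr (e j) \<le> n j\<rbrakk> \<Longrightarrow>
      \<exists>z. \<forall>j<k. (f ^^ (\<Sum>i<j. n i)) z \<in> g_dynamical_ball D f g (n j) (x j) (e j)"
begin

text \<open>Finitely many of the closed conditions \<open>C j\<close> can always be met, and the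
  space is compact.\<close>

lemma infinite_shadowing:
  fixes n :: "nat \<Rightarrow> nat"
  assumes "\<And>j. 0 < e j" "\<And>j. thr (e j) \<le> n j"
  shows "\<exists>z. \<forall>j. (f ^^ (\<Sum>i<j. n i)) z \<in> g_dynamical_ball D f g (n j) (x j) (e j)"
proof -
  define C where "C j = (f ^^ (\<Sum>i<j. n i)) -` g_dynamical_ball D f g (n j) (x j) (e j)" for j
  have "UNIV \<inter> (\<Inter>j\<in>UNIV. C j) \<noteq> {}"
  proof (rule compact_imp_fip_image[OF compact_UNIV])
    show "closed (C j)" for j
      unfolding C_def by (intro closed_vimage closed_g_dynamical_ball continuous_funpow)
    fix F :: "nat set" assume F: "finite F"
    then obtain k where k: "F \<subseteq> {..<k}" using finite_nat_iff_bounded by blast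
    obtain z where "\<forall>j<k. (f ^^ (\<Sum>i<j. n i)) z \<in> g_dynamical_ball D f g (n j) (x j) (e j)"
      using finite_shadowing[of e n k x] assms by blast
    then have "z \<in> UNIV \<inter> (\<Inter>j\<in>F. C j)" using k by (auto simp: C_def)
    then show "UNIV \<inter> (\<Inter>j\<in>F. C j) \<noteq> {}" by blast
  qed
  then show ?thesis by (auto simp: C_def)
qed

text \<open>More than \<open>\<delta> * n\<close> times separate \<open>x\<close> and
  \<open>y\<close>, and the two shadows spoil at most \<open>2 * g n\<close> of them. At a remaining
  time two errors of at most \<open>e / 3\<close> leave more than \<open>e / 3\<close>.\<close>

lemma separated_shadows_differ:
  fixes \<delta> :: real
  assumes E: "separated n \<delta> e E" "x \<in> E" "y \<in> E" "x \<noteq> y" and g: "2 * g n \<le> \<delta> * n"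
    and z: "z \<in> g_dynamical_ball D f g n x (e / 3)" "z' \<in> g_dynamical_ball D f g n y (e / 3)"
  obtains j where "j < n" "e / 3 < D ((f ^^ j) z) ((f ^^ j) z')"
proof -
  let ?B = "{j \<in> {..<n}. e < D ((f ^^ j) x) ((f ^^ j) y)}"
  obtain \<Lambda> where \<Lambda>: "card ({..<n} - \<Lambda>) \<le> g n" "\<And>j. j \<in> \<Lambda> \<Longrightarrow> D ((f ^^ j) x) ((f ^^ j) z) \<le> e / 3"
    using z(1) unfolding g_dynamical_ball_def by blast
  obtain \<Lambda>' where \<Lambda>': "card ({..<n} - \<Lambda>') \<le> g n" "\<And>j. j \<in> \<Lambda>' \<Longrightarrow> D ((f ^^ j) y) ((f ^^ j) z') \<le> e / 3"
    using z(2) unfolding g_dynamical_ball_def by blast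
  have "\<not> ?B \<subseteq> ({..<n} - \<Lambda>) \<union> ({..<n} - \<Lambda>')"
  proof
    assume "?B \<subseteq> ({..<n} - \<Lambda>) \<union> ({..<n} - \<Lambda>')"
    then have "card ?B \<le> card (({..<n} - \<Lambda>) \<union> ({..<n} - \<Lambda>'))" by (intro card_mono) auto
    also have "\<dots> \<le> card ({..<n} - \<Lambda>) + card ({..<n} - \<Lambda>')" by (rule card_Un_le)
    finally have "card ?B \<le> 2 * g n" using \<Lambda>(1) \<Lambda>'(1) by linarith
    moreover have "\<delta> * n < card ?B" using E unfolding separated_def by blast
    ultimately show False using g by linarith
  qed
  then obtain j where j: "j \<in> ?B" "j \<in> \<Lambda>" "j \<in> \<Lambda>'" by blast
  have "e / 3 < D ((f ^^ j) z) ((f ^^ j) z')"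
    using j(1) \<Lambda>(2)[OF j(2)] \<Lambda>'(2)[OF j(3)] D_triangle[of "(f ^^ j) x" "(f ^^ j) y" "(f ^^ j) z"]
      D_triangle[of "(f ^^ j) z" "(f ^^ j) y" "(f ^^ j) z'"] D_commute[of "(f ^^ j) z'" "(f ^^ j) y"]
    by auto
  then show thesis using j(1) that by blast
qed

text \<open>Each sequence of choices from the sets \<open>EE j\<close> has a shadow in the
  completely irregular set, and a string containing the shadow determines the choices in all blocks
  that end within it. A cover by strings thus becomes a cover of sequences by cylinders, to which
  \<open>cylinder_cover_sum_ge_1\<close> applies.\<close>

lemma bowen_M_N_completely_irregular_set_nonzero:
  fixes h s \<delta> :: real and n :: "nat \<Rightarrow> nat"
  assumes block: "1 \<le> p" "thr (e / 3) \<le> p" "2 * g p \<le> \<delta> * p" and e: "0 < e"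
    and E: "finite E" "separated p \<delta> e E" "exp (h * p) \<le> card E"
    and U: "\<And>V x y. \<lbrakk>V \<in> U; x \<in> V; y \<in> V\<rbrakk> \<Longrightarrow> D x y < e / 3"
    and seg: "\<And>k. max 1 (thr (1 / Suc k)) \<le> n k" "\<And>k. 2 * n k \<le> n (Suc k)"
    and y: "\<And>\<phi>. \<lbrakk>continuous_on UNIV \<phi>; irregular_set f \<phi> \<noteq> {}\<rbrakk>
      \<Longrightarrow> \<not> convergent (\<lambda>k. birkhoff_avg f \<phi> (n k) (y k))"
    and s: "s < h"
  shows "\<exists>N. bowen_M_N f U (completely_irregular_set f) s N \<noteq> 0"
proof -
  \<comment> \<open>For \<open>0 \<le> s\<close> the condition reads
    \<open>\<theta> * (s + 2 * h) < h - s\<close>, and half of the margin makes it strict. For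
    negative \<open>s\<close> all string weights are at least 1 and any \<theta> works.\<close>
  obtain \<theta> where ratio: "0 < \<theta>" "\<theta> \<le> 1" "0 \<le> s \<Longrightarrow> s * (1 + \<theta>) < h * (1 - 2 * \<theta>)"
  proof (cases "0 \<le> s")
    case True
    define \<theta> where "\<theta> = min 1 ((h - s) / (2 * (s + 2 * h)))"
    have pos: "0 < s + 2 * h" using True s by linarith
    have "0 < \<theta>" using pos s by (simp add: \<theta>_def)
    have "\<theta> \<le> (h - s) / (2 * (s + 2 * h))" by (simp add: \<theta>_def)
    then have "\<theta> * (s + 2 * h) \<le> (h - s) / 2" using pos by (simp add: field_simps)
    also have "\<dots> < h - s" using s by simp
    finally have "\<theta> * (s + 2 * h) < h - s" .
    then show thesis using \<open>0 < \<theta>\<close> by (intro that[of \<theta>]) (auto simp: \<theta>_def algebra_simps)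
  qed (use that[of 1] in simp)
  interpret block_layout p \<theta> n
    by unfold_locales (use block(1) ratio seg in auto)
  \<comment> \<open>On prescribed blocks the tolerance tends to 0, so that averages are reproduced
    in the limit; on free blocks a fixed one that preserves separation is enough.\<close>
  define tol where "tol j = (if prescribed j then 1 / real (Suc (stage j)) else e / 3)" for j
  \<comment> \<open>Singletons at the prescribed blocks leave the mass of a cylinder
    unchanged.\<close>
  define EE where "EE j = (if prescribed j then {y (stage j)} else E)" for j
  have E_pos: "1 \<le> card E"
    using E(3) exp_gt_zero[of "h * p"] by (metis One_nat_def Suc_leI less_le_trans of_nat_0_less_iff)
  then have EE: "finite (EE j)" "EE j \<noteq> {}" for j
    using E(1) by (auto simp: EE_def)
  have tol: "0 < tol j" "thr (tol j) \<le> len j" for j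
    using e block(2) seg(1)[of "stage j"] by (auto simp: tol_def len_def)
  have "\<exists>z. \<forall>j. (f ^^ start j) z \<in> g_dynamical_ball D f g (len j) (\<omega> j) (tol j)" for \<omega>
    using infinite_shadowing[of tol len \<omega>] tol unfolding start_eq_sum by blast
  then obtain z where z: "\<And>\<omega> j. (f ^^ start j) (z \<omega>) \<in> g_dynamical_ball D f g (len j) (\<omega> j) (tol j)"
    by metis
  have z_CI: "z \<omega> \<in> completely_irregular_set f" if \<omega>: "\<And>j. \<omega> j \<in> EE j" for \<omega>
    unfolding completely_irregular_set_def
  proof (rule INT_I)
    fix \<phi> :: "'m \<Rightarrow> real" assume "\<phi> \<in> {\<phi>. continuous_on UNIV \<phi> \<and> irregular_set f \<phi> \<noteq> {}}"
    then have \<phi>: "continuous_on UNIV \<phi>" "irregular_set f \<phi> \<noteq> {}" by auto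
    obtain j where j: "\<And>k. prescribed (j k)" "\<And>k. stage (j k) = k"
      using prescribed_block_exists by metis
    show "z \<omega> \<in> irregular_set f \<phi>"
    proof (rule shadowing_irregular[OF mistake_function n_ge_1, where m = "\<lambda>k. start (j k)" and C = "1 / \<theta> + p" and y = y])
      have "strict_mono n"
      proof (rule strict_monoI_Suc)
        show "n k < n (Suc k)" for k using n_double[of k] n_ge_1[of k] by linarith
      qed
      then show "filterlim n at_top sequentially" by (rule filterlim_subseq)
      show "n k \<le> start (j k)" "start (j k) \<le> (1 / \<theta> + p) * n k" for k
        using prescribed_start[OF j(1)[of k]] by (simp_all add: j(2))
      show "(f ^^ start (j k)) (z \<omega>) \<in> g_dynamical_ball D f g (n k) (y k) (1 / Suc k)" for k
        using z[of "j k" \<omega>] \<omega>[of "j k"] j[of k] by (simp add: len_def tol_def EE_def)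
      show "continuous_on UNIV \<phi>" by (rule \<phi>(1))
      show "\<not> convergent (\<lambda>k. birkhoff_avg f \<phi> (n k) (y k))" by (rule y[OF \<phi>])
    qed
  qed
  \<comment> \<open>\<open>start (Suc i)\<close> is the end of block \<open>i\<close>. Shadows of
    different choices are more than \<open>e / 3\<close> apart at some time of the block, but points
    of one set of \<open>U\<close> are closer than that.\<close>
  have determined: "\<omega> i = \<omega>' i"
    if \<omega>: "\<And>j. \<omega> j \<in> EE j" "\<And>j. \<omega>' j \<in> EE j" and w: "w \<in> lists U" "start (Suc i) \<le> length w"
      "z \<omega> \<in> string_set f w" "z \<omega>' \<in> string_set f w" for \<omega> \<omega>' w i
  proof (cases "prescribed i")
    case True
    then show ?thesis using \<omega>(1)[of i] \<omega>(2)[of i] by (simp add: EE_def)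
  next
    case False
    show ?thesis
    proof (rule ccontr)
      assume neq: "\<omega> i \<noteq> \<omega>' i"
      obtain j where j: "j < p" "e / 3 < D ((f ^^ j) ((f ^^ start i) (z \<omega>))) ((f ^^ j) ((f ^^ start i) (z \<omega>')))"
        by (rule separated_shadows_differ[OF E(2) _ _ neq block(3), of "(f ^^ start i) (z \<omega>)" "(f ^^ start i) (z \<omega>')"])
          (use z[of i \<omega>] z[of i \<omega>'] \<omega>(1)[of i] \<omega>(2)[of i] False in \<open>simp_all add: EE_def tol_def len_def\<close>)
      have lt: "start i + j < length w" using j(1) w(2) False by (simp add: start_Suc len_def)
      have eq: "(f ^^ j) ((f ^^ start i) x) = (f ^^ (start i + j)) x" for x
        by (subst add.commute) (simp add: funpow_add)
      have "D ((f ^^ (start i + j)) (z \<omega>)) ((f ^^ (start i + j)) (z \<omega>')) < e / 3"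
      proof (rule U)
        show "w ! (start i + j) \<in> U" using w(1) lt by (auto simp: in_lists_conv_set)
      qed (use w(3,4) lt in \<open>auto simp: string_set_def\<close>)
      then show False using j(2) unfolding eq by simp
    qed
  qed
  have growth: "\<exists>X. \<forall>j. X \<le> real (start j) \<longrightarrow> s * start (Suc j) \<le> h * (p * free j)" if "0 \<le> s"
    using free_growth[OF that ratio(3)[OF that]] that s by (metis less_imp_le order_trans)
  \<comment> \<open>Defined by \<open>SOME\<close> so that \<open>N\<close> can be chosen before the
    sign of \<open>s\<close> is distinguished.\<close>
  define X where "X = (SOME X. \<forall>j. X \<le> real (start j) \<longrightarrow> s * start (Suc j) \<le> h * (p * free j))"
  have X: "s * start (Suc j) \<le> h * (p * free j)" if "0 \<le> s" "X \<le> real (start j)" for j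
    using someI_ex[OF growth[OF that(1)]] that(2) unfolding X_def by blast
  \<comment> \<open>As \<open>l \<le> 2 * start (J l) + p\<close> below, this puts
    \<open>start (J l)\<close> beyond \<open>X\<close>.\<close>
  obtain N :: nat where N: "2 * \<bar>X\<bar> + p \<le> N" using real_arch_simple by blast
  \<comment> \<open>The number of blocks that end by time \<open>l\<close>; the maximum exists
    because \<open>j \<le> start j\<close>.\<close>
  define J where "J l = (GREATEST j. start j \<le> l)" for l
  have J: "start (J l) \<le> l" "l < start (Suc (J l))" for l
  proof -
    have bound: "j \<le> l" if "start j \<le> l" for j
      using strict_mono_imp_increasing[OF strict_mono_start, of j] that by linarith
    show "start (J l) \<le> l"
      unfolding J_def by (rule GreatestI_nat[of _ 0 l]) (use bound in auto)
    show "l < start (Suc (J l))"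
    proof (rule ccontr)
      assume "\<not> ?thesis"
      then have "Suc (J l) \<le> J l"
        unfolding J_def by (intro Greatest_le_nat[where b = l]) (use bound in \<open>auto simp: not_less\<close>)
      then show False by simp
    qed
  qed
  have prod: "(\<Prod>i<j. 1 / real (card (EE i))) = (1 / card E) ^ free j" for j
    by (induction j) (auto simp: free_Suc EE_def, simp add: free_def)
  have weight: "(1 / real (card E)) ^ free (J l) \<le> exp (- s * l)" if l: "N \<le> l" for l
  proof (cases "0 \<le> s")
    case True
    have "real l \<le> (1 + \<theta>) * start (J l) + p" using J(2)[of l] start_Suc_le[of "J l"] by linarith
    also have "\<dots> \<le> 2 * real (start (J l)) + p" using \<theta>(2) by (intro add_mono mult_right_mono) auto
    finally have "X \<le> real (start (J l))" using N l by linarith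
    then have "s * start (Suc (J l)) \<le> h * (p * free (J l))" by (rule X[OF True])
    moreover have "s * l \<le> s * start (Suc (J l))" using J(2)[of l] True by (intro mult_left_mono) auto
    ultimately have "s * l \<le> h * (p * free (J l))" by linarith
    moreover have "(1 / real (card E)) ^ free (J l) \<le> exp (- (h * p)) ^ free (J l)"
    proof (rule power_mono)
      show "1 / real (card E) \<le> exp (- (h * p))"
        using E(3) E_pos by (simp add: exp_minus field_simps)
    qed simp
    ultimately show ?thesis
      by (simp add: exp_of_nat_mult[symmetric] mult_ac order_trans)
  next
    case False
    have "(1 / real (card E)) ^ free (J l) \<le> 1" using E_pos by (intro power_le_one) auto
    also have "1 \<le> exp (- s * l)" using False by (simp add: mult_nonpos_nonneg)
    finally show ?thesis .
  qed
  have "1 \<le> bowen_M_N f U (completely_irregular_set f) s N"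
    unfolding bowen_M_N_def
  proof (rule INF_greatest)
    fix \<G> assume "\<G> \<in> {\<G>. \<G> \<subseteq> {w \<in> lists U. w \<noteq> [] \<and> N \<le> length w}
      \<and> completely_irregular_set f \<subseteq> (\<Union>w\<in>\<G>. string_set f w)}"
    then have \<G>: "\<And>w. w \<in> \<G> \<Longrightarrow> w \<in> lists U" "\<And>w. w \<in> \<G> \<Longrightarrow> N \<le> length w"
      "completely_irregular_set f \<subseteq> (\<Union>w\<in>\<G>. string_set f w)" by auto
    show "1 \<le> (\<Sum>\<^sub>\<infinity>w\<in>\<G>. ennreal (exp (- s * real (length w))))"
    proof (rule cylinder_cover_sum_ge_1[of EE \<G> "\<lambda>w. {\<omega>. (\<forall>j. \<omega> j \<in> EE j) \<and> z \<omega> \<in> string_set f w}"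
          "\<lambda>w. J (length w)"])
      show "finite (EE i)" "EE i \<noteq> {}" for i by (rule EE)+
      show "\<omega> i = \<omega>' i"
        if "w \<in> \<G>" "\<omega> \<in> {\<omega>. (\<forall>j. \<omega> j \<in> EE j) \<and> z \<omega> \<in> string_set f w}"
          "\<omega>' \<in> {\<omega>. (\<forall>j. \<omega> j \<in> EE j) \<and> z \<omega> \<in> string_set f w}" "i < J (length w)" for w \<omega> \<omega>' i
      proof (rule determined[of \<omega> \<omega>' w i])
        have "start (Suc i) \<le> start (J (length w))"
          unfolding strict_mono_less_eq[OF strict_mono_start] using that(4) by (rule Suc_leI)
        then show "start (Suc i) \<le> length w" using J(1)[of "length w"] by linarith
      qed (use that(2,3) \<G>(1)[OF that(1)] in simp_all)
      show "ennreal (\<Prod>i<J (length w). 1 / card (EE i)) \<le> ennreal (exp (- s * real (length w)))"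
        if "w \<in> \<G>" for w
        unfolding prod by (intro ennreal_leI weight \<G>(2) that)
      show "\<exists>w\<in>\<G>. \<omega> \<in> {\<omega>. (\<forall>j. \<omega> j \<in> EE j) \<and> z \<omega> \<in> string_set f w}"
        if "\<And>i. \<omega> i \<in> EE i" for \<omega>
        using z_CI[OF that] \<G>(3) that by blast
    qed
  qed
  then show ?thesis by (intro exI[of _ N]) auto
qed

text \<open>The order of choices matters: the cover and the gap give \<open>e\<close> and \<delta>,
  these give the block length \<open>p\<close>, and \<theta> comes last, for each \<open>s\<close>.
  The lower bound is witnessed by a new cover \<open>U'\<close>, fine enough to tell separated
  shadows apart.\<close>

lemma bowen_entropy_completely_irregular_set:
  assumes \<Psi>: "countable \<Psi>"
      "\<And>\<phi> \<eta>. \<lbrakk>continuous_on UNIV \<phi>; 0 < \<eta>\<rbrakk> \<Longrightarrow> \<exists>\<psi>\<in>\<Psi>. \<forall>x::'m. \<bar>\<phi> x - \<psi> x\<bar> < (\<eta> :: real)"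
  shows "bowen_entropy f UNIV \<le> bowen_entropy f (completely_irregular_set f)"
proof (rule dense_le)
  fix a assume a: "a < bowen_entropy f UNIV"
  show "a \<le> bowen_entropy f (completely_irregular_set f)"
  proof (cases a)
    case (real h)
    then have "ereal h < bowen_entropy f UNIV" using a by simp
    then obtain U c N h' where U: "finite U" "\<And>V. V \<in> U \<Longrightarrow> open V" "\<Union>U = UNIV"
      "h < h'" "0 < c" "\<And>n. N \<le> n \<Longrightarrow> ennreal c \<le> bowen_M_N f U UNIV h' n"
      by (rule bowen_entropy_gtD) blast
    have "\<exists>e \<delta> N'. 0 < e \<and> 0 < \<delta> \<and>
        (\<forall>n\<ge>N'. \<exists>E. finite E \<and> separated n \<delta> e E \<and> exp (h * n) \<le> card E)"
      by (rule separated_sets[OF U])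
    then obtain e \<delta> N' where e: "0 < e" "0 < \<delta>"
      and sep: "\<forall>n\<ge>N'. \<exists>E. finite E \<and> separated n \<delta> e E \<and> exp (h * n) \<le> card E"
      by (elim exE conjE)
    have "0 < e / 3" using e(1) by simp
    then obtain U' where U': "finite U'" "\<And>V. V \<in> U' \<Longrightarrow> open V" "\<Union>U' = UNIV"
      "\<And>V x y. \<lbrakk>V \<in> U'; x \<in> V; y \<in> V\<rbrakk> \<Longrightarrow> D x y < e / 3"
      by (rule finite_small_cover) blast
    have "(\<lambda>n. real (g n) / real n) \<longlonglongrightarrow> 0"
      using mistake_function by (simp add: mistake_function_def)
    moreover have "0 < \<delta> / 2" using e(2) by simp
    ultimately have "\<forall>\<^sub>F n in sequentially. real (g n) / real n < \<delta> / 2" by (rule order_tendstoD(2))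
    then obtain N2 where N2: "\<And>n. N2 \<le> n \<Longrightarrow> real (g n) / real n < \<delta> / 2"
      by (auto simp: eventually_sequentially)
    \<comment> \<open>Large enough for many separated segments, for few mistakes and for shadowing
      with tolerance \<open>e / 3\<close>.\<close>
    define p where "p = max (max 1 N') (max N2 (thr (e / 3)))"
    have p: "1 \<le> p" "N' \<le> p" "thr (e / 3) \<le> p" "N2 \<le> p" by (auto simp: p_def)
    have gp: "2 * g p \<le> \<delta> * p" using N2[OF p(4)] p(1) by (simp add: field_simps)
    obtain E where E: "finite E" "separated p \<delta> e E" "exp (h * p) \<le> card E" using sep p(2) by blast
    obtain y n where n: "\<And>k. max 1 (thr (1 / Suc k)) \<le> n k" "\<And>k. 2 * n k \<le> n (Suc k)"
      and y: "\<And>\<phi>. \<lbrakk>continuous_on UNIV \<phi>; irregular_set f \<phi> \<noteq> {}\<rbrakk>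
        \<Longrightarrow> \<not> convergent (\<lambda>k. birkhoff_avg f \<phi> (n k) (y k))"
      by (rule universal_orbit_segments[OF compact_UNIV \<Psi>, of "\<lambda>k. max 1 (thr (1 / Suc k))" f]) blast+
    have "ereal h \<le> bowen_entropy f (completely_irregular_set f)"
    proof (rule bowen_entropy_geI[OF U'(1-3)])
      show "\<exists>N. bowen_M_N f U' (completely_irregular_set f) s N \<noteq> 0" if "s < h" for s
        by (rule bowen_M_N_completely_irregular_set_nonzero[OF p(1,3) gp e(1) E U'(4) n y that])
    qed
    then show ?thesis using real by simp
  qed (use a in auto)
qed

end

section \<open>The Riemannian distance\<close>

locale atlas =
  fixes A :: "('m::t2_space, 'e::euclidean_space) chart set"
  assumes smooth_atlas: "smooth_atlas A"
begin

lemma open_cdom: "c \<in> A \<Longrightarrow> open (cdom c)"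
  and open_coord_image: "c \<in> A \<Longrightarrow> open (coord c ` cdom c)"
  and chart_homeomorphism: "c \<in> A \<Longrightarrow> homeomorphism (cdom c) (coord c ` cdom c) (coord c) (param c)"
  and transition_C_k: "\<lbrakk>c \<in> A; d \<in> A\<rbrakk> \<Longrightarrow> C_k_on k (coord d \<circ> param c) (coord c ` (cdom c \<inter> cdom d))"
  using smooth_atlas unfolding smooth_atlas_def by blast+

lemma chart_at: "chart_at A x \<in> A" "x \<in> cdom (chart_at A x)"
proof -
  have "x \<in> (\<Union>c\<in>A. cdom c)" using smooth_atlas unfolding smooth_atlas_def by simp
  then have "\<exists>c. c \<in> A \<and> x \<in> cdom c" by blast
  from someI_ex[OF this] show "chart_at A x \<in> A" "x \<in> cdom (chart_at A x)"
    unfolding chart_at_def by blast+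
qed

lemma param_coord: "\<lbrakk>c \<in> A; x \<in> cdom c\<rbrakk> \<Longrightarrow> param c (coord c x) = x"
  and coord_param: "\<lbrakk>c \<in> A; y \<in> coord c ` cdom c\<rbrakk> \<Longrightarrow> coord c (param c y) = y"
  and param_in: "\<lbrakk>c \<in> A; y \<in> coord c ` cdom c\<rbrakk> \<Longrightarrow> param c y \<in> cdom c"
  and continuous_coord: "c \<in> A \<Longrightarrow> continuous_on (cdom c) (coord c)"
  and continuous_param: "c \<in> A \<Longrightarrow> continuous_on (coord c ` cdom c) (param c)"
  using chart_homeomorphism unfolding homeomorphism_def by fastforce+

lemma open_coord_subimage:
  assumes "c \<in> A" "open V"
  shows "open (coord c ` (cdom c \<inter> V))"
proof -
  have "openin (top_of_set (coord c ` cdom c)) (coord c ` (cdom c \<inter> V))"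
    by (rule homeomorphism_imp_open_map[OF chart_homeomorphism[OF assms(1)]])
      (use assms(2) in \<open>auto simp: openin_open\<close>)
  then show ?thesis using openin_open_trans open_coord_image[OF assms(1)] by blast
qed

lemma open_param_image:
  assumes "c \<in> A" "open B" "B \<subseteq> coord c ` cdom c"
  shows "open (param c ` B)"
proof -
  have "openin (top_of_set (cdom c)) (param c ` B)"
    by (rule homeomorphism_imp_open_map[OF homeomorphism_symD[OF chart_homeomorphism[OF assms(1)]]])
      (use assms(2,3) in \<open>auto simp: openin_open\<close>)
  then show ?thesis using openin_open_trans open_cdom[OF assms(1)] by blast
qed

lemma transition_has_derivative:
  assumes "c \<in> A" "d \<in> A" "y \<in> coord c ` (cdom c \<inter> cdom d)"
  shows "((coord d \<circ> param c) has_derivative frechet_derivative (coord d \<circ> param c) (at y)) (at y)"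
proof -
  have "(coord d \<circ> param c) differentiable_on (coord c ` (cdom c \<inter> cdom d))"
    using transition_C_k[OF assms(1,2), of 1] by simp
  then have "(coord d \<circ> param c) differentiable (at y)"
    using open_coord_subimage[OF assms(1) open_cdom[OF assms(2)]] assms(3)
    by (auto simp: differentiable_on_eq_differentiable_at)
  then show ?thesis by (simp add: frechet_derivative_works)
qed

lemma continuous_transition_derivative:
  assumes "c \<in> A" "d \<in> A"
  shows "continuous_on (coord c ` (cdom c \<inter> cdom d)) (\<lambda>y. frechet_derivative (coord d \<circ> param c) (at y) v)"
  using transition_C_k[OF assms, of 1] by simp

lemma vec_of_coords_has_derivative:
  assumes "c \<in> A" "x \<in> cdom c"
  shows "((coord (chart_at A x) \<circ> param c) has_derivative vec_of_coords A c x) (at (coord c x))"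
  unfolding vec_of_coords_def
  by (rule transition_has_derivative) (use assms chart_at in auto)

lemma linear_vec_of_coords:
  assumes "c \<in> A" "x \<in> cdom c"
  shows "linear (vec_of_coords A c x)"
  using vec_of_coords_has_derivative[OF assms] by (rule has_derivative_linear)

text \<open>The derivative of the transition back is a left inverse, by the chain rule for a
  composite that is the identity near the point.\<close>

lemma vec_of_coords_nonzero:
  assumes "c \<in> A" "x \<in> cdom c" "v \<noteq> 0"
  shows "vec_of_coords A c x v \<noteq> 0"
proof
  assume zero: "vec_of_coords A c x v = 0"
  let ?d = "chart_at A x"
  let ?L = "frechet_derivative (coord c \<circ> param ?d) (at (coord ?d x))"
  have "((coord c \<circ> param ?d) has_derivative ?L) (at ((coord ?d \<circ> param c) (coord c x)))"
    using transition_has_derivative[of ?d c "coord ?d x"] chart_at assms by (simp add: param_coord)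
  then have comp: "((coord c \<circ> param ?d) \<circ> (coord ?d \<circ> param c) has_derivative ?L \<circ> vec_of_coords A c x)
      (at (coord c x))"
    by (rule diff_chain_at[OF vec_of_coords_has_derivative[OF assms(1,2)]])
  have "((\<lambda>y. y) has_derivative ?L \<circ> vec_of_coords A c x) (at (coord c x))"
  proof (rule has_derivative_transform_within_open[OF comp])
    show "open (coord c ` (cdom c \<inter> cdom ?d))"
      by (rule open_coord_subimage[OF assms(1) open_cdom[OF chart_at(1)]])
    show "coord c x \<in> coord c ` (cdom c \<inter> cdom ?d)" using assms chart_at by blast
    show "((coord c \<circ> param ?d) \<circ> (coord ?d \<circ> param c)) y = y"
      if "y \<in> coord c ` (cdom c \<inter> cdom ?d)" for y
      using that assms(1) chart_at(1) by (auto simp: param_coord)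
  qed
  then have "?L \<circ> vec_of_coords A c x = (\<lambda>y. y)"
    by (rule has_derivative_unique) (rule has_derivative_ident)
  then have "?L (vec_of_coords A c x v) = v" by (metis comp_apply)
  moreover have "linear ?L"
    by (rule has_derivative_linear[OF transition_has_derivative]) (use chart_at assms in auto)
  ultimately show False using zero assms(3) by (simp add: linear_0)
qed

text \<open>\<open>velocity\<close> uses a preferred chart that jumps along the curve;
  \<open>vec_of_coords\<close> relates it to the continuous derivative in one fixed chart.\<close>

lemma velocity_in_chart:
  assumes "C1_curve_on A a b \<gamma>" "t \<in> {a<..<b}" "c \<in> A" "\<gamma> t \<in> cdom c"
    and D: "((coord c \<circ> \<gamma>) has_vector_derivative D) (at t within {a..b})"
  shows "((coord c \<circ> \<gamma>) has_vector_derivative D) (at t)"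
    and "velocity A \<gamma> t = vec_of_coords A c (\<gamma> t) D"
proof -
  have cont: "continuous_on {a<..<b} \<gamma>"
    using assms(1) unfolding C1_curve_on_def by (rule continuous_on_subset[OF conjunct1]) auto
  show D': "((coord c \<circ> \<gamma>) has_vector_derivative D) (at t)"
    using D assms(2) by (simp add: at_within_Icc_at)
  let ?d = "chart_at A (\<gamma> t)"
  let ?L = "vec_of_coords A c (\<gamma> t)"
  have "((coord ?d \<circ> param c) has_derivative ?L) (at ((coord c \<circ> \<gamma>) t))"
    using vec_of_coords_has_derivative[OF assms(3,4)] by simp
  with D' have "((coord ?d \<circ> param c) \<circ> (coord c \<circ> \<gamma>) has_derivative ?L \<circ> (\<lambda>h. h *\<^sub>R D)) (at t)"
    unfolding has_vector_derivative_def by (rule diff_chain_at)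
  moreover have "?L \<circ> (\<lambda>h. h *\<^sub>R D) = (\<lambda>h. h *\<^sub>R ?L D)"
    using linear_vec_of_coords[OF assms(3,4)] by (auto simp: linear_scale)
  ultimately have "((coord ?d \<circ> param c) \<circ> (coord c \<circ> \<gamma>) has_vector_derivative ?L D) (at t)"
    by (simp add: has_vector_derivative_def)
  then have "((coord ?d \<circ> \<gamma>) has_vector_derivative ?L D) (at t)"
  proof (rule has_vector_derivative_transform_within_open)
    show "open ({a<..<b} \<inter> \<gamma> -` cdom c)"
      by (rule continuous_open_preimage[OF cont open_greaterThanLessThan open_cdom[OF assms(3)]])
    show "((coord ?d \<circ> param c) \<circ> (coord c \<circ> \<gamma>)) s = (coord ?d \<circ> \<gamma>) s"
      if "s \<in> {a<..<b} \<inter> \<gamma> -` cdom c" for s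
      using that assms(3) by (simp add: param_coord)
  qed (use assms in simp)
  then show "velocity A \<gamma> t = ?L D" unfolding velocity_def by (rule vector_derivative_at)
qed

end

locale riemannian_manifold = atlas A
  for A :: "('m::t2_space, 'e::euclidean_space) chart set" +
  fixes G :: "'m \<Rightarrow> 'e \<Rightarrow> 'e \<Rightarrow> real"
  assumes riemannian_metric: "riemannian_metric A G"
begin

lemma G_bilinear: "bilinear (G x)"
  and G_pos: "v \<noteq> 0 \<Longrightarrow> 0 < G x v v"
  using riemannian_metric unfolding riemannian_metric_def by blast+

lemma G_nonneg: "0 \<le> G x v v"
proof (cases "v = 0")
  case True
  then show ?thesis using bilinear_lzero[OF G_bilinear] by simp
qed (use G_pos less_imp_le in blast)

lemma tnorm_nonneg: "0 \<le> tnorm G x v"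
  unfolding tnorm_def using G_nonneg by simp

definition chart_metric :: "('m, 'e) chart \<Rightarrow> 'e \<Rightarrow> 'e \<Rightarrow> 'e \<Rightarrow> real" where
  "chart_metric c y v w = G (param c y) (vec_of_coords A c (param c y) v) (vec_of_coords A c (param c y) w)"

lemma chart_metric_bilinear:
  assumes "c \<in> A" "y \<in> coord c ` cdom c"
  shows "bilinear (chart_metric c y)"
proof -
  have lin: "linear (vec_of_coords A c (param c y))"
    by (rule linear_vec_of_coords[OF assms(1) param_in[OF assms]])
  show ?thesis
    unfolding bilinear_def chart_metric_def
  proof (intro conjI allI)
    show "linear (\<lambda>w. G (param c y) (vec_of_coords A c (param c y) v) (vec_of_coords A c (param c y) w))" for v
      using linear_compose[OF lin, of "G (param c y) (vec_of_coords A c (param c y) v)"] G_bilinear[of "param c y"]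
      by (simp add: bilinear_def o_def)
    show "linear (\<lambda>w. G (param c y) (vec_of_coords A c (param c y) w) (vec_of_coords A c (param c y) v))" for v
      using linear_compose[OF lin, of "\<lambda>u. G (param c y) u (vec_of_coords A c (param c y) v)"] G_bilinear[of "param c y"]
      by (simp add: bilinear_def o_def)
  qed
qed

text \<open>A metric is given as continuous in the base point for fixed vectors; expansion in the
  basis yields joint continuity.\<close>

lemma chart_metric_continuous:
  assumes "c \<in> A"
  shows "continuous_on (coord c ` cdom c \<times> UNIV) (\<lambda>(y, v). chart_metric c y v v)"
proof -
  have cont: "continuous_on (coord c ` cdom c) (\<lambda>y. chart_metric c y v w)" for v w
  proof -
    have "C_k_on 0 (\<lambda>y. chart_metric c y v w) (coord c ` cdom c)"
      using riemannian_metric assms unfolding riemannian_metric_def chart_metric_def by blast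
    then show ?thesis by simp
  qed
  have "continuous_on (coord c ` cdom c \<times> UNIV)
      (\<lambda>p. \<Sum>(b, b')\<in>Basis \<times> Basis. (snd p \<bullet> b) * (snd p \<bullet> b') * chart_metric c (fst p) b b')"
    unfolding case_prod_beta
    by (intro continuous_intros continuous_on_compose2[OF cont]) auto
  moreover have "(case p of (y, v) \<Rightarrow> chart_metric c y v v)
      = (\<Sum>(b, b')\<in>Basis \<times> Basis. (snd p \<bullet> b) * (snd p \<bullet> b') * chart_metric c (fst p) b b')"
    if "p \<in> coord c ` cdom c \<times> UNIV" for p
  proof -
    obtain y v where p: "p = (y, v)" "y \<in> coord c ` cdom c" using \<open>p \<in> _\<close> by blast
    note bil = chart_metric_bilinear[OF assms p(2)]
    have "chart_metric c y v v = chart_metric c y (\<Sum>b\<in>Basis. (v \<bullet> b) *\<^sub>R b) (\<Sum>b\<in>Basis. (v \<bullet> b) *\<^sub>R b)"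
      by (simp add: euclidean_representation)
    also have "\<dots> = (\<Sum>(b, b')\<in>Basis \<times> Basis. chart_metric c y ((v \<bullet> b) *\<^sub>R b) ((v \<bullet> b') *\<^sub>R b'))"
      by (rule bilinear_sum[OF bil])
    finally show ?thesis
      by (simp add: p(1) bilinear_lmul[OF bil] bilinear_rmul[OF bil] mult_ac)
  qed
  ultimately show ?thesis by (rule continuous_on_eq[OF _ sym])
qed

text \<open>The form has a positive minimum on the compact product of \<open>K\<close> with the unit
  sphere; homogeneity does the rest.\<close>

lemma chart_metric_lower_bound:
  assumes "c \<in> A" "compact K" "K \<subseteq> coord c ` cdom c"
  obtains \<kappa> where "0 < \<kappa>"
    "\<And>y v. y \<in> K \<Longrightarrow> \<kappa> * norm v \<le> tnorm G (param c y) (vec_of_coords A c (param c y) v)"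
proof (cases "K = {}")
  case False
  let ?S = "K \<times> sphere (0 :: 'e) 1"
  have "compact ?S" using assms(2) by (intro compact_Times) auto
  moreover have "?S \<noteq> {}" using False by simp
  moreover have "continuous_on ?S (\<lambda>(y, v). chart_metric c y v v)"
    by (rule continuous_on_subset[OF chart_metric_continuous[OF assms(1)]]) (use assms(3) in auto)
  ultimately have "\<exists>p\<in>?S. \<forall>q\<in>?S. (\<lambda>(y, v). chart_metric c y v v) p \<le> (\<lambda>(y, v). chart_metric c y v v) q"
    by (rule continuous_attains_inf)
  then obtain p where p: "p \<in> ?S"
    "\<And>q. q \<in> ?S \<Longrightarrow> (\<lambda>(y, v). chart_metric c y v v) p \<le> (\<lambda>(y, v). chart_metric c y v v) q"
    by blast
  obtain y0 v0 where y0: "p = (y0, v0)" by (cases p)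
  define \<mu> where "\<mu> = chart_metric c y0 v0 v0"
  have "0 < \<mu>"
    unfolding \<mu>_def chart_metric_def
    by (intro G_pos vec_of_coords_nonzero assms(1) param_in) (use p(1) y0 assms(3) in auto)
  have lower: "\<mu> * (norm v)\<^sup>2 \<le> chart_metric c y v v" if "y \<in> K" for y v
  proof (cases "v = 0")
    case True
    then show ?thesis unfolding chart_metric_def using G_nonneg by simp
  next
    case False
    have bil: "bilinear (chart_metric c y)"
      by (rule chart_metric_bilinear) (use assms \<open>y \<in> K\<close> in auto)
    have "\<mu> \<le> chart_metric c y (v /\<^sub>R norm v) (v /\<^sub>R norm v)"
      using p(2)[of "(y, v /\<^sub>R norm v)"] \<open>y \<in> K\<close> False by (simp add: y0 \<mu>_def)
    also have "\<dots> = chart_metric c y v v / (norm v)\<^sup>2"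
      by (simp add: bilinear_lmul[OF bil] bilinear_rmul[OF bil] power2_eq_square field_simps)
    finally show ?thesis using False by (simp add: field_simps)
  qed
  show thesis
  proof (rule that[of "sqrt \<mu>"])
    show "sqrt \<mu> * norm v \<le> tnorm G (param c y) (vec_of_coords A c (param c y) v)" if "y \<in> K" for y v
    proof -
      have "sqrt \<mu> * norm v = sqrt (\<mu> * (norm v)\<^sup>2)" by (simp add: real_sqrt_mult)
      also have "\<dots> \<le> sqrt (chart_metric c y v v)" by (rule real_sqrt_le_mono[OF lower[OF that]])
      finally show ?thesis by (simp add: tnorm_def chart_metric_def)
    qed
  qed (use \<open>0 < \<mu>\<close> in simp)
qed (use that[of 1] in simp)

end

subsection \<open>Lengths of paths leaving a chart ball\<close>

context riemannian_manifold begin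

lemma C1_curve_speed_integrable:
  assumes "C1_curve_on A a b \<gamma>" "a < b" "c \<in> A" "\<gamma> ` {a..b} \<subseteq> cdom c"
  shows "(\<lambda>t. tnorm G (\<gamma> t) (velocity A \<gamma> t)) integrable_on {a..b}"
proof -
  have *: "{a..b} \<inter> \<gamma> -` cdom c = {a..b}" using assms(4) by blast
  obtain D where D: "continuous_on {a..b} D"
    "\<And>t. t \<in> {a..b} \<Longrightarrow> ((coord c \<circ> \<gamma>) has_vector_derivative D t) (at t within {a..b})"
    using assms(1,3) unfolding C1_curve_on_def by (metis *)
  have cont_\<gamma>: "continuous_on {a..b} \<gamma>" using assms(1) by (simp add: C1_curve_on_def)
  have cont_pair: "continuous_on {a..b} (\<lambda>t. (coord c (\<gamma> t), D t))"
    by (intro continuous_on_Pair continuous_on_compose2[OF continuous_coord[OF assms(3)] cont_\<gamma>] assms(4) D(1))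
  have "continuous_on {a..b} (\<lambda>t. (\<lambda>(y, v). chart_metric c y v v) (coord c (\<gamma> t), D t))"
    by (rule continuous_on_compose2[OF chart_metric_continuous[OF assms(3)] cont_pair]) (use assms(4) in auto)
  then have "continuous_on {a..b} (\<lambda>t. sqrt (chart_metric c (coord c (\<gamma> t)) (D t) (D t)))"
    by (intro continuous_on_real_sqrt) simp
  then have "(\<lambda>t. sqrt (chart_metric c (coord c (\<gamma> t)) (D t) (D t))) integrable_on {a..b}"
    by (rule integrable_continuous_real)
  then show ?thesis
  \<comment> \<open>At the end points the two-sided derivative in \<open>velocity\<close> is not
    controlled.\<close>
  proof (rule integrable_spike_finite[of "{a, b}", rotated 2])
    fix t assume t: "t \<in> {a..b} - {a, b}"
    then have "\<gamma> t \<in> cdom c" using assms(4) by auto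
    moreover have "velocity A \<gamma> t = vec_of_coords A c (\<gamma> t) (D t)"
      by (rule velocity_in_chart(2)[OF assms(1) _ assms(3) \<open>\<gamma> t \<in> cdom c\<close> D(2)]) (use t in auto)
    ultimately show "tnorm G (\<gamma> t) (velocity A \<gamma> t) = sqrt (chart_metric c (coord c (\<gamma> t)) (D t) (D t))"
      by (simp add: tnorm_def chart_metric_def param_coord[OF assms(3)])
  qed simp
qed

text \<open>A nonintegrable function has integral 0 by convention, so a bound on lengths needs this
  first. Near each time the path stays in one chart and has no other breakpoint; the interval is
  split at that time.\<close>

lemma speed_integrable:
  assumes "piecewise_C1_path A \<gamma>"
  shows "(\<lambda>t. tnorm G (\<gamma> t) (velocity A \<gamma> t)) integrable_on {0..1}"
proof -
  have cont: "continuous_on {0..1} \<gamma>" using assms by (simp add: piecewise_C1_path_def)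
  obtain S where "finite S"
    and S: "\<forall>a b. 0 \<le> a \<and> a < b \<and> b \<le> 1 \<and> {a<..<b} \<inter> S = {} \<longrightarrow> C1_curve_on A a b \<gamma>"
    using assms unfolding piecewise_C1_path_def by blast
  let ?h = "\<lambda>t. tnorm G (\<gamma> t) (velocity A \<gamma> t)"
  have piece: "?h integrable_on {a..b}"
    if "0 \<le> a" "a \<le> b" "b \<le> 1" "{a<..<b} \<inter> S = {}" "c \<in> A" "\<gamma> ` {a..b} \<subseteq> cdom c" for a b c
  proof (cases "a = b")
    case False
    then have "a < b" using that(2) by simp
    moreover have "C1_curve_on A a b \<gamma>" using S that \<open>a < b\<close> by blast
    ultimately show ?thesis using that(5,6) by (intro C1_curve_speed_integrable)
  next
    case True
    then show ?thesis using integrable_on_refl[of ?h a] by simp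
  qed
  have "?h integrable_on cbox 0 1"
  proof (rule integrable_on_little_subintervals, rule ballI)
    fix t :: real assume t: "t \<in> cbox 0 1"
    let ?c = "chart_at A (\<gamma> t)"
    obtain T where T: "open T" "{0..1} \<inter> \<gamma> -` cdom ?c = {0..1} \<inter> T"
      using cont open_cdom[OF chart_at(1)] unfolding continuous_on_open_invariant by (metis Int_commute)
    have "t \<in> T" using T(2) t chart_at(2) by auto
    then obtain d1 where d1: "0 < d1" "ball t d1 \<subseteq> T" using T(1) openE by metis
    obtain d2 where d2: "0 < d2" "\<And>x. \<lbrakk>x \<in> S; x \<noteq> t\<rbrakk> \<Longrightarrow> d2 \<le> dist t x"
      using finite_set_avoid[OF \<open>finite S\<close>, of t] by blast
    show "\<exists>d>0. \<forall>u v. t \<in> cbox u v \<and> cbox u v \<subseteq> ball t d \<and> cbox u v \<subseteq> cbox 0 1 \<longrightarrow> ?h integrable_on cbox u v"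
    proof (intro exI[of _ "min d1 d2"] conjI allI impI)
      show "0 < min d1 d2" using d1 d2 by simp
      fix u v assume uv: "t \<in> cbox u v \<and> cbox u v \<subseteq> ball t (min d1 d2) \<and> cbox u v \<subseteq> cbox 0 1"
      then have *: "u \<le> t" "t \<le> v" "0 \<le> u" "v \<le> 1" by auto
      have chart: "\<gamma> ` {u..v} \<subseteq> cdom ?c"
      proof
        fix z assume "z \<in> \<gamma> ` {u..v}"
        then obtain s where s: "s \<in> {u..v}" "z = \<gamma> s" by blast
        then have "s \<in> cbox u v" by simp
        then have "s \<in> ball t (min d1 d2)" "s \<in> cbox 0 1" using uv by blast+
        then have "s \<in> {0..1} \<inter> T" using subsetD[OF d1(2), of s] by simp
        then show "z \<in> cdom ?c" using T(2) s(2) by blast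
      qed
      have avoid: "x \<notin> S" if "x \<in> {u..v}" "x \<noteq> t" for x
      proof
        assume "x \<in> S"
        then have "d2 \<le> dist t x" by (rule d2(2)[OF _ that(2)])
        moreover have "x \<in> cbox u v" using that(1) by simp
        then have "x \<in> ball t (min d1 d2)" using uv by blast
        ultimately show False by simp
      qed
      have "?h integrable_on {u..t}"
        by (rule piece[OF _ _ _ _ chart_at(1)]) (use * chart avoid in auto)
      moreover have "?h integrable_on {t..v}"
        by (rule piece[OF _ _ _ _ chart_at(1)]) (use * chart avoid in auto)
      ultimately show "?h integrable_on cbox u v"
        using Henstock_Kurzweil_Integration.integrable_combine[OF *(1,2)] by simp
    qed
  qed
  then show ?thesis by simp
qed

text \<open>Until it first leaves the ball of radius \<open>2 * r\<close> the path stays in one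
  chart, where its coordinates move by at least \<open>r\<close> and its speed is at least \<kappa>
  times the Euclidean one.\<close>

lemma path_length_ge:
  assumes \<gamma>: "piecewise_C1_path A \<gamma>" and c: "c \<in> A" and r: "0 < r"
    and ball: "cball p (2 * r) \<subseteq> coord c ` cdom c"
    and \<kappa>: "0 < \<kappa>"
      "\<And>y v. y \<in> cball p (2 * r) \<Longrightarrow> \<kappa> * norm v \<le> tnorm G (param c y) (vec_of_coords A c (param c y) v)"
    and ends: "\<gamma> 0 \<in> param c ` ball p r" "\<gamma> 1 \<notin> param c ` ball p (2 * r)"
  shows "\<kappa> * r \<le> path_length A G \<gamma>"
proof -
  have cont: "continuous_on {0..1} \<gamma>" using \<gamma> by (simp add: piecewise_C1_path_def)
  obtain S where "finite S"
    and S: "\<forall>a b. 0 \<le> a \<and> a < b \<and> b \<le> 1 \<and> {a<..<b} \<inter> S = {} \<longrightarrow> C1_curve_on A a b \<gamma>"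
    using \<gamma> unfolding piecewise_C1_path_def by blast
  let ?h = "\<lambda>t. tnorm G (\<gamma> t) (velocity A \<gamma> t)"
  let ?O = "param c ` ball p (2 * r)"
  let ?K = "param c ` cball p (2 * r)"
  let ?u = "coord c \<circ> \<gamma>"
  have "open ?O" by (rule open_param_image[OF c]) (use ball ball_subset_cball in auto)
  have "compact ?K"
    by (intro compact_continuous_image continuous_on_subset[OF continuous_param[OF c] ball]) simp
  then have "closed ?K" by (rule compact_imp_closed)
  have K: "?K \<subseteq> cdom c" using param_in[OF c] ball by blast
  define T where "T = {0..1} \<inter> \<gamma> -` (- ?O)"
  have "closed T"
    unfolding T_def by (rule continuous_closed_preimage[OF cont]) (use \<open>open ?O\<close> in auto)
  then have "compact T" unfolding T_def by (metis compact_Icc compact_Int_closed inf.right_idem inf_commute inf_left_idem)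
  moreover have "1 \<in> T" using ends(2) by (simp add: T_def)
  then have "T \<noteq> {}" by blast
  ultimately have "\<exists>\<tau>\<in>T. \<forall>t\<in>T. \<tau> \<le> t" by (rule compact_attains_inf)
  then obtain \<tau> where \<tau>: "\<tau> \<in> T" "\<And>t. t \<in> T \<Longrightarrow> \<tau> \<le> t" by blast
  have "\<gamma> 0 \<in> ?O" using ends(1) r by auto
  then have \<tau>01: "0 < \<tau>" "\<tau> \<le> 1" using \<tau>(1) by (auto simp: T_def order_less_le)
  have before: "\<gamma> t \<in> ?O" if "t \<in> {0..<\<tau>}" for t
    using \<tau>(2)[of t] that \<tau>01 by (force simp: T_def)
  \<comment> \<open>At the exit time the path has left the open ball, but by continuity it is in the
    closed one and so still in the chart.\<close>
  have "\<gamma> ` closure {0..<\<tau>} \<subseteq> ?K"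
  proof (rule image_closure_subset[OF _ \<open>closed ?K\<close>])
    show "continuous_on (closure {0..<\<tau>}) \<gamma>" using \<tau>01 by (intro continuous_on_subset[OF cont]) auto
    show "\<gamma> ` {0..<\<tau>} \<subseteq> ?K" using before ball_subset_cball by blast
  qed
  then have in_K: "\<gamma> t \<in> ?K" if "t \<in> {0..\<tau>}" for t using that \<tau>01 by auto
  have coord_K: "coord c z \<in> cball p (2 * r)" if z: "z \<in> ?K" for z
  proof -
    obtain y where y: "y \<in> cball p (2 * r)" "z = param c y" using z by blast
    then show ?thesis using coord_param[OF c subsetD[OF ball y(1)]] by simp
  qed
  have "norm (?u \<tau> - ?u 0) \<ge> r"
  proof -
    have "\<gamma> \<tau> \<in> ?K" using in_K \<tau>01 by simp
    moreover have "\<gamma> \<tau> \<notin> ?O" using \<tau>(1) by (simp add: T_def)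
    moreover have "\<gamma> \<tau> = param c (coord c (\<gamma> \<tau>))"
      using param_coord[OF c subsetD[OF K \<open>\<gamma> \<tau> \<in> ?K\<close>]] by simp
    ultimately have "coord c (\<gamma> \<tau>) \<notin> ball p (2 * r)" by (metis imageI)
    then have 1: "2 * r \<le> dist p (coord c (\<gamma> \<tau>))" by simp
    obtain q where q: "q \<in> ball p r" "\<gamma> 0 = param c q" using ends(1) by blast
    then have "q \<in> coord c ` cdom c" using ball r by auto
    then have 2: "dist p (coord c (\<gamma> 0)) < r" using q coord_param[OF c] by simp
    have "dist p (coord c (\<gamma> \<tau>)) \<le> dist p (coord c (\<gamma> 0)) + dist (coord c (\<gamma> \<tau>)) (coord c (\<gamma> 0))"
      by (rule dist_triangle2)
    then show ?thesis using 1 2 by (simp add: dist_norm)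
  qed
  have deriv: "(?u has_vector_derivative vector_derivative ?u (at t)) (at t)"
      "velocity A \<gamma> t = vec_of_coords A c (\<gamma> t) (vector_derivative ?u (at t))"
    if t: "t \<in> {0<..<\<tau>} - S" for t
  proof -
    obtain d where d: "0 < d" "\<And>x. \<lbrakk>x \<in> S; x \<noteq> t\<rbrakk> \<Longrightarrow> d \<le> dist t x"
      using finite_set_avoid[OF \<open>finite S\<close>, of t] by blast
    define a b where "a = max 0 (t - d)" and "b = min 1 (t + d)"
    have ab: "0 \<le> a" "a < t" "t < b" "b \<le> 1" using t d(1) \<tau>01 by (auto simp: a_def b_def)
    have "x \<notin> S" if "x \<in> {a<..<b}" for x
    proof (cases "x = t")
      case False
      show ?thesis
      proof
        assume "x \<in> S"
        from d(2)[OF this False] that show False by (auto simp: a_def b_def dist_real_def)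
      qed
    qed (use t in simp)
    then have "{a<..<b} \<inter> S = {}" by blast
    then have "C1_curve_on A a b \<gamma>" using ab S by (meson less_trans)
    moreover have "\<gamma> t \<in> cdom c" using in_K[of t] K t by auto
    moreover from this obtain D where D: "(?u has_vector_derivative D) (at t within {a..b})"
      using \<open>C1_curve_on A a b \<gamma>\<close> c ab unfolding C1_curve_on_def by force
    ultimately have "(?u has_vector_derivative D) (at t)" "velocity A \<gamma> t = vec_of_coords A c (\<gamma> t) D"
      using velocity_in_chart[of a b \<gamma> t c D] c ab by auto
    then show "(?u has_vector_derivative vector_derivative ?u (at t)) (at t)"
      "velocity A \<gamma> t = vec_of_coords A c (\<gamma> t) (vector_derivative ?u (at t))"
      by (simp_all add: vector_derivative_at)
  qed
  \<comment> \<open>The value 0 at breakpoints and end points keeps the bound by the speed valid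
    there.\<close>
  define u' where "u' t = (if t \<in> {0<..<\<tau>} - S then vector_derivative ?u (at t) else 0)" for t
  have ftc: "(u' has_integral (?u \<tau> - ?u 0)) {0..\<tau>}"
  proof (rule fundamental_theorem_of_calculus_interior_strong[OF \<open>finite S\<close>])
    show "continuous_on {0..\<tau>} ?u"
    proof (rule continuous_on_compose)
      show "continuous_on {0..\<tau>} \<gamma>" using \<tau>01 by (intro continuous_on_subset[OF cont]) auto
      show "continuous_on (\<gamma> ` {0..\<tau>}) (coord c)"
        by (rule continuous_on_subset[OF continuous_coord[OF c]]) (use in_K K in blast)
    qed
    show "(?u has_vector_derivative u' t) (at t)" if t: "t \<in> {0<..<\<tau>} - S" for t
      using deriv(1)[OF t] t unfolding u'_def by (simp only: if_True)
  qed (use \<tau>01 in simp)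
  have int: "?h integrable_on {0..1}" by (rule speed_integrable[OF \<gamma>])
  then have int_\<tau>: "?h integrable_on {0..\<tau>}" by (rule integrable_on_subinterval) (use \<tau>01 in auto)
  have "norm (integral {0..\<tau>} u') \<le> integral {0..\<tau>} (\<lambda>t. ?h t / \<kappa>)"
  proof (rule integral_norm_bound_integral)
    show "u' integrable_on {0..\<tau>}" using ftc by blast
    show "(\<lambda>t. ?h t / \<kappa>) integrable_on {0..\<tau>}" using int_\<tau> by (rule integrable_on_divide)
    fix t assume t: "t \<in> {0..\<tau>}"
    show "norm (u' t) \<le> ?h t / \<kappa>"
    proof (cases "t \<in> {0<..<\<tau>} - S")
      case True
      have "\<kappa> * norm (vector_derivative ?u (at t)) \<le> tnorm G (param c (coord c (\<gamma> t)))
          (vec_of_coords A c (param c (coord c (\<gamma> t))) (vector_derivative ?u (at t)))"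
        by (rule \<kappa>(2)[OF coord_K[OF in_K[OF t]]])
      also have "param c (coord c (\<gamma> t)) = \<gamma> t" using in_K[OF t] K by (intro param_coord[OF c]) auto
      finally show ?thesis using \<kappa>(1) True deriv(2)[OF True] by (simp add: u'_def field_simps o_def)
    next
      case False
      then have "u' t = 0" unfolding u'_def by (rule if_not_P)
      then show ?thesis using \<kappa>(1) tnorm_nonneg[of "\<gamma> t" "velocity A \<gamma> t"] by simp
    qed
  qed
  then have "r \<le> integral {0..\<tau>} ?h / \<kappa>"
    using \<open>norm (?u \<tau> - ?u 0) \<ge> r\<close> integral_unique[OF ftc] by simp
  moreover have "integral {0..\<tau>} ?h \<le> integral {0..1} ?h"
    by (rule integral_subset_le) (use int int_\<tau> \<tau>01 tnorm_nonneg in auto)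
  ultimately show ?thesis using \<kappa>(1) by (simp add: path_length_def field_simps)
qed

end

subsection \<open>Piecewise smooth connectedness and the topology of the manifold\<close>

context atlas begin

text \<open>Without a path between two points, \<open>length_dist\<close> would be the meaningless
  \<open>Inf {}\<close>.\<close>

definition joined :: "'m \<Rightarrow> 'm \<Rightarrow> bool" where
  "joined x y \<longleftrightarrow> (\<exists>\<gamma>. piecewise_C1_path A \<gamma> \<and> \<gamma> 0 = x \<and> \<gamma> 1 = y)"

lemma C1_curve_on_affine:
  assumes "C1_curve_on A (m * a + k) (m * b + k) \<gamma>" "0 < m"
    and \<gamma>': "\<And>t. t \<in> {a..b} \<Longrightarrow> \<gamma>' t = \<gamma> (m * t + k)"
  shows "C1_curve_on A a b \<gamma>'"
proof -
  let ?l = "\<lambda>t. m * t + k"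
  have l: "?l ` {a..b} \<subseteq> {?l a..?l b}" using assms(2) by (auto intro: mult_left_mono)
  have cont_\<gamma>: "continuous_on {?l a..?l b} \<gamma>" using assms(1) by (simp add: C1_curve_on_def)
  have "continuous_on {a..b} (\<lambda>t. \<gamma> (?l t))"
    by (rule continuous_on_compose2[OF cont_\<gamma>]) (use l in \<open>auto intro!: continuous_intros\<close>)
  then have "continuous_on {a..b} \<gamma>'" by (rule continuous_on_eq) (simp add: \<gamma>')
  moreover have "\<exists>D. continuous_on ({a..b} \<inter> \<gamma>' -` cdom c) D \<and>
      (\<forall>t \<in> {a..b} \<inter> \<gamma>' -` cdom c. ((coord c \<circ> \<gamma>') has_vector_derivative D t) (at t within {a..b}))"
    if c: "c \<in> A" for c
  proof -
    obtain D where D: "continuous_on ({?l a..?l b} \<inter> \<gamma> -` cdom c) D"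
      "\<forall>t \<in> {?l a..?l b} \<inter> \<gamma> -` cdom c. ((coord c \<circ> \<gamma>) has_vector_derivative D t) (at t within {?l a..?l b})"
      using bspec[OF conjunct2[OF assms(1)[unfolded C1_curve_on_def]] c] by (elim exE conjE)
    have l_in: "?l t \<in> {?l a..?l b} \<inter> \<gamma> -` cdom c" if "t \<in> {a..b} \<inter> \<gamma>' -` cdom c" for t
      using that l assms(2) by (auto simp: \<gamma>' intro: mult_left_mono)
    show ?thesis
    proof (intro exI[of _ "\<lambda>t. m *\<^sub>R D (?l t)"] conjI ballI)
      show "continuous_on ({a..b} \<inter> \<gamma>' -` cdom c) (\<lambda>t. m *\<^sub>R D (?l t))"
        by (intro continuous_on_scaleR continuous_on_const continuous_on_compose2[OF D(1)])
          (use l_in in \<open>auto intro!: continuous_intros\<close>)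
      fix t assume t: "t \<in> {a..b} \<inter> \<gamma>' -` cdom c"
      have "(?l has_vector_derivative m) (at t within {a..b})"
        by (auto intro!: derivative_eq_intros simp: has_vector_derivative_def)
      moreover have "((coord c \<circ> \<gamma>) has_vector_derivative D (?l t)) (at (?l t) within ?l ` {a..b})"
        by (rule has_vector_derivative_within_subset[OF D(2)[rule_format, OF l_in[OF t]] l])
      ultimately have "((coord c \<circ> \<gamma>) \<circ> ?l has_vector_derivative m *\<^sub>R D (?l t)) (at t within {a..b})"
        by (rule vector_diff_chain_within)
      then show "((coord c \<circ> \<gamma>') has_vector_derivative m *\<^sub>R D (?l t)) (at t within {a..b})"
        by (rule has_vector_derivative_transform[rotated 2]) (use t \<gamma>' in auto)
    qed
  qed
  ultimately show ?thesis unfolding C1_curve_on_def by blast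
qed

lemma joined_trans:
  assumes "joined x y" "joined y z"
  shows "joined x z"
proof -
  obtain \<gamma>1 \<gamma>2 where \<gamma>: "piecewise_C1_path A \<gamma>1" "\<gamma>1 0 = x" "\<gamma>1 1 = y"
    "piecewise_C1_path A \<gamma>2" "\<gamma>2 0 = y" "\<gamma>2 1 = z"
    using assms unfolding joined_def by blast
  obtain S1 where S1: "finite S1"
    "\<forall>a b. 0 \<le> a \<and> a < b \<and> b \<le> 1 \<and> {a<..<b} \<inter> S1 = {} \<longrightarrow> C1_curve_on A a b \<gamma>1"
    using \<gamma>(1) unfolding piecewise_C1_path_def by blast
  obtain S2 where S2: "finite S2"
    "\<forall>a b. 0 \<le> a \<and> a < b \<and> b \<le> 1 \<and> {a<..<b} \<inter> S2 = {} \<longrightarrow> C1_curve_on A a b \<gamma>2"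
    using \<gamma>(4) unfolding piecewise_C1_path_def by blast
  let ?\<gamma> = "\<gamma>1 +++ \<gamma>2"
  let ?S = "insert (1 / 2) ((\<lambda>s. s / 2) ` S1 \<union> (\<lambda>s. (s + 1) / 2) ` S2)"
  have "path \<gamma>1" "path \<gamma>2" using \<gamma>(1,4) by (simp_all add: path_def piecewise_C1_path_def)
  then have "path ?\<gamma>" using \<gamma>(3,5) by (intro path_join_imp) (simp_all add: pathfinish_def pathstart_def)
  then have "continuous_on {0..1} ?\<gamma>" by (simp add: path_def)
  moreover have "finite ?S" using S1(1) S2(1) by simp
  moreover have "C1_curve_on A a b ?\<gamma>" if ab: "0 \<le> a" "a < b" "b \<le> 1" "{a<..<b} \<inter> ?S = {}" for a b
  proof -
    have "\<not> (a < 1 / 2 \<and> 1 / 2 < b)" using ab(4) by auto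
    then consider "b \<le> 1 / 2" | "1 / 2 \<le> a" by linarith
    then show ?thesis
    proof cases
      case 1
      have "{2 * a + 0<..<2 * b + 0} \<inter> S1 = {}"
      proof (rule ccontr)
        assume "{2 * a + 0<..<2 * b + 0} \<inter> S1 \<noteq> {}"
        then obtain s where "s \<in> S1" "2 * a < s" "s < 2 * b" by auto
        then have "s / 2 \<in> {a<..<b} \<inter> ?S" by auto
        then show False using ab(4) by blast
      qed
      moreover have "0 \<le> 2 * a + 0" "2 * a + 0 < 2 * b + 0" "2 * b + 0 \<le> 1" using ab 1 by auto
      ultimately have "C1_curve_on A (2 * a + 0) (2 * b + 0) \<gamma>1" using S1(2) by blast
      then show ?thesis by (rule C1_curve_on_affine) (use 1 in \<open>auto simp: joinpaths_def\<close>)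
    next
      case 2
      have "{2 * a + - 1<..<2 * b + - 1} \<inter> S2 = {}"
      proof (rule ccontr)
        assume "{2 * a + - 1<..<2 * b + - 1} \<inter> S2 \<noteq> {}"
        then obtain s where s: "s \<in> S2" "2 * a + - 1 < s" "s < 2 * b + - 1" by auto
        then have "(s + 1) / 2 \<in> {a<..<b}" by auto
        moreover have "(s + 1) / 2 \<in> ?S" using s(1) by blast
        ultimately show False using ab(4) by blast
      qed
      moreover have "0 \<le> 2 * a + - 1" "2 * a + - 1 < 2 * b + - 1" "2 * b + - 1 \<le> 1" using ab 2 by auto
      ultimately have C2: "C1_curve_on A (2 * a + - 1) (2 * b + - 1) \<gamma>2" using S2(2) by blast
      show ?thesis
      proof (rule C1_curve_on_affine[OF C2])
        show "?\<gamma> t = \<gamma>2 (2 * t + - 1)" if "t \<in> {a..b}" for t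
        \<comment> \<open>At the junction \<open>joinpaths\<close> still uses the first path, whose
          end is the start of the second.\<close>
        proof (cases "t = 1 / 2")
          case True
          show ?thesis unfolding True using \<gamma>(3,5) by (simp add: joinpaths_def)
        next
          case False
          then show ?thesis using that 2 by (simp add: joinpaths_def)
        qed
      qed simp
    qed
  qed
  ultimately have "piecewise_C1_path A ?\<gamma>" unfolding piecewise_C1_path_def by blast
  moreover have "?\<gamma> 0 = x" "?\<gamma> 1 = z" using \<gamma>(2,6) by (simp_all add: joinpaths_def)
  ultimately show ?thesis unfolding joined_def by blast
qed

text \<open>A straight segment in the coordinates of \<open>c\<close> is \<open>C1\<close> in every
  chart because the transitions are smooth.\<close>

lemma joined_in_chart:
  assumes c: "c \<in> A" and B: "convex B" "B \<subseteq> coord c ` cdom c" and pq: "p \<in> B" "q \<in> B"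
  shows "joined (param c p) (param c q)"
proof -
  let ?l = "\<lambda>t::real. p + t *\<^sub>R (q - p)"
  have l: "?l t \<in> coord c ` cdom c" if "t \<in> {0..1}" for t
  proof -
    have "(1 - t) *\<^sub>R p + t *\<^sub>R q \<in> B" using that by (intro convexD_alt[OF B(1) pq]) auto
    then show ?thesis using B(2) by (auto simp: algebra_simps)
  qed
  define \<gamma> where "\<gamma> t = param c (?l t)" for t
  have cont: "continuous_on {0..1} \<gamma>"
    unfolding \<gamma>_def
    by (rule continuous_on_compose2[OF continuous_param[OF c]]) (use l in \<open>auto intro!: continuous_intros\<close>)
  have "C1_curve_on A a b \<gamma>" if ab: "0 \<le> a" "a < b" "b \<le> 1" for a b
    unfolding C1_curve_on_def
  proof (intro conjI ballI)
    show "continuous_on {a..b} \<gamma>" using ab by (intro continuous_on_subset[OF cont]) auto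
    fix d assume d: "d \<in> A"
    let ?F = "\<lambda>t. frechet_derivative (coord d \<circ> param c) (at (?l t)) (q - p)"
    have mem: "?l t \<in> coord c ` (cdom c \<inter> cdom d)" if "t \<in> {a..b} \<inter> \<gamma> -` cdom d" for t
    proof -
      have t: "?l t \<in> coord c ` cdom c" using that ab by (intro l) auto
      have "coord c (\<gamma> t) = ?l t" unfolding \<gamma>_def by (rule coord_param[OF c t])
      moreover have "\<gamma> t \<in> cdom c" unfolding \<gamma>_def by (rule param_in[OF c t])
      ultimately show ?thesis using that by (metis IntD2 IntI image_eqI vimageD)
    qed
    show "\<exists>D. continuous_on ({a..b} \<inter> \<gamma> -` cdom d) D \<and>
        (\<forall>t\<in>{a..b} \<inter> \<gamma> -` cdom d. ((coord d \<circ> \<gamma>) has_vector_derivative D t) (at t within {a..b}))"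
    proof (intro exI[of _ ?F] conjI ballI)
      show "continuous_on ({a..b} \<inter> \<gamma> -` cdom d) ?F"
        by (rule continuous_on_compose2[OF continuous_transition_derivative[OF c d]])
          (use mem in \<open>auto intro!: continuous_intros\<close>)
      fix t assume t: "t \<in> {a..b} \<inter> \<gamma> -` cdom d"
      let ?L = "frechet_derivative (coord d \<circ> param c) (at (?l t))"
      have deriv: "((coord d \<circ> param c) has_derivative ?L) (at (?l t))"
        by (rule transition_has_derivative[OF c d mem[OF t]])
      have "(?l has_derivative (\<lambda>h. h *\<^sub>R (q - p))) (at t)"
        by (auto intro!: derivative_eq_intros)
      then have "((coord d \<circ> param c) \<circ> ?l has_derivative ?L \<circ> (\<lambda>h. h *\<^sub>R (q - p))) (at t)"
        using deriv by (rule diff_chain_at)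
      moreover have "?L \<circ> (\<lambda>h. h *\<^sub>R (q - p)) = (\<lambda>h. h *\<^sub>R ?L (q - p))"
        using has_derivative_linear[OF deriv] by (auto simp: linear_scale)
      moreover have "(coord d \<circ> param c) \<circ> ?l = coord d \<circ> \<gamma>" by (auto simp: \<gamma>_def)
      ultimately show "((coord d \<circ> \<gamma>) has_vector_derivative ?F t) (at t within {a..b})"
        unfolding has_vector_derivative_def by (metis has_derivative_at_withinI)
    qed
  qed
  then have "piecewise_C1_path A \<gamma>"
    unfolding piecewise_C1_path_def using cont by (intro conjI exI[of _ "{}"]) auto
  moreover have "\<gamma> 0 = param c p" "\<gamma> 1 = param c q" by (simp_all add: \<gamma>_def)
  ultimately show ?thesis unfolding joined_def by blast
qed

text \<open>Recording both directions lets the connectedness argument do without reversing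
  paths.\<close>

lemma joined_neighbourhood:
  obtains N where "open N" "x \<in> N" "\<And>y. y \<in> N \<Longrightarrow> joined x y \<and> joined y x"
proof -
  let ?c = "chart_at A x"
  obtain r where r: "0 < r" "ball (coord ?c x) r \<subseteq> coord ?c ` cdom ?c"
    using openE[OF open_coord_image[OF chart_at(1)], of "coord ?c x" x] chart_at(2) by blast
  show thesis
  proof (rule that[of "param ?c ` ball (coord ?c x) r"])
    show "open (param ?c ` ball (coord ?c x) r)"
      by (rule open_param_image[OF chart_at(1) open_ball r(2)])
    have x: "param ?c (coord ?c x) = x" by (rule param_coord) (rule chart_at)+
    have center: "coord ?c x \<in> ball (coord ?c x) r" using r(1) by simp
    show "x \<in> param ?c ` ball (coord ?c x) r" using imageI[OF center, of "param ?c"] x by simp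
    fix y assume "y \<in> param ?c ` ball (coord ?c x) r"
    then obtain q where q: "q \<in> ball (coord ?c x) r" "y = param ?c q" by blast
    show "joined x y \<and> joined y x"
      using joined_in_chart[OF chart_at(1) convex_ball r(2) center q(1)]
        joined_in_chart[OF chart_at(1) convex_ball r(2) q(1) center] x q(2) by simp
  qed
qed

lemma joined_if_connected:
  assumes "connected (UNIV :: 'm set)"
  shows "joined x y"
proof -
  let ?S = "{z. joined x z}"
  have "open ?S"
  proof (subst open_subopen, rule ballI)
    fix z assume z: "z \<in> ?S"
    obtain N where N: "open N" "z \<in> N" "\<And>y. y \<in> N \<Longrightarrow> joined z y \<and> joined y z"
      by (rule joined_neighbourhood[of z]) blast
    then have "N \<subseteq> ?S" using z joined_trans by blast
    then show "\<exists>T. open T \<and> z \<in> T \<and> T \<subseteq> ?S" using N by blast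
  qed
  moreover have "open (- ?S)"
  proof (subst open_subopen, rule ballI)
    fix z assume z: "z \<in> - ?S"
    obtain N where N: "open N" "z \<in> N" "\<And>y. y \<in> N \<Longrightarrow> joined z y \<and> joined y z"
      by (rule joined_neighbourhood[of z]) blast
    then have "N \<subseteq> - ?S" using z joined_trans by blast
    then show "\<exists>T. open T \<and> z \<in> T \<and> T \<subseteq> - ?S" using N by blast
  qed
  ultimately have "?S = {} \<or> ?S = UNIV"
    using assms by (auto simp: connected_clopen closed_def)
  moreover have "joined x x"
    by (rule joined_neighbourhood[of x]) blast
  ultimately show ?thesis by blast
qed

text \<open>Finitely many charts cover the space, and each of them carries over a countable base of
  \<open>'e\<close>.\<close>

lemma countable_base_if_compact:
  assumes "compact (UNIV :: 'm set)"
  obtains \<B> :: "'m set set" where "countable \<B>" "\<And>B. B \<in> \<B> \<Longrightarrow> open B"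
    "\<And>V x. \<lbrakk>open V; x \<in> V\<rbrakk> \<Longrightarrow> \<exists>B\<in>\<B>. x \<in> B \<and> B \<subseteq> V"
proof -
  have "(UNIV :: 'm set) \<subseteq> (\<Union>c\<in>A. cdom c)" using chart_at by blast
  then obtain F where F: "F \<subseteq> A" "finite F" "(UNIV :: 'm set) \<subseteq> (\<Union>c\<in>F. cdom c)"
    by (rule compactE_image[OF assms open_cdom, rotated])
  obtain \<E> :: "'e set set" where \<E>: "countable \<E>" "\<And>C. C \<in> \<E> \<Longrightarrow> open C"
    "\<And>S. open S \<Longrightarrow> \<exists>U. U \<subseteq> \<E> \<and> S = \<Union>U"
    by (rule univ_second_countable) blast
  show thesis
  proof (rule that[of "\<Union>c\<in>F. (\<lambda>B. param c ` (B \<inter> coord c ` cdom c)) ` \<E>"])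
    show "countable (\<Union>c\<in>F. (\<lambda>B. param c ` (B \<inter> coord c ` cdom c)) ` \<E>)"
      by (intro countable_UN countable_image \<E>(1) countable_finite[OF F(2)])
    show "open B" if B: "B \<in> (\<Union>c\<in>F. (\<lambda>B. param c ` (B \<inter> coord c ` cdom c)) ` \<E>)" for B
    proof -
      obtain c C where cC: "c \<in> F" "C \<in> \<E>" "B = param c ` (C \<inter> coord c ` cdom c)" using B by blast
      have "c \<in> A" using cC(1) F(1) by blast
      then show ?thesis
        unfolding cC(3) by (intro open_param_image open_Int \<E>(2) cC(2) open_coord_image) auto
    qed
    fix V and x :: 'm assume V: "open V" "x \<in> V"
    obtain c where c: "c \<in> F" "x \<in> cdom c" using F(3) by blast
    then have cA: "c \<in> A" using F(1) by blast
    have "open (coord c ` (cdom c \<inter> V))" by (rule open_coord_subimage[OF cA V(1)])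
    then obtain U where U: "U \<subseteq> \<E>" "coord c ` (cdom c \<inter> V) = \<Union>U" using \<E>(3) by blast
    have "coord c x \<in> \<Union>U" using c(2) V(2) U(2) by blast
    then obtain C where C: "C \<in> U" "coord c x \<in> C" by blast
    have sub: "C \<subseteq> coord c ` (cdom c \<inter> V)" using C(1) U(2) by blast
    show "\<exists>B\<in>\<Union>c\<in>F. (\<lambda>B. param c ` (B \<inter> coord c ` cdom c)) ` \<E>. x \<in> B \<and> B \<subseteq> V"
    proof (intro bexI conjI)
      show "param c ` (C \<inter> coord c ` cdom c) \<in> (\<Union>c\<in>F. (\<lambda>B. param c ` (B \<inter> coord c ` cdom c)) ` \<E>)"
        using c(1) C(1) U(1) by blast
      show "x \<in> param c ` (C \<inter> coord c ` cdom c)"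
        using C(2) c(2) param_coord[OF cA c(2)] by (intro image_eqI[of _ _ "coord c x"]) auto
      show "param c ` (C \<inter> coord c ` cdom c) \<subseteq> V"
      proof
        fix z assume "z \<in> param c ` (C \<inter> coord c ` cdom c)"
        then obtain v where v: "v \<in> C" "z = param c v" by blast
        obtain w where w: "w \<in> cdom c \<inter> V" "v = coord c w" using subsetD[OF sub v(1)] by blast
        then show "z \<in> V" using param_coord[OF cA, of w] v(2) by simp
      qed
    qed
  qed
qed

end

context riemannian_manifold begin

text \<open>A path from near \<open>x\<close> to the outside of \<open>V\<close> crosses the shell
  between the radii \<open>r\<close> and \<open>2 * r\<close> of a chart ball in \<open>V\<close>,
  at a cost of at least \<open>\<kappa> * r\<close>.\<close>

lemma riemannian_dist_neighbourhood:
  assumes "connected (UNIV :: 'm set)" "open V" "x \<in> V"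
  shows "\<exists>N e. open N \<and> x \<in> N \<and> N \<subseteq> V \<and> 0 < e \<and>
    (\<forall>y\<in>N. \<forall>z. riemannian_dist A G y z \<le> e \<longrightarrow> z \<in> V)"
proof -
  let ?c = "chart_at A x"
  let ?p = "coord ?c x"
  have "open (coord ?c ` (cdom ?c \<inter> V))" by (rule open_coord_subimage[OF chart_at(1) assms(2)])
  moreover have "?p \<in> coord ?c ` (cdom ?c \<inter> V)" using chart_at(2) assms(3) by blast
  ultimately have "\<exists>R>0. cball ?p R \<subseteq> coord ?c ` (cdom ?c \<inter> V)" by (simp only: open_contains_cball)
  then obtain R where R: "0 < R" "cball ?p R \<subseteq> coord ?c ` (cdom ?c \<inter> V)" by blast
  define r where "r = R / 2"
  have r: "0 < r" "cball ?p (2 * r) \<subseteq> coord ?c ` (cdom ?c \<inter> V)" using R by (simp_all add: r_def)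
  then have ball: "cball ?p (2 * r) \<subseteq> coord ?c ` cdom ?c" by blast
  obtain \<kappa> where \<kappa>: "0 < \<kappa>" "\<And>y v. y \<in> cball ?p (2 * r) \<Longrightarrow>
      \<kappa> * norm v \<le> tnorm G (param ?c y) (vec_of_coords A ?c (param ?c y) v)"
    by (rule chart_metric_lower_bound[OF chart_at(1) compact_cball ball]) blast
  have sub: "param ?c ` ball ?p (2 * r) \<subseteq> V"
  proof
    fix z assume "z \<in> param ?c ` ball ?p (2 * r)"
    then obtain v where v: "v \<in> ball ?p (2 * r)" "z = param ?c v" by blast
    then have "v \<in> coord ?c ` (cdom ?c \<inter> V)" using r(2) ball_subset_cball by blast
    then obtain w where w: "w \<in> cdom ?c \<inter> V" "v = coord ?c w" by blast
    then show "z \<in> V" using param_coord[OF chart_at(1), of w x] v(2) by simp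
  qed
  have balls: "ball ?p r \<subseteq> ball ?p (2 * r)" using r(1) by (intro subset_ball) simp
  have far: "\<kappa> * r \<le> riemannian_dist A G y z" if y: "y \<in> param ?c ` ball ?p r" and z: "z \<notin> V" for y z
    unfolding length_dist_def
  proof (rule cInf_greatest)
    show "{path_length A G \<gamma> |\<gamma>. piecewise_C1_path A \<gamma> \<and> \<gamma> ` {0..1} \<subseteq> UNIV \<and> \<gamma> 0 = y \<and> \<gamma> 1 = z} \<noteq> {}"
      using joined_if_connected[OF assms(1), of y z] unfolding joined_def by blast
    fix l assume "l \<in> {path_length A G \<gamma> |\<gamma>. piecewise_C1_path A \<gamma> \<and> \<gamma> ` {0..1} \<subseteq> UNIV \<and> \<gamma> 0 = y \<and> \<gamma> 1 = z}"
    then obtain \<gamma> where \<gamma>: "l = path_length A G \<gamma>" "piecewise_C1_path A \<gamma>" "\<gamma> 0 = y" "\<gamma> 1 = z" by blast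
    show "\<kappa> * r \<le> l"
      unfolding \<gamma>(1)
      by (rule path_length_ge[OF \<gamma>(2) chart_at(1) r(1) ball \<kappa>]) (use \<gamma>(3,4) y z sub in auto)
  qed
  show ?thesis
  proof (intro exI conjI ballI allI impI)
    show "open (param ?c ` ball ?p r)"
      by (rule open_param_image[OF chart_at(1) open_ball]) (use ball balls ball_subset_cball in blast)
    show "x \<in> param ?c ` ball ?p r"
      using r(1) param_coord[OF chart_at] by (intro image_eqI[of _ _ ?p]) auto
    show "param ?c ` ball ?p r \<subseteq> V" using sub balls by blast
    show "0 < \<kappa> * r / 2" using \<kappa>(1) r(1) by simp
    show "z \<in> V" if "y \<in> param ?c ` ball ?p r" "riemannian_dist A G y z \<le> \<kappa> * r / 2" for y z
      using far[OF that(1), of z] that(2) \<open>0 < \<kappa> * r / 2\<close> by fastforce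
  qed
qed

lemma riemannian_dist_uniform:
  fixes \<Phi> :: "'m \<Rightarrow> 'b::metric_space"
  assumes "compact (UNIV :: 'm set)" "connected (UNIV :: 'm set)" "continuous_on UNIV \<Phi>" "0 < \<eta>"
  shows "\<exists>e>0. \<forall>x y. riemannian_dist A G x y \<le> e \<longrightarrow> dist (\<Phi> x) (\<Phi> y) \<le> \<eta>"
proof -
  have "\<exists>N e. open N \<and> x \<in> N \<and> N \<subseteq> {y. dist (\<Phi> x) (\<Phi> y) < \<eta> / 2} \<and> 0 < e \<and>
    (\<forall>y\<in>N. \<forall>z. riemannian_dist A G y z \<le> e \<longrightarrow> z \<in> {y. dist (\<Phi> x) (\<Phi> y) < \<eta> / 2})" for x
    by (rule riemannian_dist_neighbourhood[OF assms(2)])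
      (use assms(4) in \<open>auto intro!: open_Collect_less continuous_intros assms(3)\<close>)
  then obtain N e where N: "\<And>x. open (N x)" "\<And>x. x \<in> N x" "\<And>x. N x \<subseteq> {y. dist (\<Phi> x) (\<Phi> y) < \<eta> / 2}"
      "\<And>x. 0 < e x"
      "\<And>x. \<forall>y\<in>N x. \<forall>z. riemannian_dist A G y z \<le> e x \<longrightarrow> z \<in> {y. dist (\<Phi> x) (\<Phi> y) < \<eta> / 2}"
    by metis
  have "(UNIV :: 'm set) \<subseteq> (\<Union>x\<in>UNIV. N x)" using N(2) by blast
  then obtain F where F: "finite F" "(UNIV :: 'm set) \<subseteq> (\<Union>x\<in>F. N x)"
    by (rule compactE_image[OF assms(1) N(1)])
  define d where "d = Min (insert 1 (e ` F))"
  have "0 < d" using F(1) N(4) by (auto simp: d_def)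
  moreover have "dist (\<Phi> y) (\<Phi> z) \<le> \<eta>" if yz: "riemannian_dist A G y z \<le> d" for y z
  proof -
    obtain x where x: "x \<in> F" "y \<in> N x" using F(2) by blast
    have "d \<le> e x" using F(1) x(1) by (auto simp: d_def)
    then have "dist (\<Phi> x) (\<Phi> z) < \<eta> / 2" using N(5)[of x] x(2) yz by auto
    moreover have "dist (\<Phi> x) (\<Phi> y) < \<eta> / 2" using N(3)[of x] x(2) by blast
    ultimately show ?thesis using dist_triangle3[of "\<Phi> y" "\<Phi> z" "\<Phi> x"] by linarith
  qed
  ultimately show ?thesis by blast
qed

end

section \<open>The main theorem\<close>

lemma continuous_separating_function:
  fixes x y :: "'m::t2_space"
  assumes "compact (UNIV :: 'm set)" "x \<noteq> y"
  obtains f :: "'m \<Rightarrow> real" where "continuous_on UNIV f" "f x = 0" "f y = 1"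
proof -
  have "compact_space (euclidean :: 'm topology)"
    using assms(1) by (simp add: compact_space_def)
  moreover have "Hausdorff_space (euclidean :: 'm topology)"
    unfolding Hausdorff_space_def disjnt_def by (simp add: separation_t2)
  ultimately have normal: "normal_space (euclidean :: 'm topology)"
    by (intro compact_Hausdorff_or_regular_imp_normal_space disjI1)
  have closed: "closedin euclidean {x}" "closedin euclidean {y}" "disjnt {x} {y}"
    using assms(2) by (simp_all add: closed_closedin[symmetric])
  obtain f :: "'m \<Rightarrow> real" where f: "continuous_map euclidean euclideanreal f"
      "f ` {x} \<subseteq> {0}" "f ` {y} \<subseteq> {1}"
    by (rule Urysohn_lemma_alt[OF normal closed])
  show thesis by (rule that[of f]) (use f in simp_all)
qed

text \<open>As in Urysohn's metrisation theorem, one function is chosen for each pair of base sets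
  that can be separated by the values 0 and 1; these countably many functions separate
  points.\<close>

lemma continuous_injection_into_sequences:
  fixes \<B> :: "'m::t2_space set set"
  assumes compact: "compact (UNIV :: 'm set)"
    and \<B>: "countable \<B>" "\<And>V x. \<lbrakk>open V; x \<in> V\<rbrakk> \<Longrightarrow> \<exists>B\<in>\<B>. x \<in> B \<and> B \<subseteq> V"
  obtains \<Phi> :: "'m \<Rightarrow> nat \<Rightarrow> real" where "continuous_on UNIV \<Phi>" "inj \<Phi>"
proof -
  define P :: "'m set \<times> 'm set \<Rightarrow> ('m \<Rightarrow> real) \<Rightarrow> bool" where
    "P = (\<lambda>(B, B') f. continuous_on UNIV f \<and> (\<forall>x\<in>B. f x = 0) \<and> (\<forall>x\<in>B'. f x = 1))"
  define \<F> where "\<F> = insert (\<lambda>_. 0) ((\<lambda>p. SOME f. P p f) ` {p \<in> \<B> \<times> \<B>. \<exists>f. P p f})"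
  have \<F>: "countable \<F>" "\<F> \<noteq> {}"
    using \<B>(1) by (auto simp: \<F>_def intro!: countable_image countable_Collect countable_SIGMA)
  have cont: "continuous_on UNIV f" if f: "f \<in> \<F>" for f
  proof (cases "f = (\<lambda>_. 0)")
    case False
    then obtain p where p: "\<exists>f. P p f" "f = (SOME f. P p f)" using f unfolding \<F>_def by blast
    have "P p f" unfolding p(2) by (rule someI_ex[OF p(1)])
    then show ?thesis by (cases p) (simp add: P_def)
  qed simp
  define \<Phi> :: "'m \<Rightarrow> nat \<Rightarrow> real" where "\<Phi> x n = from_nat_into \<F> n x" for x n
  show thesis
  proof (rule that[of \<Phi>])
    show "continuous_on UNIV \<Phi>"
      by (rule continuous_on_coordinatewise_then_product)
        (simp add: \<Phi>_def cont[OF from_nat_into[OF \<F>(2)]])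
    show "inj \<Phi>"
    proof (rule injI, rule ccontr)
      fix x y assume eq: "\<Phi> x = \<Phi> y" and "x \<noteq> y"
      then obtain f where f: "continuous_on UNIV f" "f x = 0" "f y = (1 :: real)"
        using continuous_separating_function[OF compact] by metis
      have "open {z. f z < 1 / 3}" "open {z. 2 / 3 < f z}"
        by (intro open_Collect_less f(1) continuous_intros)+
      then obtain B B' where B: "B \<in> \<B>" "x \<in> B" "B \<subseteq> {z. f z < 1 / 3}"
        and B': "B' \<in> \<B>" "y \<in> B'" "B' \<subseteq> {z. 2 / 3 < f z}"
        using \<B>(2)[of "{z. f z < 1 / 3}" x] \<B>(2)[of "{z. 2 / 3 < f z}" y] f by auto
      \<comment> \<open>Truncation makes the values exactly 0 on \<open>B\<close> and 1 on
        \<open>B'\<close>, so that any function chosen for this pair tells \<open>x\<close> from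
        \<open>y\<close>.\<close>
      define f' where "f' z = min 1 (max 0 (3 * f z - 1))" for z
      have "continuous_on UNIV f'" unfolding f'_def by (intro continuous_intros f(1))
      moreover have "\<forall>z\<in>B. f' z = 0" "\<forall>z\<in>B'. f' z = 1" using B(3) B'(3) by (auto simp: f'_def)
      ultimately have "P (B, B') f'" by (simp add: P_def)
      then have ex: "\<exists>f. P (B, B') f" by blast
      define h where "h = (SOME f. P (B, B') f)"
      have "P (B, B') h" unfolding h_def by (rule someI_ex[OF ex])
      then have "h x = 0" "h y = 1" using B(2) B'(2) by (simp_all add: P_def)
      have "(B, B') \<in> {p \<in> \<B> \<times> \<B>. \<exists>f. P p f}" using ex B(1) B'(1) by simp
      then have "h \<in> \<F>" unfolding \<F>_def h_def by blast
      then obtain n where "from_nat_into \<F> n = h" using from_nat_into_surj[OF \<F>(1)] by blast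
      then have "\<Phi> x n = 0" "\<Phi> y n = 1" using \<open>h x = 0\<close> \<open>h y = 1\<close> by (simp_all add: \<Phi>_def)
      then show False using eq by simp
    qed
  qed
qed

text \<open>The definition numbers the blocks from 1, the construction from 0; all sequences are
  shifted by one.\<close>

lemma almost_product_propertyE:
  fixes f :: "'a \<Rightarrow> 'a"
  assumes "almost_product_property d f g"
  obtains thr :: "real \<Rightarrow> nat" where
    "\<And>x e n (k :: nat). \<lbrakk>\<And>j. 0 < e j; \<And>j. thr (e j) \<le> n j\<rbrakk> \<Longrightarrow>
      \<exists>z. \<forall>j<k. (f ^^ (\<Sum>i<j. n i)) z \<in> g_dynamical_ball d f g (n j) (x j) (e j)"
proof -
  obtain m :: "real \<Rightarrow> nat" where m: "\<forall>k::nat. k \<ge> 1 \<longrightarrow> (\<forall>x \<epsilon> n. (\<forall>j\<in>{1..k}. \<epsilon> j > 0 \<and> n j \<ge> m (\<epsilon> j)) \<longrightarrow>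
      (\<Inter>j\<in>{1..k}. (f ^^ (\<Sum>i\<in>{1..<j}. n i)) -` g_dynamical_ball d f g (n j) (x j) (\<epsilon> j)) \<noteq> {})"
    using assms unfolding almost_product_property_def by blast
  show thesis
  proof (rule that[of m])
    fix x :: "nat \<Rightarrow> 'a" and e :: "nat \<Rightarrow> real" and n :: "nat \<Rightarrow> nat" and k :: nat
    assume e: "\<And>j. 0 < e j" and n: "\<And>j. m (e j) \<le> n j"
    show "\<exists>z. \<forall>j<k. (f ^^ (\<Sum>i<j. n i)) z \<in> g_dynamical_ball d f g (n j) (x j) (e j)"
    proof (cases "k = 0")
      case False
      have "(\<Inter>j\<in>{1..k}. (f ^^ (\<Sum>i\<in>{1..<j}. n (i - 1))) -`
          g_dynamical_ball d f g (n (j - 1)) (x (j - 1)) (e (j - 1))) \<noteq> {}"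
        using m[rule_format, of k "\<lambda>j. e (j - 1)" "\<lambda>j. n (j - 1)" "\<lambda>j. x (j - 1)"] False e n by simp
      then obtain z where z: "\<And>j. j \<in> {1..k} \<Longrightarrow> (f ^^ (\<Sum>i\<in>{1..<j}. n (i - 1))) z \<in>
          g_dynamical_ball d f g (n (j - 1)) (x (j - 1)) (e (j - 1))" by blast
      have "(f ^^ (\<Sum>i<j. n i)) z \<in> g_dynamical_ball d f g (n j) (x j) (e j)" if "j < k" for j
      proof -
        have "(\<Sum>i\<in>{1..<Suc j}. n (i - 1)) = (\<Sum>i<j. n i)"
          by (induction j) (simp_all add: sum.atLeastLessThan_Suc)
        then show ?thesis using z[of "Suc j"] that by simp
      qed
      then show ?thesis by blast
    qed simp
  qed
qed

lemma g_dynamical_ball_mono: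
  assumes "\<And>y z. d y z \<le> e \<Longrightarrow> d' y z \<le> e'"
  shows "g_dynamical_ball d f g n x e \<subseteq> g_dynamical_ball d' f g n x e'"
  using assms unfolding g_dynamical_ball_def by blast

theorem corollaryD1:
  fixes A :: "('m::t2_space, 'e::euclidean_space) chart set"
    and G :: "'m \<Rightarrow> 'e \<Rightarrow> 'e \<Rightarrow> real"
    and f :: "'m \<Rightarrow> 'm"
    and Es Ec Eu :: "'m \<Rightarrow> 'e set"
    and Wu :: "'m \<Rightarrow> 'm set"
    and g :: "nat \<Rightarrow> nat"
  assumes "smooth_atlas A"
    and "compact (UNIV :: 'm set)"
    and "connected (UNIV :: 'm set)"
    and "riemannian_metric A G"
    and "partially_hyperbolic A f Es Ec Eu"
    and "foliation_tangent_to A Eu Wu"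
    and "mistake_function g"
    and "almost_product_property (riemannian_dist A G) f g"
  shows "bowen_entropy f (completely_irregular_set f) \<ge> unstable_bowen_entropy A G Wu f UNIV"
proof -
  interpret riemannian_manifold A G using assms(1,4) by unfold_locales
  have f: "continuous_on UNIV f"
    using assms(5) by (simp add: partially_hyperbolic_def C1_diffeomorphism_def C1_map_def)
  obtain \<B> :: "'m set set" where \<B>: "countable \<B>" "\<And>B. B \<in> \<B> \<Longrightarrow> open B"
    "\<And>V x. \<lbrakk>open V; x \<in> V\<rbrakk> \<Longrightarrow> \<exists>B\<in>\<B>. x \<in> B \<and> B \<subseteq> V"
    by (rule countable_base_if_compact[OF assms(2)]) blast
  obtain \<Phi> :: "'m \<Rightarrow> nat \<Rightarrow> real" where \<Phi>: "continuous_on UNIV \<Phi>" "inj \<Phi>"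
    by (rule continuous_injection_into_sequences[OF assms(2) \<B>(1,3)])
  interpret sys: compact_system f \<Phi> using assms(2) f \<Phi> by unfold_locales
  obtain thr where thr: "\<And>x e n (k :: nat). \<lbrakk>\<And>j. 0 < e j; \<And>j. thr (e j) \<le> n j\<rbrakk> \<Longrightarrow>
      \<exists>z. \<forall>j<k. (f ^^ (\<Sum>i<j. n i)) z \<in> g_dynamical_ball (riemannian_dist A G) f g (n j) (x j) (e j)"
    by (rule almost_product_propertyE[OF assms(8)]) blast
  \<comment> \<open>A tolerance for \<open>D\<close> is translated into one for the Riemannian
    distance; the threshold for \<open>D\<close> is then \<open>thr\<close> after this
    translation.\<close>
  have "\<forall>\<eta>. \<exists>e. 0 < \<eta> \<longrightarrow> 0 < e \<and> (\<forall>x y. riemannian_dist A G x y \<le> e \<longrightarrow> sys.D x y \<le> \<eta>)"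
    using riemannian_dist_uniform[OF assms(2,3) \<Phi>(1)] unfolding sys.D_def by blast
  then obtain tol where tol: "\<And>\<eta>. 0 < \<eta> \<Longrightarrow> 0 < tol \<eta>"
    "\<And>\<eta> x y. \<lbrakk>0 < \<eta>; riemannian_dist A G x y \<le> tol \<eta>\<rbrakk> \<Longrightarrow> sys.D x y \<le> \<eta>" by metis
  interpret sys: almost_product_system f \<Phi> g "\<lambda>\<eta>. thr (tol \<eta>)"
  proof
    show "mistake_function g" by (rule assms(7))
    fix x :: "nat \<Rightarrow> 'm" and e :: "nat \<Rightarrow> real" and n :: "nat \<Rightarrow> nat" and k
    assume e: "\<And>j. 0 < e j" and n: "\<And>j. thr (tol (e j)) \<le> n j"
    obtain z where z: "\<forall>j<k. (f ^^ (\<Sum>i<j. n i)) z \<in>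
        g_dynamical_ball (riemannian_dist A G) f g (n j) (x j) (tol (e j))"
      using thr[of "\<lambda>j. tol (e j)" n k x] tol(1)[OF e] n by blast
    have "g_dynamical_ball (riemannian_dist A G) f g (n j) (x j) (tol (e j))
        \<subseteq> g_dynamical_ball sys.D f g (n j) (x j) (e j)" for j
      by (rule g_dynamical_ball_mono) (rule tol(2)[OF e])
    then show "\<exists>z. \<forall>j<k. (f ^^ (\<Sum>i<j. n i)) z \<in> g_dynamical_ball sys.D f g (n j) (x j) (e j)"
      using z by blast
  qed
  obtain \<Psi> :: "('m \<Rightarrow> real) set" where \<Psi>: "countable \<Psi>"
    "\<forall>\<phi> \<eta>. continuous_on UNIV \<phi> \<longrightarrow> 0 < \<eta> \<longrightarrow> (\<exists>\<psi>\<in>\<Psi>. \<forall>x. \<bar>\<phi> x - \<psi> x\<bar> < \<eta>)"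
    using countable_uniformly_dense_functions[OF assms(2) \<B>] by blast
  have "unstable_bowen_entropy A G Wu f UNIV \<le> bowen_entropy f UNIV"
    by (rule unstable_bowen_entropy_le)
  also have "\<dots> \<le> bowen_entropy f (completely_irregular_set f)"
    by (rule sys.bowen_entropy_completely_irregular_set[OF \<Psi>(1) \<Psi>(2)[rule_format]])
  finally show ?thesis .
qed

end
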